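(* Let $H$ be a compact Hopf $*$-algebra over $\mathbb{C}$ with integral $\int$ normalized by $\int(1_H)=1$, and let $H_{L^2}$ be the Hilbert space completion of $H$ for the scalar product $\langle a,b\rangle=\int(ab^* )$. Equip $H_{L^2}$ with the continuous extension $*$ of the convolution product, the system $\{e_K\mid K\in C_0(\Lambda)\}$, the coproduct $\Delta_*:H_{L^2}\to H_{L^2}\hat\otimes H_{L^2}$ and the counit $\varepsilon_*=\int$. Then $(H_{L^2},*,e_K,\Delta_*,\varepsilon_* )$ is a (topological) Hopf algebra with approximate unit.
   Context: $S$ is the antipode of $H$; Sweedler's notation is used. A compact Hopf $*$-algebra is a co-semisimple Hopf algebra $H$ over $\mathbb{C}$ with an involutive antilinear algebra anti-homomorphism $^*$ with $\Delta(h^* )=h_1^*\otimes h_2^*$, such that every simple right comodule $V$, $\delta(v)=v_0\otimes v_1$, has a scalar product with $\langle v_0,w\rangle S(v_1)=\langle v,w_0\rangle w_1^*$ for all $v,w\in V$. Its integral is the invariant functional: $x_1\int(x_2)=\int(x)1_H=\int(x_1)x_2$; it is positive definite. Convolution: $g*f:=\int(fS(g_1))\,g_2$ on $H$; it satisfies $\|f*g\|_{L^2}\le\|f\|_{L^2}\|g\|_{L^2}$ and so extends to $H_{L^2}$. Write $\check H$ for $H$ with this product. $\Lambda$ indexes the isomorphism classes of simple $H$-comodules $V_\lambda$, with $0\in\Lambda$ the trivial one; $H=\bigoplus_{\lambda}H_\lambda$ with $H_\lambda$ the coefficient coalgebra of $V_\lambda$. $C_0(\Lambda)$ is the set, ordered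 by inclusion, of finite subsets $K\subset\Lambda$ containing $0$; $\check H_K=\bigoplus_{\lambda\in K}H_\lambda$ with the convolution product is a unital algebra with unit $e_K$. Coproduct: for $h\in H$, $\Delta_*(h)\in H_{L^2}\hat\otimes H_{L^2}$ ($\hat\otimes$ is the Hilbert space tensor product) is the element representing (Riesz) the functional $g\otimes f\mapsto\int(hgf)$, i.e. $(\int\otimes\int)\big(\Delta_*(h)\cdot(g\otimes f)\big)=\int(hgf)$ for all $g,f\in H$; $\Delta_*$ is extended to $H_{L^2}$ by continuity. Counit: $\varepsilon_*(f)=\int(f)$. Definition. An approximate unit in a topological algebra $A$ without unit is a system $\{e_i\}_{i\in I}$ of idempotents indexed by a partially ordered set $I$ such that for each $a\in A$ the nets $\{e_ia\}$ and $\{ae_i\}$ converge to $a$; in a bialgebra one also requires $\varepsilon(e_i)=1$ for all $i$. A (topological) bialgebra with approximate unit is such an algebra with a coproduct $\Delta$ (with values in the completed tensor product) and a counit $\varepsilon$ which are algebra homomorphisms satisfying coassociativity and the counit axiom. A Hopf algebra with approximate unit is a bialgebra with approximate unit together with (i.e. for which there exists) a system of linear endomorphisms $\{S_i\mid i\in I\}$, called an approximate antipode, with $m(S_i\otimes\mathrm{id})\Delta=m(\mathrm{id}\otimes S_i)\Delta=e_i\varepsilon$ for all $i$, where $m$ is the product.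
   Formalization: The Hopf algebra claim is stated for every continuous Δ_* with the defining identity; such Δ_* into the Hilbert tensor product exists only if H is finite-dimensional (for C[z,1/z], Δ_*(1)=Σ zⁿ⊗z⁻ⁿ has infinite norm). The algebra, e_K and counit claims hold for all compact H. *)

theory Defs
  imports "HOL-Analysis.Analysis"
begin

section \<open>Complex vector spaces and algebras, Hilbert spaces\<close>

class complex_vector = ab_group_add +
  fixes scaleC :: "complex \<Rightarrow> 'a \<Rightarrow> 'a"  (infixr \<open>*\<^sub>C\<close> 75)
  assumes scaleC_add_right: "c *\<^sub>C (x + y) = c *\<^sub>C x + c *\<^sub>C y"
    and scaleC_add_left: "(c + d) *\<^sub>C x = c *\<^sub>C x + d *\<^sub>C x"
    and scaleC_scaleC: "c *\<^sub>C d *\<^sub>C x = (c * d) *\<^sub>C x"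
    and scaleC_one: "1 *\<^sub>C x = x"

interpretation complex_vector: vector_space "scaleC :: complex \<Rightarrow> 'a \<Rightarrow> 'a::complex_vector"
  by unfold_locales (simp_all add: scaleC_add_right scaleC_add_left scaleC_scaleC scaleC_one)

abbreviation clinear :: "('a::complex_vector \<Rightarrow> 'b::complex_vector) \<Rightarrow> bool"
  where "clinear \<equiv> Vector_Spaces.linear (*\<^sub>C) (*\<^sub>C)"

abbreviation csubspace :: "'a::complex_vector set \<Rightarrow> bool"
  where "csubspace \<equiv> module.subspace (*\<^sub>C)"

abbreviation cspan :: "'a::complex_vector set \<Rightarrow> 'a set"
  where "cspan \<equiv> module.span (*\<^sub>C)"

definition cbilinear :: "('a::complex_vector \<Rightarrow> 'b::complex_vector \<Rightarrow> 'c::complex_vector) \<Rightarrow> bool"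
  where "cbilinear \<beta> \<longleftrightarrow> (\<forall>b. clinear (\<lambda>a. \<beta> a b)) \<and> (\<forall>a. clinear (\<beta> a))"

instantiation complex :: complex_vector
begin
definition scaleC_complex :: "complex \<Rightarrow> complex \<Rightarrow> complex"
  where "scaleC_complex c x = c * x"
instance
  by standard (simp_all add: scaleC_complex_def algebra_simps)
end

class complex_algebra_1 = complex_vector + ring_1 +
  assumes mult_scaleC_left: "(c *\<^sub>C x) * y = c *\<^sub>C (x * y)"
    and mult_scaleC_right: "x * (c *\<^sub>C y) = c *\<^sub>C (x * y)"

text \<open>The scalar product is linear in its first argument, as \<open>\<langle>a,b\<rangle> = \<integral>(ab\<^sup>*)\<close> is.\<close>

class complex_hilbert_space = complex_vector + banach +
  fixes cinner :: "'a \<Rightarrow> 'a \<Rightarrow> complex"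
  assumes scaleR_scaleC: "r *\<^sub>R x = complex_of_real r *\<^sub>C x"
    and cinner_commute: "cinner x y = cnj (cinner y x)"
    and cinner_add_left: "cinner (x + y) z = cinner x z + cinner y z"
    and cinner_scaleC_left: "cinner (c *\<^sub>C x) y = c * cinner x y"
    and cinner_norm: "cinner x x = complex_of_real ((norm x)\<^sup>2)"

definition bounded_clinear ::
  "('a::{complex_vector,real_normed_vector} \<Rightarrow> 'b::{complex_vector,real_normed_vector}) \<Rightarrow> bool"
  where "bounded_clinear f \<longleftrightarrow> bounded_linear f \<and> clinear f"

definition bounded_cbilinear ::
  "('a::{complex_vector,real_normed_vector} \<Rightarrow> 'b::{complex_vector,real_normed_vector}
    \<Rightarrow> 'c::{complex_vector,real_normed_vector}) \<Rightarrow> bool"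
  where "bounded_cbilinear \<beta> \<longleftrightarrow> bounded_bilinear \<beta> \<and> cbilinear \<beta>"


section \<open>The algebraic tensor product\<close>

text \<open>Elements of \<open>A \<otimes> B\<close> are formal finite sums of pairs (scalars can be absorbed in either
  factor) modulo the congruence generated by commutativity and bilinearity.\<close>

inductive tensor_cong ::
  "('a::complex_vector \<times> 'b::complex_vector) list \<Rightarrow> ('a \<times> 'b) list \<Rightarrow> bool"
  where
    refl: "tensor_cong xs xs"
  | sym: "tensor_cong xs ys \<Longrightarrow> tensor_cong ys xs"
  | trans: "tensor_cong xs ys \<Longrightarrow> tensor_cong ys zs \<Longrightarrow> tensor_cong xs zs"
  | append: "tensor_cong xs ys \<Longrightarrow> tensor_cong us vs \<Longrightarrow> tensor_cong (xs @ us) (ys @ vs)"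
  | commute: "tensor_cong (xs @ ys) (ys @ xs)"
  | add_left: "tensor_cong [(a + a', b)] [(a, b), (a', b)]"
  | add_right: "tensor_cong [(a, b + b')] [(a, b), (a, b')]"
  | scale: "tensor_cong [(c *\<^sub>C a, b)] [(a, c *\<^sub>C b)]"
  | zero: "tensor_cong [(0, b)] []"

quotient_type (overloaded) ('a, 'b) tensor = "('a::complex_vector \<times> 'b::complex_vector) list" / tensor_cong
  by (rule equivpI)
    (auto intro!: reflpI sympI transpI intro: tensor_cong.refl tensor_cong.sym tensor_cong.trans)

lift_definition tens :: "'a::complex_vector \<Rightarrow> 'b::complex_vector \<Rightarrow> ('a, 'b) tensor"
    (infixr \<open>\<otimes>\<close> 76)
  is "\<lambda>a b. [(a, b)]" .

instantiation tensor :: (complex_vector, complex_vector) complex_vector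
begin

lift_definition zero_tensor :: "('a, 'b) tensor" is "[]" .

lift_definition plus_tensor :: "('a, 'b) tensor \<Rightarrow> ('a, 'b) tensor \<Rightarrow> ('a, 'b) tensor"
  is "(@)" by (rule tensor_cong.append)

lift_definition scaleC_tensor :: "complex \<Rightarrow> ('a, 'b) tensor \<Rightarrow> ('a, 'b) tensor"
  is "\<lambda>c. map (\<lambda>(a, b). (c *\<^sub>C a, b))"
proof -
  fix c :: complex and xs ys :: "('a \<times> 'b) list"
  let ?m = "map (\<lambda>(a, b). (c *\<^sub>C a, b)) :: ('a \<times> 'b) list \<Rightarrow> _"
  assume "tensor_cong xs ys"
  then show "tensor_cong (?m xs) (?m ys)"
  proof induction
    case (scale d a b)
    have "tensor_cong [(d *\<^sub>C c *\<^sub>C a, b)] [(c *\<^sub>C a, d *\<^sub>C b)]"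
      by (rule tensor_cong.scale)
    then show ?case by (simp add: scaleC_scaleC mult.commute)
  qed (auto simp: scaleC_add_right intro: tensor_cong.intros)
qed

definition uminus_tensor :: "('a, 'b) tensor \<Rightarrow> ('a, 'b) tensor"
  where "uminus_tensor t = (- 1) *\<^sub>C t"

definition minus_tensor :: "('a, 'b) tensor \<Rightarrow> ('a, 'b) tensor \<Rightarrow> ('a, 'b) tensor"
  where "minus_tensor s t = s + (- 1) *\<^sub>C t"

lemma tensor_cong_cancel:
  fixes xs :: "('a \<times> 'b) list"
  shows "tensor_cong (map (\<lambda>(a, b). ((- 1) *\<^sub>C a, b)) xs @ xs) []"
proof (induction xs)
  case Nil
  then show ?case by (simp add: tensor_cong.refl)
next
  case (Cons x xs)
  obtain a b where x: "x = (a, b)" by (cases x)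
  let ?m = "map (\<lambda>(a, b). ((- 1) *\<^sub>C a, b)) :: ('a \<times> 'b) list \<Rightarrow> _"
  have "tensor_cong ([(- a, b)] @ (?m xs @ [(a, b)]) @ xs) ([(- a, b)] @ ([(a, b)] @ ?m xs) @ xs)"
    by (intro tensor_cong.append tensor_cong.refl tensor_cong.commute)
  then have 1: "tensor_cong (?m (x # xs) @ (x # xs)) ([(- a, b), (a, b)] @ (?m xs @ xs))"
    by (simp add: x scaleC_one)
  have "tensor_cong [(- a, b), (a, b)] [(- a + a, b)]"
    by (intro tensor_cong.sym[OF tensor_cong.add_left])
  also have "[(- a + a, b)] = [(0, b)]" by simp
  finally have "tensor_cong [(- a, b), (a, b)] []"
    using tensor_cong.trans tensor_cong.zero by blast
  then have "tensor_cong ([(- a, b), (a, b)] @ (?m xs @ xs)) ([] @ [])"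
    using Cons.IH by (rule tensor_cong.append)
  then show ?case using 1 tensor_cong.trans by fastforce
qed

lemma tensor_cong_scale_add:
  fixes xs :: "('a \<times> 'b) list"
  shows "tensor_cong (map (\<lambda>(a, b). ((c + d) *\<^sub>C a, b)) xs)
    (map (\<lambda>(a, b). (c *\<^sub>C a, b)) xs @ map (\<lambda>(a, b). (d *\<^sub>C a, b)) xs)"
proof (induction xs)
  case Nil
  then show ?case by (simp add: tensor_cong.refl)
next
  case (Cons x xs)
  obtain a b where x: "x = (a, b)" by (cases x)
  let ?m = "\<lambda>c. map (\<lambda>(a, b). (c *\<^sub>C a, b)) :: ('a \<times> 'b) list \<Rightarrow> _"
  have "tensor_cong ([((c + d) *\<^sub>C a, b)] @ ?m (c + d) xs)
      ([(c *\<^sub>C a, b), (d *\<^sub>C a, b)] @ (?m c xs @ ?m d xs))"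
    by (rule tensor_cong.append)
      (use Cons.IH tensor_cong.add_left[of "c *\<^sub>C a" "d *\<^sub>C a" b] in \<open>simp_all add: scaleC_add_left\<close>)
  moreover have "tensor_cong ([(c *\<^sub>C a, b)] @ ([(d *\<^sub>C a, b)] @ ?m c xs) @ ?m d xs)
      ([(c *\<^sub>C a, b)] @ (?m c xs @ [(d *\<^sub>C a, b)]) @ ?m d xs)"
    by (intro tensor_cong.append tensor_cong.refl tensor_cong.commute)
  ultimately show ?case by (simp add: x) (blast intro: tensor_cong.trans)
qed

instance
proof
  fix s t u :: "('a, 'b) tensor" and c d :: complex
  show "s + t + u = s + (t + u)" by transfer (simp add: tensor_cong.refl)
  show "s + t = t + s" by transfer (rule tensor_cong.commute)
  show "0 + s = s" by transfer (simp add: tensor_cong.refl)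
  show "- s + s = 0" unfolding uminus_tensor_def by transfer (rule tensor_cong_cancel)
  show "s - t = s + - t" by (simp add: uminus_tensor_def minus_tensor_def)
  show "c *\<^sub>C (s + t) = c *\<^sub>C s + c *\<^sub>C t" by transfer (simp add: tensor_cong.refl)
  show "(c + d) *\<^sub>C s = c *\<^sub>C s + d *\<^sub>C s" by transfer (rule tensor_cong_scale_add)
  show "c *\<^sub>C d *\<^sub>C s = (c * d) *\<^sub>C s"
    by transfer (simp add: scaleC_scaleC case_prod_unfold comp_def tensor_cong.refl)
  show "1 *\<^sub>C s = s" by transfer (simp add: scaleC_one case_prod_unfold tensor_cong.refl)
qed

end

text \<open>\<open>tensor_lift \<beta>\<close> sends \<open>\<Sum> a\<^sub>i \<otimes> b\<^sub>i\<close> to \<open>\<Sum> \<beta> a\<^sub>i b\<^sub>i\<close>. It is only meant for biadditive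
  maps that are balanced over \<open>\<complex>\<close>, for which it does not depend on the chosen
  representative (see the lemmas below); these include the bilinear and the bi-antilinear maps.
  With \<open>\<Delta> h = h\<^sub>1 \<otimes> h\<^sub>2\<close> in Sweedler's notation, \<open>tensor_lift \<beta> (\<Delta> h)\<close> is \<open>\<beta> h\<^sub>1 h\<^sub>2\<close>.\<close>

definition tensor_lift ::
  "('a::complex_vector \<Rightarrow> 'b::complex_vector \<Rightarrow> 'c::comm_monoid_add) \<Rightarrow> ('a, 'b) tensor \<Rightarrow> 'c"
  where "tensor_lift \<beta> t = (\<Sum>(a, b)\<leftarrow>rep_tensor t. \<beta> a b)"

definition balanced ::
  "('a::complex_vector \<Rightarrow> 'b::complex_vector \<Rightarrow> 'c::ab_group_add) \<Rightarrow> bool"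
  where "balanced \<beta> \<longleftrightarrow> (\<forall>a a' b. \<beta> (a + a') b = \<beta> a b + \<beta> a' b)
    \<and> (\<forall>a b b'. \<beta> a (b + b') = \<beta> a b + \<beta> a b')
    \<and> (\<forall>c a b. \<beta> (c *\<^sub>C a) b = \<beta> a (c *\<^sub>C b))"

lemma tensor_cong_sum_list:
  assumes "balanced \<beta>" "tensor_cong xs ys"
  shows "(\<Sum>(a, b)\<leftarrow>xs. \<beta> a b) = (\<Sum>(a, b)\<leftarrow>ys. \<beta> a b)"
  using assms(2)
proof induction
  case (zero b)
  have "\<beta> (0 + 0) b = \<beta> 0 b + \<beta> 0 b" using assms(1) unfolding balanced_def by blast
  then show ?case by simp
qed (use assms(1) in \<open>auto simp: balanced_def add.commute\<close>)

lemma tensor_lift_abs: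
  assumes "balanced \<beta>"
  shows "tensor_lift \<beta> (abs_tensor xs) = (\<Sum>(a, b)\<leftarrow>xs. \<beta> a b)"
  unfolding tensor_lift_def
  by (rule tensor_cong_sum_list[OF assms]) (simp add: Quotient3_tensor rep_abs_rsp_left tensor_cong.refl)

lemma tensor_lift_tens: "balanced \<beta> \<Longrightarrow> tensor_lift \<beta> (a \<otimes> b) = \<beta> a b"
  by (simp add: tens.abs_eq tensor_lift_abs)

lemma tensor_lift_add:
  assumes "balanced \<beta>"
  shows "tensor_lift \<beta> (s + t) = tensor_lift \<beta> s + tensor_lift \<beta> t"
  by (induct s rule: tensor.abs_induct, induct t rule: tensor.abs_induct)
    (simp add: plus_tensor.abs_eq tensor_lift_abs assms)

definition tensor_map ::
  "('a::complex_vector \<Rightarrow> 'c::complex_vector) \<Rightarrow> ('b::complex_vector \<Rightarrow> 'd::complex_vector)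
    \<Rightarrow> ('a, 'b) tensor \<Rightarrow> ('c, 'd) tensor"
  where "tensor_map f g = tensor_lift (\<lambda>a b. f a \<otimes> g b)"

definition tensor_assoc ::
  "(('a::complex_vector, 'b::complex_vector) tensor, 'c::complex_vector) tensor
    \<Rightarrow> ('a, ('b, 'c) tensor) tensor"
  where "tensor_assoc = tensor_lift (\<lambda>t c. tensor_lift (\<lambda>a b. a \<otimes> (b \<otimes> c)) t)"

definition tensor_mult ::
  "('a::complex_algebra_1, 'b::complex_algebra_1) tensor \<Rightarrow> ('a, 'b) tensor \<Rightarrow> ('a, 'b) tensor"
  where "tensor_mult s t =
    tensor_lift (\<lambda>a b. tensor_lift (\<lambda>c d. (a * c) \<otimes> (b * d)) t) s"

definition tensor_sub ::
  "'a::complex_vector set \<Rightarrow> 'b::complex_vector set \<Rightarrow> ('a, 'b) tensor set"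
  where "tensor_sub V W = cspan {v \<otimes> w | v w. v \<in> V \<and> w \<in> W}"


section \<open>Hopf algebras and their comodules\<close>

locale coalgebra =
  fixes \<Delta> :: "'h::complex_vector \<Rightarrow> ('h, 'h) tensor" and \<epsilon> :: "'h \<Rightarrow> complex"
  assumes clinear_comult: "clinear \<Delta>"
    and clinear_counit: "clinear \<epsilon>"
    and coassoc: "tensor_assoc (tensor_map \<Delta> id (\<Delta> h)) = tensor_map id \<Delta> (\<Delta> h)"
    and counit_left: "tensor_lift (\<lambda>a b. \<epsilon> a *\<^sub>C b) (\<Delta> h) = h"
    and counit_right: "tensor_lift (\<lambda>a b. \<epsilon> b *\<^sub>C a) (\<Delta> h) = h"

locale bialgebra = coalgebra \<Delta> \<epsilon>
  for \<Delta> :: "'h::complex_algebra_1 \<Rightarrow> ('h, 'h) tensor" and \<epsilon> :: "'h \<Rightarrow> complex" +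
  assumes comult_one: "\<Delta> 1 = 1 \<otimes> 1"
    and comult_mult: "\<Delta> (g * h) = tensor_mult (\<Delta> g) (\<Delta> h)"
    and counit_one: "\<epsilon> 1 = 1"
    and counit_mult: "\<epsilon> (g * h) = \<epsilon> g * \<epsilon> h"

locale hopf_algebra = bialgebra \<Delta> \<epsilon>
  for \<Delta> :: "'h::complex_algebra_1 \<Rightarrow> ('h, 'h) tensor" and \<epsilon> :: "'h \<Rightarrow> complex" +
  fixes S :: "'h \<Rightarrow> 'h"
  assumes clinear_antipode: "clinear S"
    and antipode_left: "tensor_lift (\<lambda>a b. S a * b) (\<Delta> h) = \<epsilon> h *\<^sub>C 1"
    and antipode_right: "tensor_lift (\<lambda>a b. a * S b) (\<Delta> h) = \<epsilon> h *\<^sub>C 1"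

definition subcoalgebra :: "('h::complex_vector \<Rightarrow> ('h, 'h) tensor) \<Rightarrow> 'h set \<Rightarrow> bool"
  where "subcoalgebra \<Delta> D \<longleftrightarrow> csubspace D \<and> (\<forall>d\<in>D. \<Delta> d \<in> tensor_sub D D)"

definition simple_subcoalgebra :: "('h::complex_vector \<Rightarrow> ('h, 'h) tensor) \<Rightarrow> 'h set \<Rightarrow> bool"
  where "simple_subcoalgebra \<Delta> D \<longleftrightarrow> subcoalgebra \<Delta> D \<and> D \<noteq> {0} \<and>
    (\<forall>E. subcoalgebra \<Delta> E \<and> E \<subseteq> D \<longrightarrow> E = {0} \<or> E = D)"

definition cosemisimple :: "('h::complex_vector \<Rightarrow> ('h, 'h) tensor) \<Rightarrow> bool"
  where "cosemisimple \<Delta> \<longleftrightarrow> cspan (\<Union>{D. simple_subcoalgebra \<Delta> D}) = UNIV"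

text \<open>Right comodules are carried by subspaces \<open>V\<close> of an ambient vector space. The coaction,
  the scalar products and the comodule maps on \<open>V\<close> are given by (sesqui)linear extensions to
  the ambient space (which always exist, and whose values off \<open>V\<close> play no role), so that
  \<^const>\<open>tensor_lift\<close> is applied to globally balanced maps only.\<close>

definition right_comodule ::
  "('h::complex_vector \<Rightarrow> ('h, 'h) tensor) \<Rightarrow> ('h \<Rightarrow> complex)
    \<Rightarrow> 'v::complex_vector set \<Rightarrow> ('v \<Rightarrow> ('v, 'h) tensor) \<Rightarrow> bool"
  where "right_comodule \<Delta> \<epsilon> V \<delta> \<longleftrightarrow> csubspace V \<and> clinear \<delta> \<and>
    (\<forall>v\<in>V. \<delta> v \<in> tensor_sub V UNIV
      \<and> tensor_assoc (tensor_map \<delta> id (\<delta> v)) = tensor_map id \<Delta> (\<delta> v)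
      \<and> tensor_lift (\<lambda>x h. \<epsilon> h *\<^sub>C x) (\<delta> v) = v)"

definition subcomodule ::
  "('v::complex_vector \<Rightarrow> ('v, 'h::complex_vector) tensor) \<Rightarrow> 'v set \<Rightarrow> bool"
  where "subcomodule \<delta> W \<longleftrightarrow> csubspace W \<and> (\<forall>w\<in>W. \<delta> w \<in> tensor_sub W UNIV)"

definition simple_comodule ::
  "('h::complex_vector \<Rightarrow> ('h, 'h) tensor) \<Rightarrow> ('h \<Rightarrow> complex)
    \<Rightarrow> 'v::complex_vector set \<Rightarrow> ('v \<Rightarrow> ('v, 'h) tensor) \<Rightarrow> bool"
  where "simple_comodule \<Delta> \<epsilon> V \<delta> \<longleftrightarrow> right_comodule \<Delta> \<epsilon> V \<delta> \<and> V \<noteq> {0} \<and>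
    (\<forall>W\<subseteq>V. subcomodule \<delta> W \<longrightarrow> W = {0} \<or> W = V)"

definition comodule_iso ::
  "'v::complex_vector set \<Rightarrow> ('v \<Rightarrow> ('v, 'h::complex_vector) tensor)
    \<Rightarrow> 'w::complex_vector set \<Rightarrow> ('w \<Rightarrow> ('w, 'h) tensor) \<Rightarrow> bool"
  where "comodule_iso V \<delta> W \<delta>' \<longleftrightarrow>
    (\<exists>f. clinear f \<and> bij_betw f V W \<and> (\<forall>v\<in>V. \<delta>' (f v) = tensor_map f id (\<delta> v)))"

definition trivial_comodule ::
  "'v::complex_vector set \<Rightarrow> ('v \<Rightarrow> ('v, 'h::complex_algebra_1) tensor) \<Rightarrow> bool"
  where "trivial_comodule V \<delta> \<longleftrightarrow> (\<exists>v. v \<noteq> 0 \<and> V = cspan {v} \<and> \<delta> v = v \<otimes> 1)"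

text \<open>The span of the matrix coefficients \<open>\<phi>(v\<^sub>0) v\<^sub>1\<close>.\<close>

definition coefficient_coalgebra ::
  "'v::complex_vector set \<Rightarrow> ('v \<Rightarrow> ('v, 'h::complex_vector) tensor) \<Rightarrow> 'h set"
  where "coefficient_coalgebra V \<delta> =
    cspan {tensor_lift (\<lambda>x h. \<phi> x *\<^sub>C h) (\<delta> v) | \<phi> v. clinear \<phi> \<and> v \<in> V}"

definition scalar_product_on ::
  "'v::complex_vector set \<Rightarrow> ('v \<Rightarrow> 'v \<Rightarrow> complex) \<Rightarrow> bool"
  where "scalar_product_on V ip \<longleftrightarrow>
    (\<forall>y. clinear (\<lambda>x. ip x y)) \<and> (\<forall>x. clinear (\<lambda>y. cnj (ip x y)))
    \<and> (\<forall>x\<in>V. \<forall>y\<in>V. ip y x = cnj (ip x y))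
    \<and> (\<forall>x\<in>V. x \<noteq> 0 \<longrightarrow> 0 < Re (ip x x))"

text \<open>\<open>\<langle>v\<^sub>0,w\<rangle> S(v\<^sub>1) = \<langle>v,w\<^sub>0\<rangle> w\<^sub>1\<^sup>*\<close> for all \<open>v\<close>, \<open>w\<close> in \<open>V\<close>.\<close>

definition unitary_scalar_product ::
  "('h::complex_vector \<Rightarrow> 'h) \<Rightarrow> ('h \<Rightarrow> 'h) \<Rightarrow> 'v::complex_vector set
    \<Rightarrow> ('v \<Rightarrow> ('v, 'h) tensor) \<Rightarrow> ('v \<Rightarrow> 'v \<Rightarrow> complex) \<Rightarrow> bool"
  where "unitary_scalar_product S star V \<delta> ip \<longleftrightarrow> scalar_product_on V ip \<and>
    (\<forall>v\<in>V. \<forall>w\<in>V. tensor_lift (\<lambda>x h. ip x w *\<^sub>C S h) (\<delta> v)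
                 = tensor_lift (\<lambda>y h. ip v y *\<^sub>C star h) (\<delta> w))"

text \<open>HOL cannot quantify over the type carrying a comodule, so ``every simple comodule'' is taken
  over the comodules carried by subspaces of \<open>H\<close> (with an arbitrary coaction, not necessarily
  the restriction of \<open>\<Delta>\<close>). Every simple right comodule \<open>V\<close> is isomorphic to one of these:
  \<open>v \<mapsto> \<phi>(v\<^sub>0) v\<^sub>1\<close> embeds it in \<open>H\<close> for any functional \<open>\<phi> \<noteq> 0\<close> on \<open>V\<close>.\<close>

locale compact_hopf_star_algebra = hopf_algebra \<Delta> \<epsilon> S
  for \<Delta> :: "'h::complex_algebra_1 \<Rightarrow> ('h, 'h) tensor" and \<epsilon> :: "'h \<Rightarrow> complex"
    and S :: "'h \<Rightarrow> 'h" +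
  fixes star :: "'h \<Rightarrow> 'h"
  assumes cosemisimple: "cosemisimple \<Delta>"
    and star_star: "star (star h) = h"
    and star_add: "star (g + h) = star g + star h"
    and star_scaleC: "star (c *\<^sub>C h) = cnj c *\<^sub>C star h"
    and star_mult: "star (g * h) = star h * star g"
    and star_comult: "\<Delta> (star h) = tensor_lift (\<lambda>a b. star a \<otimes> star b) (\<Delta> h)"
    and unitarizable:
      "\<And>(V :: 'h set) \<delta>. simple_comodule \<Delta> \<epsilon> V \<delta> \<Longrightarrow> \<exists>ip. unitary_scalar_product S star V \<delta> ip"

definition normalized_integral ::
  "('h::complex_algebra_1 \<Rightarrow> ('h, 'h) tensor) \<Rightarrow> ('h \<Rightarrow> complex) \<Rightarrow> bool"
  where "normalized_integral \<Delta> I \<longleftrightarrow> clinear I \<and> I 1 = 1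
    \<and> (\<forall>x. tensor_lift (\<lambda>a b. I b *\<^sub>C a) (\<Delta> x) = I x *\<^sub>C 1)
    \<and> (\<forall>x. tensor_lift (\<lambda>a b. I a *\<^sub>C b) (\<Delta> x) = I x *\<^sub>C 1)"

text \<open>\<open>g * f = \<integral>(f S(g\<^sub>1)) g\<^sub>2\<close>\<close>

definition convolution ::
  "('h::complex_algebra_1 \<Rightarrow> ('h, 'h) tensor) \<Rightarrow> ('h \<Rightarrow> 'h) \<Rightarrow> ('h \<Rightarrow> complex) \<Rightarrow> 'h \<Rightarrow> 'h \<Rightarrow> 'h"
  where "convolution \<Delta> S I g f = tensor_lift (\<lambda>a b. I (f * S a) *\<^sub>C b) (\<Delta> g)"

text \<open>A full set of representatives \<open>(V\<^sub>\<lambda>, \<delta>\<^sub>\<lambda>)\<close>, \<open>\<lambda> \<in> \<Lambda>\<close>, of the isomorphism classes of simple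
  comodules, with \<open>o\<close> (the index 0) representing the trivial comodule.\<close>

definition simple_comodule_classes ::
  "('h::complex_algebra_1 \<Rightarrow> ('h, 'h) tensor) \<Rightarrow> ('h \<Rightarrow> complex)
    \<Rightarrow> 'i set \<Rightarrow> ('i \<Rightarrow> 'h set) \<Rightarrow> ('i \<Rightarrow> 'h \<Rightarrow> ('h, 'h) tensor) \<Rightarrow> 'i \<Rightarrow> bool"
  where "simple_comodule_classes \<Delta> \<epsilon> \<Lambda> V \<delta> o' \<longleftrightarrow>
    (\<forall>l\<in>\<Lambda>. simple_comodule \<Delta> \<epsilon> (V l) (\<delta> l))
    \<and> (\<forall>l\<in>\<Lambda>. \<forall>m\<in>\<Lambda>. comodule_iso (V l) (\<delta> l) (V m) (\<delta> m) \<longrightarrow> l = m)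
    \<and> (\<forall>(W :: 'h set) \<delta>'. simple_comodule \<Delta> \<epsilon> W \<delta>'
          \<longrightarrow> (\<exists>l\<in>\<Lambda>. comodule_iso W \<delta>' (V l) (\<delta> l)))
    \<and> o' \<in> \<Lambda> \<and> trivial_comodule (V o') (\<delta> o')"

definition C\<^sub>0 :: "'i set \<Rightarrow> 'i \<Rightarrow> 'i set set"
  where "C\<^sub>0 \<Lambda> o' = {K. finite K \<and> K \<subseteq> \<Lambda> \<and> o' \<in> K}"

definition coefficient_sum ::
  "('i \<Rightarrow> 'v::complex_vector set) \<Rightarrow> ('i \<Rightarrow> 'v \<Rightarrow> ('v, 'h::complex_vector) tensor)
    \<Rightarrow> 'i set \<Rightarrow> 'h set"
  where "coefficient_sum V \<delta> K = cspan (\<Union>l\<in>K. coefficient_coalgebra (V l) (\<delta> l))"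

definition convolution_unit ::
  "('h \<Rightarrow> 'h \<Rightarrow> 'h) \<Rightarrow> 'h set \<Rightarrow> 'h \<Rightarrow> bool"
  where "convolution_unit conv A e \<longleftrightarrow> e \<in> A \<and> (\<forall>a\<in>A. conv e a = a \<and> conv a e = a)"


section \<open>Completions and Hilbert space tensor products\<close>

definition hilbert_completion ::
  "('h::complex_vector \<Rightarrow> 'h \<Rightarrow> complex) \<Rightarrow> ('h \<Rightarrow> 'l::complex_hilbert_space) \<Rightarrow> bool"
  where "hilbert_completion ip \<iota> \<longleftrightarrow> clinear \<iota> \<and> inj \<iota>
    \<and> (\<forall>a b. cinner (\<iota> a) (\<iota> b) = ip a b) \<and> closure (range \<iota>) = UNIV"

text \<open>The completed tensor product of two Hilbert spaces, determined up to a unique unitary.\<close>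

definition hilbert_tensor_product ::
  "('a::complex_hilbert_space \<Rightarrow> 'b::complex_hilbert_space \<Rightarrow> 't::complex_hilbert_space) \<Rightarrow> bool"
  where "hilbert_tensor_product ht \<longleftrightarrow> cbilinear ht
    \<and> (\<forall>a b c d. cinner (ht a b) (ht c d) = cinner a c * cinner b d)
    \<and> closure (cspan {ht a b | a b. True}) = UNIV"

text \<open>\<open>T = L \<hat>\<otimes> L\<close>, together with a single space serving both as \<open>T \<hat>\<otimes> L\<close> and as
  \<open>L \<hat>\<otimes> T\<close>, these two being identified by the associativity isomorphism.\<close>

definition hilbert_tensor_powers ::
  "('l::complex_hilbert_space \<Rightarrow> 'l \<Rightarrow> 't::complex_hilbert_space)
    \<Rightarrow> ('t \<Rightarrow> 'l \<Rightarrow> 'u::complex_hilbert_space) \<Rightarrow> ('l \<Rightarrow> 't \<Rightarrow> 'u) \<Rightarrow> bool"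
  where "hilbert_tensor_powers ht htl htr \<longleftrightarrow>
    hilbert_tensor_product ht \<and> hilbert_tensor_product htl \<and> hilbert_tensor_product htr
    \<and> (\<forall>a b c. htl (ht a b) c = htr a (ht b c))"

text \<open>\<open>F\<close> is the (unique) continuous linear extension to the completed tensor product of the
  map \<open>a \<otimes> b \<mapsto> \<beta> a b\<close>.\<close>

definition hilbert_extension ::
  "('a::complex_hilbert_space \<Rightarrow> 'b::complex_hilbert_space \<Rightarrow> 't::complex_hilbert_space)
    \<Rightarrow> ('a \<Rightarrow> 'b \<Rightarrow> 'c::{complex_vector,real_normed_vector}) \<Rightarrow> ('t \<Rightarrow> 'c) \<Rightarrow> bool"
  where "hilbert_extension ht \<beta> F \<longleftrightarrow> bounded_clinear F \<and> (\<forall>a b. F (ht a b) = \<beta> a b)"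


section \<open>Topological Hopf algebras with approximate unit\<close>

text \<open>``Without unit'' in the notion of approximate unit means ``not necessarily unital''.\<close>

definition topological_algebra :: "('l::complex_hilbert_space \<Rightarrow> 'l \<Rightarrow> 'l) \<Rightarrow> bool"
  where "topological_algebra m \<longleftrightarrow> bounded_cbilinear m \<and> (\<forall>a b c. m (m a b) c = m a (m b c))"

definition directed :: "'j::order set \<Rightarrow> bool"
  where "directed J \<longleftrightarrow> J \<noteq> {} \<and> (\<forall>i\<in>J. \<forall>j\<in>J. \<exists>k\<in>J. i \<le> k \<and> j \<le> k)"

definition net_converges :: "'j::order set \<Rightarrow> ('j \<Rightarrow> 'l::topological_space) \<Rightarrow> 'l \<Rightarrow> bool"
  where "net_converges J x a \<longleftrightarrow>
    (\<forall>U. open U \<and> a \<in> U \<longrightarrow> (\<exists>i\<in>J. \<forall>j\<in>J. i \<le> j \<longrightarrow> x j \<in> U))"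

definition approximate_unit ::
  "('l::complex_hilbert_space \<Rightarrow> 'l \<Rightarrow> 'l) \<Rightarrow> 'j::order set \<Rightarrow> ('j \<Rightarrow> 'l) \<Rightarrow> bool"
  where "approximate_unit m J e \<longleftrightarrow> directed J \<and> (\<forall>i\<in>J. m (e i) (e i) = e i)
    \<and> (\<forall>a. net_converges J (\<lambda>i. m (e i) a) a \<and> net_converges J (\<lambda>i. m a (e i)) a)"

definition algebra_with_approximate_unit ::
  "('l::complex_hilbert_space \<Rightarrow> 'l \<Rightarrow> 'l) \<Rightarrow> 'j::order set \<Rightarrow> ('j \<Rightarrow> 'l) \<Rightarrow> bool"
  where "algebra_with_approximate_unit m J e \<longleftrightarrow> topological_algebra m \<and> approximate_unit m J e"

definition counit_homomorphism ::
  "('l::complex_hilbert_space \<Rightarrow> 'l \<Rightarrow> 'l) \<Rightarrow> 'j::order set \<Rightarrow> ('j \<Rightarrow> 'l) \<Rightarrow> ('l \<Rightarrow> complex) \<Rightarrow> bool"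
  where "counit_homomorphism m J e \<epsilon> \<longleftrightarrow> bounded_clinear \<epsilon>
    \<and> (\<forall>a b. \<epsilon> (m a b) = \<epsilon> a * \<epsilon> b) \<and> (\<forall>i\<in>J. \<epsilon> (e i) = 1)"

text \<open>\<open>P\<close> is the factorwise product of \<open>L \<hat>\<otimes> L\<close>.\<close>

definition comult_homomorphism ::
  "('l::complex_hilbert_space \<Rightarrow> 'l \<Rightarrow> 't::complex_hilbert_space) \<Rightarrow> ('l \<Rightarrow> 'l \<Rightarrow> 'l)
    \<Rightarrow> ('l \<Rightarrow> 't) \<Rightarrow> bool"
  where "comult_homomorphism ht m D \<longleftrightarrow> bounded_clinear D \<and>
    (\<exists>P. bounded_cbilinear P \<and> (\<forall>a b c d. P (ht a b) (ht c d) = ht (m a c) (m b d))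
       \<and> (\<forall>a b. D (m a b) = P (D a) (D b)))"

definition coassociative ::
  "('l::complex_hilbert_space \<Rightarrow> 'l \<Rightarrow> 't::complex_hilbert_space)
    \<Rightarrow> ('t \<Rightarrow> 'l \<Rightarrow> 'u::complex_hilbert_space) \<Rightarrow> ('l \<Rightarrow> 't \<Rightarrow> 'u) \<Rightarrow> ('l \<Rightarrow> 't) \<Rightarrow> bool"
  where "coassociative ht htl htr D \<longleftrightarrow>
    (\<exists>F G. hilbert_extension ht (\<lambda>a b. htl (D a) b) F
         \<and> hilbert_extension ht (\<lambda>a b. htr a (D b)) G
         \<and> (\<forall>a. F (D a) = G (D a)))"

definition counital ::
  "('l::complex_hilbert_space \<Rightarrow> 'l \<Rightarrow> 't::complex_hilbert_space) \<Rightarrow> ('l \<Rightarrow> 't)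
    \<Rightarrow> ('l \<Rightarrow> complex) \<Rightarrow> bool"
  where "counital ht D \<epsilon> \<longleftrightarrow>
    (\<exists>F G. hilbert_extension ht (\<lambda>a b. \<epsilon> a *\<^sub>C b) F
         \<and> hilbert_extension ht (\<lambda>a b. \<epsilon> b *\<^sub>C a) G
         \<and> (\<forall>a. F (D a) = a \<and> G (D a) = a))"

definition bialgebra_with_approximate_unit ::
  "('l::complex_hilbert_space \<Rightarrow> 'l \<Rightarrow> 't::complex_hilbert_space)
    \<Rightarrow> ('t \<Rightarrow> 'l \<Rightarrow> 'u::complex_hilbert_space) \<Rightarrow> ('l \<Rightarrow> 't \<Rightarrow> 'u)
    \<Rightarrow> ('l \<Rightarrow> 'l \<Rightarrow> 'l) \<Rightarrow> 'j::order set \<Rightarrow> ('j \<Rightarrow> 'l) \<Rightarrow> ('l \<Rightarrow> 't) \<Rightarrow> ('l \<Rightarrow> complex) \<Rightarrow> bool"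
  where "bialgebra_with_approximate_unit ht htl htr m J e D \<epsilon> \<longleftrightarrow>
    algebra_with_approximate_unit m J e \<and> counit_homomorphism m J e \<epsilon>
    \<and> comult_homomorphism ht m D \<and> coassociative ht htl htr D \<and> counital ht D \<epsilon>"

text \<open>\<open>m(S\<^sub>i \<otimes> id)\<Delta> = m(id \<otimes> S\<^sub>i)\<Delta> = e\<^sub>i \<epsilon>\<close>. Here \<open>M\<close> is the product as a map on
  \<open>L \<hat>\<otimes> L\<close>, and \<open>F\<close>, \<open>G\<close> are \<open>S\<^sub>i \<otimes> id\<close>, \<open>id \<otimes> S\<^sub>i\<close>. The \<open>S\<^sub>i\<close> are required to be
  continuous, so that these make sense on the completed tensor product.\<close>

definition approximate_antipode ::
  "('l::complex_hilbert_space \<Rightarrow> 'l \<Rightarrow> 't::complex_hilbert_space) \<Rightarrow> ('l \<Rightarrow> 'l \<Rightarrow> 'l)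
    \<Rightarrow> 'j::order set \<Rightarrow> ('j \<Rightarrow> 'l) \<Rightarrow> ('l \<Rightarrow> 't) \<Rightarrow> ('l \<Rightarrow> complex) \<Rightarrow> ('j \<Rightarrow> 'l \<Rightarrow> 'l) \<Rightarrow> bool"
  where "approximate_antipode ht m J e D \<epsilon> S \<longleftrightarrow>
    (\<exists>M. hilbert_extension ht m M \<and>
      (\<forall>i\<in>J. bounded_clinear (S i) \<and>
        (\<exists>F G. hilbert_extension ht (\<lambda>a b. ht (S i a) b) F
             \<and> hilbert_extension ht (\<lambda>a b. ht a (S i b)) G
             \<and> (\<forall>a. M (F (D a)) = \<epsilon> a *\<^sub>C e i \<and> M (G (D a)) = \<epsilon> a *\<^sub>C e i))))"

definition hopf_algebra_with_approximate_unit ::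
  "('l::complex_hilbert_space \<Rightarrow> 'l \<Rightarrow> 't::complex_hilbert_space)
    \<Rightarrow> ('t \<Rightarrow> 'l \<Rightarrow> 'u::complex_hilbert_space) \<Rightarrow> ('l \<Rightarrow> 't \<Rightarrow> 'u)
    \<Rightarrow> ('l \<Rightarrow> 'l \<Rightarrow> 'l) \<Rightarrow> 'j::order set \<Rightarrow> ('j \<Rightarrow> 'l) \<Rightarrow> ('l \<Rightarrow> 't) \<Rightarrow> ('l \<Rightarrow> complex) \<Rightarrow> bool"
  where "hopf_algebra_with_approximate_unit ht htl htr m J e D \<epsilon> \<longleftrightarrow>
    bialgebra_with_approximate_unit ht htl htr m J e D \<epsilon>
    \<and> (\<exists>S. approximate_antipode ht m J e D \<epsilon> S)"


section \<open>The structure maps of the \<open>L\<^sup>2\<close>-completion\<close>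

definition convolution_extension ::
  "('h::complex_algebra_1 \<Rightarrow> 'h \<Rightarrow> 'h) \<Rightarrow> ('h \<Rightarrow> 'l::complex_hilbert_space)
    \<Rightarrow> ('l \<Rightarrow> 'l \<Rightarrow> 'l) \<Rightarrow> bool"
  where "convolution_extension conv \<iota> m \<longleftrightarrow>
    bounded_cbilinear m \<and> (\<forall>g f. m (\<iota> g) (\<iota> f) = \<iota> (conv g f))"

definition integral_extension ::
  "('h::complex_algebra_1 \<Rightarrow> complex) \<Rightarrow> ('h \<Rightarrow> 'l::complex_hilbert_space)
    \<Rightarrow> ('l \<Rightarrow> complex) \<Rightarrow> bool"
  where "integral_extension I \<iota> \<epsilon> \<longleftrightarrow> bounded_clinear \<epsilon> \<and> (\<forall>f. \<epsilon> (\<iota> f) = I f)"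

text \<open>Since \<open>(\<integral>\<otimes>\<integral>)((a \<otimes> b)(g \<otimes> f)) = \<integral>(ag) \<integral>(bf) = \<langle>a \<otimes> b, g\<^sup>* \<otimes> f\<^sup>*\<rangle>\<close>, the continuous
  extension of \<open>t \<mapsto> (\<integral>\<otimes>\<integral>)(t \<cdot> (g \<otimes> f))\<close> to \<open>L \<hat>\<otimes> L\<close> is \<open>t \<mapsto> \<langle>t, g\<^sup>* \<otimes> f\<^sup>*\<rangle>\<close>. The condition
  below thus reads \<open>(\<integral>\<otimes>\<integral>)(D h \<cdot> (g \<otimes> f)) = \<integral>(hgf)\<close>; together with continuity it determines \<open>D\<close>.
  Such a \<open>D\<close> exists only if the functionals \<open>g \<otimes> f \<mapsto> \<integral>(hgf)\<close> are bounded for the Hilbert space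
  tensor norm, which forces \<open>H\<close> to be finite-dimensional: already for the Laurent polynomials
  \<open>\<complex>[z,z\<^sup>-\<^sup>1]\<close> and \<open>h = 1\<close> the representing element would be
  \<open>\<Sum>n. z\<^sup>n \<otimes> z\<^sup>-\<^sup>n\<close>, of infinite norm.\<close>

definition convolution_comult ::
  "('h::complex_algebra_1 \<Rightarrow> complex) \<Rightarrow> ('h \<Rightarrow> 'h) \<Rightarrow> ('h \<Rightarrow> 'l::complex_hilbert_space)
    \<Rightarrow> ('l \<Rightarrow> 'l \<Rightarrow> 't::complex_hilbert_space) \<Rightarrow> ('l \<Rightarrow> 't) \<Rightarrow> bool"
  where "convolution_comult I star \<iota> ht D \<longleftrightarrow> bounded_clinear D \<and>
    (\<forall>h g f. cinner (D (\<iota> h)) (ht (\<iota> (star g)) (\<iota> (star f))) = I (h * g * f))"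

end

(* With the pairing (x, y) |-> I (x * y), which is nondegenerate because the scalar product is
   definite, convolution is dual to the coproduct: (h * k, y) = (k, y_1) (h, y_2). This rests on
   S(x_1) I(x_2 y) = I(x y_2) y_1 and gives associativity and multiplicativity of the integral.
   It also shows that the adjoints of left and right convolution operators preserve every
   subcoalgebra. Hence, for a subcoalgebra A with convolution unit e, the map f |-> e * f is the
   orthogonal projection onto A. A simple subcoalgebra either lies in A, or it
   meets A trivially and is then annihilated by e from both sides; so e is central. The subcoalgebras H_K exhaust H, and
   contractivity of the projections carries convergence over to the completion.

   The coproduct of the completion can only be bounded when orthonormal families are bounded in
   size, so that H is finite-dimensional and all tensor constructions are algebraic. The dual
   coproduct is coassociative, counital and multiplicative because the product of H is
   associative, unital and comultiplicative. If T is the Hilbert space adjoint of S, the maps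
   x |-> e_K * T x form an approximate antipode. *)

theory Submission
  imports Defs
begin

section \<open>Linear maps and the algebraic tensor product\<close>

text \<open>The tensor product is a quotient of lists of pairs, so membership in
  \<open>tensor_sub D D\<close> cannot be read off a representative. Subcoalgebras are therefore
  handled through slices: all (id \<otimes> \<psi>)\<Delta> d and (\<phi> \<otimes> id)\<Delta> d
  must lie in D, which suffices because product functionals separate tensors. This suits
  convolution, since g * f and the adjoints of both convolution operators are themselves slices of a
  coproduct.

  Conjugate symmetry and definiteness of I (a * star b) are taken from the isometric embedding
  \<iota> into a Hilbert space.

  The claims about the algebra and the counit mention no coproduct and are proved for H of any size.
  Finite dimension enters only once a bounded D is given. The axioms for D are then checked by
  adjoints: <D h, g \<otimes> f> = <h, f g> makes D adjoint to the opposite product of H, and the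
  convolution product is adjoint to the flipped \<Delta>. Each axiom turns into an axiom of H with
  its legs reversed; in particular the left antipode identity of the dual comes from the right one
  of H, and conversely.\<close>

interpretation complex_vector_pair: vector_space_pair
  "scaleC :: complex \<Rightarrow> 'a \<Rightarrow> 'a::complex_vector" "scaleC :: complex \<Rightarrow> 'b \<Rightarrow> 'b::complex_vector"
  by unfold_locales

lemma clinear_iff:
  "clinear f \<longleftrightarrow> (\<forall>x y. f (x + y) = f x + f y) \<and> (\<forall>c x. f (c *\<^sub>C x) = c *\<^sub>C f x)"
  proof
  assume "clinear f"
  then interpret f: Vector_Spaces.linear scaleC scaleC f .
  show "(\<forall>x y. f (x + y) = f x + f y) \<and> (\<forall>c x. f (c *\<^sub>C x) = c *\<^sub>C f x)"
    by (simp add: f.add f.scale)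
next
  assume "(\<forall>x y. f (x + y) = f x + f y) \<and> (\<forall>c x. f (c *\<^sub>C x) = c *\<^sub>C f x)"
  then show "clinear f" by unfold_locales auto
qed

lemma clinear_add: "clinear f \<Longrightarrow> f (x + y) = f x + f y"
  and clinear_scaleC: "clinear f \<Longrightarrow> f (c *\<^sub>C x) = c *\<^sub>C f x"
  by (simp_all add: clinear_iff)

lemma clinear_0: "clinear f \<Longrightarrow> f 0 = 0"
  using clinear_add[of f 0 0] by simp

lemma clinear_diff: "clinear f \<Longrightarrow> f (x - y) = f x - f y"
  using clinear_add[of f "x - y" y] by (simp add: algebra_simps)

lemma clinear_sum: "clinear f \<Longrightarrow> f (sum g A) = (\<Sum>a\<in>A. f (g a))"
  by (induction A rule: infinite_finite_induct) (simp_all add: clinear_0 clinear_add)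

lemma cbilinear_imp_balanced: "cbilinear \<beta> \<Longrightarrow> balanced \<beta>"
  unfolding cbilinear_def balanced_def clinear_iff by simp

text \<open>\<open>tensor_lift\<close> is a finite sum over one chosen representative, so every
  additive map passes through it. Asking for additivity alone lets the antilinear
  \<open>star\<close> through as well.\<close>

lemma tensor_lift_hom:
  fixes f :: "'c::ab_group_add \<Rightarrow> 'd::ab_group_add"
  assumes "\<And>x y. f (x + y) = f x + f y"
  shows "f (tensor_lift \<gamma> t) = tensor_lift (\<lambda>a b. f (\<gamma> a b)) t"
proof -
  have "f 0 = 0" using assms[of 0 0] by simp
  then have "f (\<Sum>(a, b)\<leftarrow>xs. \<gamma> a b) = (\<Sum>(a, b)\<leftarrow>xs. f (\<gamma> a b))" for xs
    by (induction xs) (auto simp: assms)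
  then show ?thesis by (simp add: tensor_lift_def)
qed

lemma tensor_lift_clinear:
  "clinear f \<Longrightarrow> f (tensor_lift \<gamma> t) = tensor_lift (\<lambda>a b. f (\<gamma> a b)) t"
  by (rule tensor_lift_hom) (rule clinear_add)

lemma tensor_lift_fun_add:
  fixes \<beta> \<gamma> :: "'a::complex_vector \<Rightarrow> 'b::complex_vector \<Rightarrow> 'c::ab_group_add"
  shows "tensor_lift (\<lambda>a b. \<beta> a b + \<gamma> a b) t = tensor_lift \<beta> t + tensor_lift \<gamma> t"
  by (simp add: tensor_lift_def case_prod_unfold sum_list_addf)

lemma tensor_lift_fun_scaleC:
  "tensor_lift (\<lambda>a b. c *\<^sub>C \<beta> a b) t = c *\<^sub>C tensor_lift \<beta> t"
  using tensor_lift_hom[of "\<lambda>x. c *\<^sub>C x" \<beta> t] by (simp add: scaleC_add_right)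

lemma tensor_lift_swap:
  fixes \<gamma> :: "'a::complex_vector \<Rightarrow> 'b::complex_vector \<Rightarrow> 'c::complex_vector
    \<Rightarrow> 'd::complex_vector \<Rightarrow> 'e::ab_group_add"
  shows "tensor_lift (\<lambda>a b. tensor_lift (\<lambda>c d. \<gamma> a b c d) s) t
       = tensor_lift (\<lambda>c d. tensor_lift (\<lambda>a b. \<gamma> a b c d) t) s"
proof -
  have *: "(\<Sum>(a, b)\<leftarrow>xs. \<Sum>(c, d)\<leftarrow>ys. \<gamma> a b c d) = (\<Sum>(c, d)\<leftarrow>ys. \<Sum>(a, b)\<leftarrow>xs. \<gamma> a b c d)" for xs ys
    by (induction xs) (auto simp: case_prod_unfold sum_list_addf)
  then show ?thesis by (simp add: tensor_lift_def)
qed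

lemma tensor_lift_scaleC:
  assumes "cbilinear \<beta>"
  shows "tensor_lift \<beta> (c *\<^sub>C t) = c *\<^sub>C tensor_lift \<beta> t"
proof -
  have *: "c *\<^sub>C (\<Sum>(a, b)\<leftarrow>xs. \<beta> a b) = (\<Sum>(a, b)\<leftarrow>map (\<lambda>(a, b). (c *\<^sub>C a, b)) xs. \<beta> a b)" for xs
    using assms by (induction xs) (auto simp: cbilinear_def clinear_iff scaleC_add_right)
  show ?thesis
    by (induct t rule: tensor.abs_induct)
      (simp add: scaleC_tensor.abs_eq tensor_lift_abs cbilinear_imp_balanced[OF assms] *)
qed

lemma clinear_id: "clinear (\<lambda>x. x)"
  by (simp add: clinear_iff)

lemma clinear_tensor_lift_arg:
  "cbilinear \<beta> \<Longrightarrow> clinear g \<Longrightarrow> clinear (\<lambda>x. tensor_lift \<beta> (g x))"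
  by (simp add: clinear_iff tensor_lift_add cbilinear_imp_balanced tensor_lift_scaleC)

lemma clinear_tensor_lift_fun:
  assumes "\<And>a b. clinear (\<lambda>x. \<beta> x a b)"
  shows "clinear (\<lambda>x. tensor_lift (\<lambda>a b. \<beta> x a b) t)"
proof -
  have "\<beta> (x + y) = (\<lambda>a b. \<beta> x a b + \<beta> y a b)" "\<beta> (c *\<^sub>C x) = (\<lambda>a b. c *\<^sub>C \<beta> x a b)" for c x y
    using assms by (simp_all add: fun_eq_iff clinear_iff)
  then show ?thesis by (simp add: clinear_iff tensor_lift_fun_add tensor_lift_fun_scaleC)
qed

lemma clinear_scaleC_left:
  fixes g :: "'a::complex_vector \<Rightarrow> complex"
  shows "clinear g \<Longrightarrow> clinear (\<lambda>x. g x *\<^sub>C v)"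
  by (simp add: clinear_iff scaleC_complex_def scaleC_add_left scaleC_scaleC)

lemma clinear_scaleC_right: "clinear g \<Longrightarrow> clinear (\<lambda>x. c *\<^sub>C g x)"
  by (simp add: clinear_iff scaleC_add_right scaleC_scaleC mult.commute)

lemma clinear_mult_left:
  fixes a :: "'a::complex_algebra_1"
  shows "clinear g \<Longrightarrow> clinear (\<lambda>x. g x * a)"
  by (simp add: clinear_iff algebra_simps mult_scaleC_left)

lemma clinear_mult_right:
  fixes a :: "'a::complex_algebra_1"
  shows "clinear g \<Longrightarrow> clinear (\<lambda>x. a * g x)"
  by (simp add: clinear_iff algebra_simps mult_scaleC_right)

lemma clinear_times_left:
  fixes a :: complex
  shows "clinear g \<Longrightarrow> clinear (\<lambda>x. g x * a)"
  by (simp add: clinear_iff algebra_simps scaleC_complex_def)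

lemma clinear_times_right:
  fixes a :: complex
  shows "clinear g \<Longrightarrow> clinear (\<lambda>x. a * g x)"
  by (simp add: clinear_iff algebra_simps scaleC_complex_def)

lemma clinear_compose: "clinear f \<Longrightarrow> clinear g \<Longrightarrow> clinear (\<lambda>x. f (g x))"
  by (simp add: clinear_iff)

lemma tens_add_left: "(a + a') \<otimes> b = a \<otimes> b + a' \<otimes> b"
  by transfer (simp add: tensor_cong.add_left)

lemma tens_add_right: "a \<otimes> (b + b') = a \<otimes> b + a \<otimes> b'"
  by transfer (simp add: tensor_cong.add_right)

lemma tens_scaleC_left: "(c *\<^sub>C a) \<otimes> b = c *\<^sub>C (a \<otimes> b)"
  by transfer (simp add: tensor_cong.refl)

lemma tens_scaleC_right: "a \<otimes> (c *\<^sub>C b) = c *\<^sub>C (a \<otimes> b)"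
  by transfer (simp add: tensor_cong.sym[OF tensor_cong.scale])

lemma clinear_tens_left: "clinear g \<Longrightarrow> clinear (\<lambda>x. g x \<otimes> b)"
  by (simp add: clinear_iff tens_add_left tens_scaleC_left)

lemma clinear_tens_right: "clinear g \<Longrightarrow> clinear (\<lambda>x. a \<otimes> g x)"
  by (simp add: clinear_iff tens_add_right tens_scaleC_right)

lemma cbilinearI:
  "(\<And>b. clinear (\<lambda>a. \<beta> a b)) \<Longrightarrow> (\<And>a. clinear (\<lambda>b. \<beta> a b)) \<Longrightarrow> cbilinear (\<lambda>a b. \<beta> a b)"
  by (simp add: cbilinear_def)

lemmas clinear_intros = cbilinearI clinear_id clinear_tensor_lift_arg clinear_tensor_lift_fun
  clinear_scaleC_left clinear_scaleC_right clinear_mult_left clinear_mult_right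
  clinear_times_left clinear_times_right clinear_tens_left clinear_tens_right

lemma tensor_lift_tens_cbilinear: "cbilinear \<beta> \<Longrightarrow> tensor_lift \<beta> (a \<otimes> b) = \<beta> a b"
  by (simp add: tensor_lift_tens cbilinear_imp_balanced)

lemma tensor_lift_tens_id: "tensor_lift (\<otimes>) t = t"
proof -
  have "(\<Sum>(a, b)\<leftarrow>xs. a \<otimes> b) = abs_tensor xs" for xs :: "('a \<times> 'b) list"
  proof (induction xs)
    case (Cons x xs)
    then show ?case
      by (cases x) (simp add: tens.abs_eq plus_tensor.abs_eq)
  qed (simp add: zero_tensor_def)
  then show ?thesis
    by (simp add: tensor_lift_def Quotient3_abs_rep[OF Quotient3_tensor])
qed

lemma tensor_lift_tensor_lift:
  assumes "cbilinear \<beta>"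
  shows "tensor_lift \<beta> (tensor_lift \<gamma> t) = tensor_lift (\<lambda>a b. tensor_lift \<beta> (\<gamma> a b)) t"
  by (rule tensor_lift_hom) (simp add: tensor_lift_add cbilinear_imp_balanced assms)

lemma tensor_lift_tensor_map:
  "cbilinear \<beta> \<Longrightarrow> tensor_lift \<beta> (tensor_map f g t) = tensor_lift (\<lambda>a b. \<beta> (f a) (g b)) t"
  by (simp add: tensor_map_def tensor_lift_tensor_lift tensor_lift_tens_cbilinear)

definition ctrilinear ::
  "('a::complex_vector \<Rightarrow> 'b::complex_vector \<Rightarrow> 'c::complex_vector \<Rightarrow> 'd::complex_vector) \<Rightarrow> bool"
  where "ctrilinear \<gamma> \<longleftrightarrow> (\<forall>b c. clinear (\<lambda>a. \<gamma> a b c)) \<and> (\<forall>a c. clinear (\<lambda>b. \<gamma> a b c))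
    \<and> (\<forall>a b. clinear (\<lambda>c. \<gamma> a b c))"

lemma ctrilinearI:
  "(\<And>b c. clinear (\<lambda>a. \<gamma> a b c)) \<Longrightarrow> (\<And>a c. clinear (\<lambda>b. \<gamma> a b c))
    \<Longrightarrow> (\<And>a b. clinear (\<lambda>c. \<gamma> a b c)) \<Longrightarrow> ctrilinear (\<lambda>a b c. \<gamma> a b c)"
  by (simp add: ctrilinear_def)

text \<open>Sweedler's renumbering of legs, as an evaluation rule for a trilinear \<gamma>. It is
  stated for a coaction \<delta> so that it serves comodules and, with \<delta> = \<Delta>, the
  coalgebra itself.\<close>

lemma coassoc_lift_general:
  assumes \<gamma>: "ctrilinear \<gamma>"
    and eq: "tensor_assoc (tensor_map \<delta> id t) = tensor_map id \<Delta> t"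
  shows "tensor_lift (\<lambda>x h. tensor_lift (\<lambda>y k. \<gamma> y k h) (\<delta> x)) t
       = tensor_lift (\<lambda>x h. tensor_lift (\<lambda>k l. \<gamma> x k l) (\<Delta> h)) t"
proof -
  have [intro]: "clinear (\<lambda>a. \<gamma> a b c)" "clinear (\<lambda>b. \<gamma> a b c)" "clinear (\<lambda>c. \<gamma> a b c)" for a b c
    using \<gamma> by (simp_all add: ctrilinear_def)
  let ?F = "tensor_lift (\<lambda>a. tensor_lift (\<lambda>c d. \<gamma> a c d))"
  have F: "cbilinear (\<lambda>a. tensor_lift (\<lambda>c d. \<gamma> a c d))"
    by (auto intro!: clinear_intros)
  have G: "cbilinear (\<lambda>s c. tensor_lift (\<lambda>a b. \<gamma> a b c) s)"
    by (auto intro!: clinear_intros)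
  have b: "cbilinear (\<lambda>c d. \<gamma> a c d)" for a by (auto intro!: clinear_intros)
  have "?F (tensor_assoc (tensor_map \<delta> id t))
      = tensor_lift (\<lambda>s c. tensor_lift (\<lambda>a b. \<gamma> a b c) s) (tensor_map \<delta> id t)"
    by (simp add: tensor_assoc_def tensor_lift_tensor_lift F b tensor_lift_tens_cbilinear)
  also have "\<dots> = tensor_lift (\<lambda>x h. tensor_lift (\<lambda>y k. \<gamma> y k h) (\<delta> x)) t"
    by (simp add: tensor_lift_tensor_map G)
  finally show ?thesis
    unfolding eq by (simp add: tensor_lift_tensor_map F)
qed

section \<open>Hamel bases, separating functionals and slices of tensors\<close>

lemma sum_hamel_basis:
  fixes v :: "'a::complex_vector"
  assumes "finite X" "complex_vector.independent B" "complex_vector.span B = UNIV" "v \<in> X"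
  shows "v = (\<Sum>b\<in>(\<Union>x\<in>X. {b. complex_vector.representation B x b \<noteq> 0}).
    complex_vector.representation B v b *\<^sub>C b)"
proof -
  have "(\<Sum>b\<in>(\<Union>x\<in>X. {b. complex_vector.representation B x b \<noteq> 0}).
      complex_vector.representation B v b *\<^sub>C b)
    = (\<Sum>b | complex_vector.representation B v b \<noteq> 0. complex_vector.representation B v b *\<^sub>C b)"
    by (rule sum.mono_neutral_right) (use assms complex_vector.finite_representation in auto)
  then show ?thesis using complex_vector.sum_nonzero_representation_eq[of B v] assms by simp
qed

lemma hamel_basis_exists:
  "\<exists>B::'a::complex_vector set. complex_vector.independent B \<and> complex_vector.span B = UNIV"
  using complex_vector.maximal_independent_subset[of UNIV] by (metis top.extremum_uniqueI)

lemma clinear_representation: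
  assumes "complex_vector.independent B" "complex_vector.span B = UNIV"
  shows "clinear (\<lambda>v. complex_vector.representation B v b)"
  using assms by (simp add: clinear_iff complex_vector.representation_add
      complex_vector.representation_scale scaleC_complex_def)

lemma clinear_functional_separates:
  fixes v :: "'a::complex_vector"
  assumes "\<And>\<phi> :: 'a \<Rightarrow> complex. clinear \<phi> \<Longrightarrow> \<phi> v = 0"
  shows "v = 0"
proof -
  obtain B :: "'a set" where B: "complex_vector.independent B" "complex_vector.span B = UNIV"
    using hamel_basis_exists by blast
  have "complex_vector.representation B v b = 0" for b
    using assms[OF clinear_representation[OF B]] .
  then show ?thesis
    using complex_vector.sum_nonzero_representation_eq[of B v] B by simp
qed

text \<open>Expanding the second legs in a Hamel basis writes t as a sum of a_c \<otimes> c, where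
  a_c is the slice of t along the coordinate functional of c. Every functional kills a_c by
  hypothesis, so a_c = 0.\<close>

lemma tensor_eq_0I:
  fixes t :: "('a::complex_vector, 'b::complex_vector) tensor"
  assumes "\<And>\<phi> \<psi>. clinear \<phi> \<Longrightarrow> clinear \<psi> \<Longrightarrow> tensor_lift (\<lambda>a b. \<phi> a * \<psi> b :: complex) t = 0"
  shows "t = 0"
proof -
  obtain B :: "'b set" where B: "complex_vector.independent B" "complex_vector.span B = UNIV"
    using hamel_basis_exists by blast
  let ?r = "complex_vector.representation B"
  define xs where "xs = rep_tensor t"
  \<comment> \<open>One finite index set serves all second legs of the representative, so that the
    sum over the basis and the sum over the list can be exchanged below.\<close>
  define C where "C = (\<Union>x\<in>snd ` set xs. {b. ?r x b \<noteq> 0})"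
  have r: "clinear (\<lambda>v. ?r v b)" for b by (rule clinear_representation[OF B])
  have left_0: "tensor_lift (\<lambda>a b. ?r b c *\<^sub>C a) t = 0" for c
  proof (rule clinear_functional_separates)
    fix \<phi> :: "'a \<Rightarrow> complex" assume \<phi>: "clinear \<phi>"
    have "\<phi> (tensor_lift (\<lambda>a b. ?r b c *\<^sub>C a) t) = tensor_lift (\<lambda>a b. \<phi> a * ?r b c) t"
      by (simp add: tensor_lift_clinear[OF \<phi>] clinear_scaleC[OF \<phi>] scaleC_complex_def mult.commute)
    then show "\<phi> (tensor_lift (\<lambda>a b. ?r b c *\<^sub>C a) t) = 0"
      by (simp add: assms \<phi> r)
  qed
  have "t = (\<Sum>x\<leftarrow>xs. fst x \<otimes> snd x)"
    using tensor_lift_tens_id[of t] by (simp add: tensor_lift_def xs_def case_prod_unfold)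
  also have "\<dots> = (\<Sum>x\<leftarrow>xs. \<Sum>c\<in>C. (?r (snd x) c *\<^sub>C fst x) \<otimes> c)"
  proof (rule arg_cong[where f = sum_list], rule map_cong[OF HOL.refl])
    fix x assume "x \<in> set xs"
    then have "snd x = (\<Sum>c\<in>C. ?r (snd x) c *\<^sub>C c)"
      unfolding C_def by (intro sum_hamel_basis B) auto
    then have "fst x \<otimes> snd x = fst x \<otimes> (\<Sum>c\<in>C. ?r (snd x) c *\<^sub>C c)" by simp
    also have "\<dots> = (\<Sum>c\<in>C. (?r (snd x) c *\<^sub>C fst x) \<otimes> c)"
      by (simp add: clinear_sum[OF clinear_tens_right[OF clinear_id]] tens_scaleC_left tens_scaleC_right)
    finally show "fst x \<otimes> snd x = (\<Sum>c\<in>C. (?r (snd x) c *\<^sub>C fst x) \<otimes> c)" .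
  qed
  also have "\<dots> = (\<Sum>c\<in>C. \<Sum>x\<leftarrow>xs. (?r (snd x) c *\<^sub>C fst x) \<otimes> c)"
    by (induction xs) (simp_all add: sum.distrib)
  also have "\<dots> = (\<Sum>c\<in>C. tensor_lift (\<lambda>a b. ?r b c *\<^sub>C a) t \<otimes> c)"
    by (simp add: tensor_lift_clinear[OF clinear_tens_left[OF clinear_id]])
      (simp add: tensor_lift_def xs_def case_prod_unfold)
  also have "\<dots> = 0"
    by (simp add: left_0 clinear_0[OF clinear_tens_left[OF clinear_id]])
  finally show ?thesis .
qed

lemma csubspace_sum_list: "csubspace X \<Longrightarrow> (\<And>x. x \<in> set xs \<Longrightarrow> f x \<in> X) \<Longrightarrow> sum_list (map f xs) \<in> X"
  by (induction xs) (simp_all add: complex_vector.subspace_0 complex_vector.subspace_add)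

lemma tensor_lift_in_csubspace: "csubspace X \<Longrightarrow> (\<And>a b. \<beta> a b \<in> X) \<Longrightarrow> tensor_lift \<beta> t \<in> X"
  unfolding tensor_lift_def by (rule csubspace_sum_list) auto

lemma csubspace_tensor_sub: "csubspace (tensor_sub X Y)"
  by (simp add: tensor_sub_def)

lemma tens_in_tensor_sub: "a \<in> X \<Longrightarrow> b \<in> Y \<Longrightarrow> a \<otimes> b \<in> tensor_sub X Y"
  unfolding tensor_sub_def by (rule complex_vector.span_base) blast

lemma csubspace_vimage: "clinear f \<Longrightarrow> csubspace Y \<Longrightarrow> csubspace {x. f x \<in> Y}"
  by (simp add: complex_vector.subspace_def clinear_0 clinear_add clinear_scaleC)

lemma tensor_sub_lift_in:
  assumes "t \<in> tensor_sub X Y" "cbilinear \<beta>" "csubspace Z" "\<And>x y. x \<in> X \<Longrightarrow> y \<in> Y \<Longrightarrow> \<beta> x y \<in> Z"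
  shows "tensor_lift \<beta> t \<in> Z"
  using assms(1) unfolding tensor_sub_def
proof (induction rule: complex_vector.span_induct)
  case base
  show ?case
    using csubspace_vimage[OF clinear_tensor_lift_arg[OF assms(2) clinear_id] assms(3)] by simp
next
  case (step x)
  then show ?case using assms by (auto simp: tensor_lift_tens_cbilinear)
qed

lemma cbilinear_diff: "cbilinear \<beta> \<Longrightarrow> cbilinear \<gamma> \<Longrightarrow> cbilinear (\<lambda>a b. \<beta> a b - \<gamma> a b)"
  by (simp add: cbilinear_def clinear_iff complex_vector.scale_right_diff_distrib)

lemma tensor_lift_fun_diff:
  fixes \<beta> \<gamma> :: "'a::complex_vector \<Rightarrow> 'b::complex_vector \<Rightarrow> 'c::ab_group_add"
  shows "tensor_lift (\<lambda>a b. \<beta> a b - \<gamma> a b) t = tensor_lift \<beta> t - tensor_lift \<gamma> t"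
  using tensor_lift_fun_add[of "\<lambda>a b. \<beta> a b - \<gamma> a b" \<gamma> t] by simp

lemma tensor_sub_lift_cong:
  assumes "t \<in> tensor_sub X Y" "cbilinear \<beta>" "cbilinear \<gamma>"
    and "\<And>x y. x \<in> X \<Longrightarrow> y \<in> Y \<Longrightarrow> \<beta> x y = \<gamma> x y"
  shows "tensor_lift \<beta> t = tensor_lift \<gamma> t"
proof -
  have "tensor_lift (\<lambda>a b. \<beta> a b - \<gamma> a b) t \<in> {0}"
    by (rule tensor_sub_lift_in[OF assms(1)]) (use assms in \<open>auto intro: cbilinear_diff\<close>)
  then show ?thesis by (simp add: tensor_lift_fun_diff)
qed

lemma csubspace_projection:
  assumes "csubspace X"
  shows "\<exists>p. clinear p \<and> range p \<subseteq> X \<and> (\<forall>x\<in>X. p x = x)"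
  using complex_vector_pair.linear_inj_on_left_inverse[of "\<lambda>x. x" X] clinear_id
  by (simp add: complex_vector.span_eq_iff[THEN iffD2, OF assms]) blast

text \<open>With linear projections p onto X and q onto Y, p \<otimes> q maps every tensor into X
  \<otimes> Y. It fixes t: after applying \<phi> \<otimes> \<psi>, p and q act only on slices of t,
  which they leave alone.\<close>

lemma in_tensor_subI:
  fixes t :: "('a::complex_vector, 'b::complex_vector) tensor"
  assumes X: "csubspace X" and Y: "csubspace Y"
    and left: "\<And>\<psi>. clinear \<psi> \<Longrightarrow> tensor_lift (\<lambda>a b. \<psi> b *\<^sub>C a) t \<in> X"
    and right: "\<And>\<phi>. clinear \<phi> \<Longrightarrow> tensor_lift (\<lambda>a b. \<phi> a *\<^sub>C b) t \<in> Y"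
  shows "t \<in> tensor_sub X Y"
proof -
  obtain p where p: "clinear p" "range p \<subseteq> X" "\<And>x. x \<in> X \<Longrightarrow> p x = x"
    using csubspace_projection[OF X] by blast
  obtain q where q: "clinear q" "range q \<subseteq> Y" "\<And>x. x \<in> Y \<Longrightarrow> q x = x"
    using csubspace_projection[OF Y] by blast
  have "tensor_map p q t - t = 0"
  proof (rule tensor_eq_0I)
    fix \<phi> :: "'a \<Rightarrow> complex" and \<psi> :: "'b \<Rightarrow> complex" assume \<phi>: "clinear \<phi>" and \<psi>: "clinear \<psi>"
    have b: "cbilinear (\<lambda>a b. \<phi> a * \<psi> b)"
      by (intro clinear_intros \<phi> \<psi>)
    have c: "clinear (\<lambda>t. tensor_lift (\<lambda>a b. \<phi> a * \<psi> b) t)"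
      by (intro clinear_intros \<phi> \<psi>)
    have "tensor_lift (\<lambda>a b. \<phi> a * \<psi> b) (tensor_map p q t) = tensor_lift (\<lambda>a b. \<phi> (p a) * \<psi> (q b)) t"
      by (rule tensor_lift_tensor_map[OF b])
    also have "\<dots> = \<phi> (p (tensor_lift (\<lambda>a b. \<psi> (q b) *\<^sub>C a) t))"
      by (simp add: tensor_lift_clinear[OF p(1)] tensor_lift_clinear[OF \<phi>] clinear_scaleC[OF p(1)]
          clinear_scaleC[OF \<phi>] scaleC_complex_def mult.commute)
    also have "\<dots> = \<phi> (tensor_lift (\<lambda>a b. \<psi> (q b) *\<^sub>C a) t)"
      by (simp add: p(3) left clinear_compose[OF \<psi> q(1)])
    also have "\<dots> = tensor_lift (\<lambda>a b. \<phi> a * \<psi> (q b)) t"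
      by (simp add: tensor_lift_clinear[OF \<phi>] clinear_scaleC[OF \<phi>] scaleC_complex_def mult.commute)
    also have "\<dots> = \<psi> (q (tensor_lift (\<lambda>a b. \<phi> a *\<^sub>C b) t))"
      by (simp add: tensor_lift_clinear[OF q(1)] tensor_lift_clinear[OF \<psi>] clinear_scaleC[OF q(1)]
          clinear_scaleC[OF \<psi>] scaleC_complex_def)
    also have "\<dots> = \<psi> (tensor_lift (\<lambda>a b. \<phi> a *\<^sub>C b) t)"
      by (simp add: q(3) right \<phi>)
    also have "\<dots> = tensor_lift (\<lambda>a b. \<phi> a * \<psi> b) t"
      by (simp add: tensor_lift_clinear[OF \<psi>] clinear_scaleC[OF \<psi>] scaleC_complex_def)
    finally show "tensor_lift (\<lambda>a b. \<phi> a * \<psi> b) (tensor_map p q t - t) = 0"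
      by (simp add: clinear_diff[OF c])
  qed
  moreover have "tensor_map p q t \<in> tensor_sub X Y"
    unfolding tensor_map_def using p(2) q(2)
    by (intro tensor_lift_in_csubspace csubspace_tensor_sub tens_in_tensor_sub) auto
  ultimately show ?thesis by simp
qed

section \<open>Convolution and subcoalgebras\<close>

lemma subcoalgebraI:
  assumes "csubspace D"
    and "\<And>d \<psi>. d \<in> D \<Longrightarrow> clinear \<psi> \<Longrightarrow> tensor_lift (\<lambda>a b. \<psi> b *\<^sub>C a) (\<Delta> d) \<in> D"
    and "\<And>d \<phi>. d \<in> D \<Longrightarrow> clinear \<phi> \<Longrightarrow> tensor_lift (\<lambda>a b. \<phi> a *\<^sub>C b) (\<Delta> d) \<in> D"
  shows "subcoalgebra \<Delta> D"
  unfolding subcoalgebra_def using assms by (blast intro: in_tensor_subI)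

lemma subcoalgebra_left:
  assumes "subcoalgebra \<Delta> D" "d \<in> D" "clinear \<psi>"
  shows "tensor_lift (\<lambda>a b. \<psi> b *\<^sub>C a) (\<Delta> d) \<in> D"
  by (rule tensor_sub_lift_in[where X = D and Y = D])
    (use assms in \<open>auto simp: subcoalgebra_def complex_vector.subspace_scale intro!: clinear_intros\<close>)

lemma subcoalgebra_right:
  assumes "subcoalgebra \<Delta> D" "d \<in> D" "clinear \<phi>"
  shows "tensor_lift (\<lambda>a b. \<phi> a *\<^sub>C b) (\<Delta> d) \<in> D"
  by (rule tensor_sub_lift_in[where X = D and Y = D])
    (use assms in \<open>auto simp: subcoalgebra_def complex_vector.subspace_scale intro!: clinear_intros\<close>)

text \<open>Closure under slices passes to intersections at once, which avoids comparing (D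
  \<otimes> D) \<inter> (E \<otimes> E) with (D \<inter> E) \<otimes> (D \<inter> E).\<close>

lemma subcoalgebra_Int:
  assumes "subcoalgebra \<Delta> D" "subcoalgebra \<Delta> E"
  shows "subcoalgebra \<Delta> (D \<inter> E)"
  by (rule subcoalgebraI)
    (use assms in \<open>auto intro: subcoalgebra_left subcoalgebra_right complex_vector.subspace_inter
      simp: subcoalgebra_def\<close>)

lemma simple_subcoalgebra_Int:
  assumes "simple_subcoalgebra \<Delta> D" "subcoalgebra \<Delta> E"
  shows "D \<subseteq> E \<or> D \<inter> E = {0}"
  using subcoalgebra_Int[of \<Delta> D E] assms unfolding simple_subcoalgebra_def by blast

context coalgebra
begin

lemma clinear_comult_comp: "clinear g \<Longrightarrow> clinear (\<lambda>x. \<Delta> (g x))"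
  by (rule clinear_compose[OF clinear_comult])

lemma clinear_counit_comp: "clinear g \<Longrightarrow> clinear (\<lambda>x. \<epsilon> (g x))"
  by (rule clinear_compose[OF clinear_counit])

lemmas coassoc_lift = coassoc_lift_general[OF _ coassoc]

lemma counit_left_lift: "clinear f \<Longrightarrow> tensor_lift (\<lambda>a b. \<epsilon> a *\<^sub>C f b) (\<Delta> h) = f h"
  using tensor_lift_clinear[of f "\<lambda>a b. \<epsilon> a *\<^sub>C b" "\<Delta> h"] by (simp add: counit_left clinear_scaleC)

lemma counit_right_lift: "clinear f \<Longrightarrow> tensor_lift (\<lambda>a b. \<epsilon> b *\<^sub>C f a) (\<Delta> h) = f h"
  using tensor_lift_clinear[of f "\<lambda>a b. \<epsilon> b *\<^sub>C a" "\<Delta> h"] by (simp add: counit_right clinear_scaleC)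

end

lemma (in bialgebra) comult_mult_lift:
  assumes "cbilinear \<beta>"
  shows "tensor_lift \<beta> (\<Delta> (g * h))
    = tensor_lift (\<lambda>a b. tensor_lift (\<lambda>c d. \<beta> (a * c) (b * d)) (\<Delta> h)) (\<Delta> g)"
  unfolding comult_mult tensor_mult_def
  by (simp add: tensor_lift_tensor_lift assms tensor_lift_tens_cbilinear)

context compact_hopf_star_algebra
begin

lemma star_one: "star 1 = 1"
  by (metis star_mult star_star mult_1_right)

lemma star_0: "star 0 = 0"
  using star_add[of 0 0] by simp

lemma star_diff: "star (g - h) = star g - star h"
  using star_add[of "g - h" h] by (simp add: algebra_simps)

lemma star_tensor_lift: "star (tensor_lift \<gamma> t) = tensor_lift (\<lambda>a b. star (\<gamma> a b)) t"
  by (rule tensor_lift_hom) (rule star_add)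

lemma comult_star_lift:
  "cbilinear \<beta> \<Longrightarrow> tensor_lift \<beta> (\<Delta> (star h)) = tensor_lift (\<lambda>a b. \<beta> (star a) (star b)) (\<Delta> h)"
  by (simp add: star_comult tensor_lift_tensor_lift tensor_lift_tens_cbilinear)

text \<open>Conjugating \<epsilon> by \<open>star\<close> gives another left counit
  \<open>?e\<close>. A left and a right counit agree, by evaluating ?e(h_1) \<epsilon>(h_2) in two
  ways.\<close>

lemma counit_star: "\<epsilon> (star h) = cnj (\<epsilon> h)"
proof -
  let ?e = "\<lambda>h. cnj (\<epsilon> (star h))"
  have e: "clinear ?e"
    using clinear_counit by (simp add: clinear_iff star_add star_scaleC scaleC_complex_def)
  have "tensor_lift (\<lambda>a b. ?e a *\<^sub>C b) (\<Delta> h) = star (tensor_lift (\<lambda>a b. \<epsilon> (star a) *\<^sub>C star b) (\<Delta> h))"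
    by (simp add: star_tensor_lift star_scaleC star_star)
  also have "tensor_lift (\<lambda>a b. \<epsilon> (star a) *\<^sub>C star b) (\<Delta> h) = tensor_lift (\<lambda>a b. \<epsilon> a *\<^sub>C b) (\<Delta> (star h))"
    by (subst comult_star_lift) (auto intro!: clinear_intros clinear_counit)
  finally have "h = tensor_lift (\<lambda>a b. ?e a *\<^sub>C b) (\<Delta> h)"
    by (simp add: counit_left star_star)
  then have "\<epsilon> h = tensor_lift (\<lambda>a b. ?e a * \<epsilon> b) (\<Delta> h)"
    using tensor_lift_clinear[OF clinear_counit, of "\<lambda>a b. ?e a *\<^sub>C b" "\<Delta> h"]
    by (simp add: clinear_scaleC[OF clinear_counit] scaleC_complex_def)
  also have "\<dots> = ?e h"
    using counit_right_lift[OF e, of h] by (simp add: scaleC_complex_def mult.commute)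
  finally show ?thesis by simp
qed

end

section \<open>Convolution as the dual of the coproduct\<close>

locale hopf_integral = hopf_algebra \<Delta> \<epsilon> S
  for \<Delta> :: "'h::complex_algebra_1 \<Rightarrow> ('h, 'h) tensor" and \<epsilon> :: "'h \<Rightarrow> complex" and S :: "'h \<Rightarrow> 'h" +
  fixes I :: "'h \<Rightarrow> complex"
  assumes integral: "normalized_integral \<Delta> I"
begin

abbreviation conv :: "'h \<Rightarrow> 'h \<Rightarrow> 'h"
  where "conv \<equiv> convolution \<Delta> S I"

lemma clinear_integral: "clinear I"
  and integral_one: "I 1 = 1"
  and integral_right: "tensor_lift (\<lambda>a b. I b *\<^sub>C a) (\<Delta> x) = I x *\<^sub>C 1"
  using integral by (simp_all add: normalized_integral_def)

lemma clinear_integral_comp: "clinear g \<Longrightarrow> clinear (\<lambda>x. I (g x))"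
  by (rule clinear_compose[OF clinear_integral])

lemma clinear_antipode_comp: "clinear g \<Longrightarrow> clinear (\<lambda>x. S (g x))"
  by (rule clinear_compose[OF clinear_antipode])

lemmas clin = clinear_intros clinear_integral_comp clinear_antipode_comp clinear_comult_comp
  clinear_counit_comp

lemma I_scaleC: "I (c *\<^sub>C x) = c * I x"
  by (simp add: clinear_scaleC[OF clinear_integral] scaleC_complex_def)

lemma I_add: "I (x + y) = I x + I y"
  by (rule clinear_add[OF clinear_integral])

lemma I_diff: "I (x - y) = I x - I y"
  by (rule clinear_diff[OF clinear_integral])

lemma I_0: "I 0 = 0"
  by (rule clinear_0[OF clinear_integral])

lemma I_tensor_lift: "I (tensor_lift \<gamma> t) = tensor_lift (\<lambda>a b. I (\<gamma> a b)) t"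
  by (rule tensor_lift_clinear[OF clinear_integral])

lemma mult_tensor_lift_left:
  fixes x :: "'h"
  shows "tensor_lift \<gamma> t * x = tensor_lift (\<lambda>a b. \<gamma> a b * x) t"
  by (rule tensor_lift_hom[of "\<lambda>z. z * x"]) (rule distrib_right)

lemma mult_tensor_lift_right:
  fixes x :: "'h"
  shows "x * tensor_lift \<gamma> t = tensor_lift (\<lambda>a b. x * \<gamma> a b) t"
  by (rule tensor_lift_hom[of "\<lambda>z. x * z"]) (rule distrib_left)

text \<open>In Sweedler's notation, \<open>S(x\<^sub>1) \<integral>(x\<^sub>2 y) = S(x\<^sub>1) x\<^sub>2 y\<^sub>1 \<integral>(x\<^sub>3 y\<^sub>2) = y\<^sub>1 \<integral>(x y\<^sub>2)\<close>.\<close>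

lemma integral_shift:
  "tensor_lift (\<lambda>a b. I (b * y) *\<^sub>C S a) (\<Delta> x) = tensor_lift (\<lambda>a b. I (x * b) *\<^sub>C a) (\<Delta> y)"
proof -
  let ?\<gamma> = "\<lambda>a u v. tensor_lift (\<lambda>r s. I (v * s) *\<^sub>C (S a * u * r)) (\<Delta> y)"
  have \<gamma>: "ctrilinear ?\<gamma>" by (intro ctrilinearI clin)
  have b: "cbilinear (\<lambda>a b. I b *\<^sub>C a)" by (intro clin)
  have "I (b * y) *\<^sub>C S a = tensor_lift (\<lambda>u v. ?\<gamma> a u v) (\<Delta> b)" for a b
  proof -
    have "I (b * y) *\<^sub>C S a = S a * tensor_lift (\<lambda>a b. I b *\<^sub>C a) (\<Delta> (b * y))"
      by (simp add: integral_right mult_scaleC_right)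
    also have "\<dots> = tensor_lift (\<lambda>u v. ?\<gamma> a u v) (\<Delta> b)"
      by (simp add: comult_mult_lift[OF b] mult_tensor_lift_right mult_scaleC_right mult.assoc)
    finally show ?thesis .
  qed
  then have "tensor_lift (\<lambda>a b. I (b * y) *\<^sub>C S a) (\<Delta> x)
      = tensor_lift (\<lambda>w v. tensor_lift (\<lambda>a u. ?\<gamma> a u v) (\<Delta> w)) (\<Delta> x)"
    by (simp add: coassoc_lift[OF \<gamma>])
  also have "\<dots> = tensor_lift (\<lambda>w v. \<epsilon> w *\<^sub>C tensor_lift (\<lambda>r s. I (v * s) *\<^sub>C r) (\<Delta> y)) (\<Delta> x)"
  proof -
    have "tensor_lift (\<lambda>a u. ?\<gamma> a u v) (\<Delta> w) = \<epsilon> w *\<^sub>C tensor_lift (\<lambda>r s. I (v * s) *\<^sub>C r) (\<Delta> y)" for w v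
    proof -
      have "tensor_lift (\<lambda>a u. ?\<gamma> a u v) (\<Delta> w)
          = tensor_lift (\<lambda>r s. I (v * s) *\<^sub>C (tensor_lift (\<lambda>a u. S a * u) (\<Delta> w) * r)) (\<Delta> y)"
        by (subst tensor_lift_swap) (simp add: tensor_lift_fun_scaleC mult_tensor_lift_left)
      then show ?thesis
        by (simp add: antipode_left mult_scaleC_left tensor_lift_fun_scaleC[symmetric] scaleC_scaleC mult.commute)
    qed
    then show ?thesis by simp
  qed
  also have "\<dots> = tensor_lift (\<lambda>a b. I (x * b) *\<^sub>C a) (\<Delta> y)"
    by (rule counit_left_lift) (intro clin)
  finally show ?thesis .
qed

text \<open>Unfolding the product leaves S(h_1) I(h_2 y) under the integral against k;
  \<open>integral_shift\<close> removes the antipode and trades the coproduct of h for that of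
  y.\<close>

lemma integral_convolution: "I (conv h k * y) = tensor_lift (\<lambda>a b. I (k * a) * I (h * b)) (\<Delta> y)"
proof -
  have "I (conv h k * y) = I (k * tensor_lift (\<lambda>a b. I (b * y) *\<^sub>C S a) (\<Delta> h))"
    by (simp add: convolution_def mult_tensor_lift_left mult_tensor_lift_right I_tensor_lift
        mult_scaleC_left mult_scaleC_right I_scaleC mult.commute)
  also have "\<dots> = tensor_lift (\<lambda>a b. I (k * a) * I (h * b)) (\<Delta> y)"
    by (simp add: integral_shift mult_tensor_lift_right I_tensor_lift
        mult_scaleC_right I_scaleC mult.commute)
  finally show ?thesis .
qed

text \<open>The duality evaluated at y = 1, which is grouplike.\<close>

lemma I_convolution: "I (conv g f) = I g * I f"
proof -
  have "cbilinear (\<lambda>a b. I (f * a) * I (g * b))" by (intro clin)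
  then show ?thesis
    using integral_convolution[of g f 1] by (simp add: comult_one tensor_lift_tens_cbilinear)
qed

lemma clinear_convolution_right: "clinear (\<lambda>f. conv g f)"
  unfolding convolution_def by (intro clin)

lemma clinear_convolution_left: "clinear (\<lambda>g. conv g f)"
  unfolding convolution_def by (intro clin)

text \<open>\<open>conv g f\<close> is a slice of \<Delta> g, so a subcoalgebra is a right ideal for
  convolution.\<close>

lemma convolution_in_subcoalgebra: "subcoalgebra \<Delta> A \<Longrightarrow> g \<in> A \<Longrightarrow> conv g f \<in> A"
  unfolding convolution_def by (rule subcoalgebra_right) (auto intro!: clin)

end

text \<open>The two assumptions isolate what the existence of an injective isometry into a Hilbert
  space says about the integral, so that the convolution algebra can be studied inside H, without
  the completion.\<close>

locale compact_hopf_integral = compact_hopf_star_algebra \<Delta> \<epsilon> S star + hopf_integral \<Delta> \<epsilon> S I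
  for \<Delta> :: "'h::complex_algebra_1 \<Rightarrow> ('h, 'h) tensor" and \<epsilon> :: "'h \<Rightarrow> complex" and S :: "'h \<Rightarrow> 'h"
    and star :: "'h \<Rightarrow> 'h" and I :: "'h \<Rightarrow> complex" +
  assumes hermitian: "I (a * star b) = cnj (I (b * star a))"
    and definite: "I (a * star a) = 0 \<Longrightarrow> a = 0"
begin

lemma integral_nondegenerate: "(\<And>y. I (x * y) = 0) \<Longrightarrow> x = 0"
  using definite by blast

lemma integral_eqI: "(\<And>y. I (x * y) = I (x' * y)) \<Longrightarrow> x = x'"
  using integral_nondegenerate[of "x - x'"] by (simp add: left_diff_distrib I_diff)

lemma integral_star_eqI: "(\<And>y. I (y * star x) = I (y * star x')) \<Longrightarrow> x = x'"
  using definite[of "x - x'"] by (simp add: right_diff_distrib star_diff I_diff)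

lemma integral_convolution_star:
  "I (conv g f * star h) = tensor_lift (\<lambda>a b. I (f * star a) * I (g * star b)) (\<Delta> h)"
proof -
  have "cbilinear (\<lambda>a b. I (f * a) * I (g * b))" by (intro clin)
  then show ?thesis by (simp add: integral_convolution comult_star_lift)
qed

lemma convolution_assoc: "conv (conv h k) l = conv h (conv k l)"
proof (rule integral_eqI)
  fix y
  have "ctrilinear (\<lambda>p q r. I (l * p) * I (k * q) * I (h * r))"
    by (intro ctrilinearI clin)
  from coassoc_lift[OF this, of y]
  have "tensor_lift (\<lambda>a b. tensor_lift (\<lambda>c d. I (l * c) * I (k * d)) (\<Delta> a) * I (h * b)) (\<Delta> y)
      = tensor_lift (\<lambda>a b. I (l * a) * tensor_lift (\<lambda>c d. I (k * c) * I (h * d)) (\<Delta> b)) (\<Delta> y)"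
    by (simp add: tensor_lift_hom[of "\<lambda>z. z * _"] tensor_lift_hom[of "\<lambda>z. _ * z"] algebra_simps)
  then show "I (conv (conv h k) l * y) = I (conv h (conv k l) * y)"
    by (simp add: integral_convolution)
qed

text \<open>The adjoint of f \<mapsto> \<open>conv g f\<close> for the scalar product; the next
  definition is that of g \<mapsto> \<open>conv g f\<close>. Both formulas arise by moving the
  scalar factor of \<open>integral_convolution_star\<close> into the second argument.\<close>

definition left_adjoint :: "'h \<Rightarrow> 'h \<Rightarrow> 'h"
  where "left_adjoint g h = tensor_lift (\<lambda>a b. cnj (I (g * star b)) *\<^sub>C a) (\<Delta> h)"

definition right_adjoint :: "'h \<Rightarrow> 'h \<Rightarrow> 'h"
  where "right_adjoint f h = tensor_lift (\<lambda>a b. cnj (I (f * star a)) *\<^sub>C b) (\<Delta> h)"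

lemma left_adjoint: "I (conv g f * star h) = I (f * star (left_adjoint g h))"
  by (simp add: integral_convolution_star left_adjoint_def star_tensor_lift mult_tensor_lift_right
      I_tensor_lift star_scaleC mult_scaleC_right I_scaleC mult.commute)

lemma right_adjoint: "I (conv g f * star h) = I (g * star (right_adjoint f h))"
  by (simp add: integral_convolution_star right_adjoint_def star_tensor_lift mult_tensor_lift_right
      I_tensor_lift star_scaleC mult_scaleC_right I_scaleC mult.commute)

lemma clinear_inner_left: "clinear (\<lambda>b. cnj (I (g * star b)))"
  by (simp add: clinear_iff star_add star_scaleC distrib_left mult_scaleC_right I_add I_scaleC
      scaleC_complex_def)

lemma left_adjoint_in_subcoalgebra: "subcoalgebra \<Delta> A \<Longrightarrow> x \<in> A \<Longrightarrow> left_adjoint g x \<in> A"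
  unfolding left_adjoint_def by (rule subcoalgebra_left) (auto intro: clinear_inner_left)

section \<open>Convolution units of subcoalgebras as central orthogonal projections\<close>

context
  fixes A :: "'h set" and e :: 'h
  assumes A: "subcoalgebra \<Delta> A" and e: "convolution_unit conv A e"
begin

lemma unit_conv_in: "conv e f \<in> A"
  using A e by (auto simp: convolution_unit_def intro: convolution_in_subcoalgebra)

lemma conv_unit: "x \<in> A \<Longrightarrow> conv e x = x" "x \<in> A \<Longrightarrow> conv x e = x"
  using e by (auto simp: convolution_unit_def)

text \<open>The adjoint of e * _ fixes A pointwise. For x in A the defect u stays in A, and <u,u> =
  <e * u, x> - <u, x> = 0 because e * u = u; definiteness gives u = 0.\<close>

lemma inner_unit_conv:
  assumes x: "x \<in> A"
  shows "I (conv e f * star x) = I (f * star x)"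
proof -
  define u where "u = left_adjoint e x - x"
  have u: "u \<in> A"
    using x A left_adjoint_in_subcoalgebra[OF A x] unfolding u_def
    by (auto simp: subcoalgebra_def intro: complex_vector.subspace_diff)
  have "I (u * star u) = I (u * star (left_adjoint e x)) - I (u * star x)"
    by (subst (2) u_def) (simp add: star_diff right_diff_distrib I_diff)
  also have "\<dots> = 0"
    by (simp add: left_adjoint[symmetric] conv_unit u)
  finally have "left_adjoint e x = x" using definite[of u] by (simp add: u_def)
  then show ?thesis by (simp add: left_adjoint)
qed

lemma unit_conv_selfadjoint: "I (conv e f * star x) = I (f * star (conv e x))"
proof -
  have "I (f * star (conv e x)) = I (conv e f * star (conv e x))"
    by (simp add: inner_unit_conv unit_conv_in)
  also have "\<dots> = cnj (I (conv e x * star (conv e f)))" by (rule hermitian)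
  also have "\<dots> = cnj (I (x * star (conv e f)))"
    by (simp add: inner_unit_conv unit_conv_in)
  also have "\<dots> = I (conv e f * star x)" by (rule hermitian[symmetric])
  finally show ?thesis by simp
qed

lemma left_adjoint_unit: "left_adjoint e x = conv e x"
  by (rule integral_star_eqI) (simp add: left_adjoint[symmetric] unit_conv_selfadjoint)

lemma unit_central: "conv f e = conv e f"
proof -
  have "csubspace {f. conv f e = conv e f}"
    by (simp add: complex_vector.subspace_def
        clinear_0[OF clinear_convolution_left] clinear_0[OF clinear_convolution_right]
        clinear_add[OF clinear_convolution_left] clinear_add[OF clinear_convolution_right]
        clinear_scaleC[OF clinear_convolution_left] clinear_scaleC[OF clinear_convolution_right])
  moreover have "conv f e = conv e f" if "simple_subcoalgebra \<Delta> D" "f \<in> D" for D f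
  proof (cases "D \<subseteq> A")
    case True
    then show ?thesis using that conv_unit by auto
  next
    case False
    then have DA: "D \<inter> A = {0}" using simple_subcoalgebra_Int[OF that(1) A] by blast
    have D: "subcoalgebra \<Delta> D" using that(1) by (simp add: simple_subcoalgebra_def)
    \<comment> \<open>By self-adjointness e * x is also the left adjoint of e applied to x. As such
      it lies in D, as a convolution it lies in A, and D meets A only in 0.\<close>
    have e0: "conv e x = 0" if "x \<in> D" for x
      using left_adjoint_in_subcoalgebra[OF D that, of e] unit_conv_in[of x] DA
      by (auto simp: left_adjoint_unit)
    have orth: "I (e * star x) = 0" if "x \<in> D" for x
    proof -
      have "I (e * star x) = I (conv e e * star x)" using e by (simp add: convolution_unit_def)
      also have "\<dots> = 0" by (simp add: unit_conv_selfadjoint e0 that star_0 I_0)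
      finally show ?thesis .
    qed
    \<comment> \<open>The right adjoint contracts e against the first legs of \<Delta> x. These can
      be taken in D, which is orthogonal to e.\<close>
    have "right_adjoint e x \<in> {0}" if "x \<in> D" for x
      unfolding right_adjoint_def
    proof (rule tensor_sub_lift_in[where X = D and Y = D])
      show "\<Delta> x \<in> tensor_sub D D" using D that by (simp add: subcoalgebra_def)
      show "cbilinear (\<lambda>a b. cnj (I (e * star a)) *\<^sub>C b)"
        by (intro clinear_intros clinear_inner_left)
    qed (use orth in auto)
    \<comment> \<open>Here f * e is orthogonal to all of D; it also lies in D, so it is orthogonal
      to itself.\<close>
    then have "I (conv f e * star x) = 0" if "x \<in> D" for x
      using that by (simp add: right_adjoint star_0 I_0)
    then have "conv f e = 0"
      using definite convolution_in_subcoalgebra[OF D that(2)] by blast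
    then show ?thesis by (simp add: e0 that)
  qed
  ultimately have "f \<in> {f. conv f e = conv e f}" if "f \<in> cspan (\<Union>{D. simple_subcoalgebra \<Delta> D})" for f
    using that by (elim complex_vector.span_induct) auto
  then show ?thesis using cosemisimple by (auto simp: cosemisimple_def)
qed

end

end

section \<open>Coefficient coalgebras exhaust a cosemisimple Hopf algebra\<close>

lemma in_tensor_sub_UNIV_I:
  assumes "csubspace X" and "\<And>\<psi>. clinear \<psi> \<Longrightarrow> tensor_lift (\<lambda>a b. \<psi> b *\<^sub>C a) t \<in> X"
  shows "t \<in> tensor_sub X UNIV"
  using assms by (intro in_tensor_subI) auto

lemma cspan_clinear_image:
  assumes "clinear f" "csubspace Y" "\<And>x. x \<in> G \<Longrightarrow> f x \<in> Y" "x \<in> cspan G"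
  shows "f x \<in> Y"
  using complex_vector.span_minimal[OF _ csubspace_vimage[OF assms(1,2)], of G] assms(3,4) by auto

context coalgebra
begin

lemma subcoalgebra_cspanI:
  assumes "\<And>d \<psi>. d \<in> G \<Longrightarrow> clinear \<psi> \<Longrightarrow> tensor_lift (\<lambda>a b. \<psi> b *\<^sub>C a) (\<Delta> d) \<in> cspan G"
    and "\<And>d \<phi>. d \<in> G \<Longrightarrow> clinear \<phi> \<Longrightarrow> tensor_lift (\<lambda>a b. \<phi> a *\<^sub>C b) (\<Delta> d) \<in> cspan G"
  shows "subcoalgebra \<Delta> (cspan G)"
proof (rule subcoalgebraI)
  fix d \<psi> assume d: "d \<in> cspan G" and \<psi>: "clinear (\<psi> :: 'h \<Rightarrow> complex)"
  have lin: "clinear (\<lambda>d. tensor_lift (\<lambda>a b. \<psi> b *\<^sub>C a) (\<Delta> d))"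
    "clinear (\<lambda>d. tensor_lift (\<lambda>a b. \<psi> a *\<^sub>C b) (\<Delta> d))"
    by (intro clinear_intros clinear_comult \<psi>)+
  show "tensor_lift (\<lambda>a b. \<psi> b *\<^sub>C a) (\<Delta> d) \<in> cspan G"
    by (rule cspan_clinear_image[OF lin(1) _ _ d]) (simp_all add: assms(1)[OF _ \<psi>])
  show "tensor_lift (\<lambda>a b. \<psi> a *\<^sub>C b) (\<Delta> d) \<in> cspan G"
    by (rule cspan_clinear_image[OF lin(2) _ _ d]) (simp_all add: assms(2)[OF _ \<psi>])
qed simp

text \<open>Slices of a coefficient c = \<phi>(v_0) v_1 are again coefficients: c_1 \<psi>(c_2) is
  the coefficient of \<phi> at the vector w = \<psi>(v_1) v_0, and \<psi>(c_1) c_2 is the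
  coefficient at v of the functional x \<mapsto> \<phi>(x_0) \<psi>(x_1).\<close>

lemma subcoalgebra_coefficient_coalgebra:
  fixes V :: "'v::complex_vector set"
  assumes V: "right_comodule \<Delta> \<epsilon> V \<delta>"
  shows "subcoalgebra \<Delta> (coefficient_coalgebra V \<delta>)"
  unfolding coefficient_coalgebra_def
proof (rule subcoalgebra_cspanI, safe)
  fix \<phi> :: "'v \<Rightarrow> complex" and v and \<psi> :: "'h \<Rightarrow> complex"
  assume \<phi>: "clinear \<phi>" and v: "v \<in> V" and \<psi>: "clinear \<psi>"
  have \<delta>: "clinear \<delta>" and coassoc: "tensor_assoc (tensor_map \<delta> id (\<delta> v)) = tensor_map id \<Delta> (\<delta> v)"
    using V v by (auto simp: right_comodule_def)
  let ?G = "{tensor_lift (\<lambda>x h. \<phi> x *\<^sub>C h) (\<delta> v) | \<phi> v. clinear \<phi> \<and> v \<in> V}"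
  let ?c = "tensor_lift (\<lambda>x h. \<phi> x *\<^sub>C h) (\<delta> v)"
  have lin: "clinear (\<lambda>d. tensor_lift (\<lambda>a b. \<psi> b *\<^sub>C a) (\<Delta> d))"
    "clinear (\<lambda>d. tensor_lift (\<lambda>a b. \<psi> a *\<^sub>C b) (\<Delta> d))"
    by (intro clinear_intros clinear_comult \<psi>)+
  define w where "w = tensor_lift (\<lambda>x h. \<psi> h *\<^sub>C x) (\<delta> v)"
  have w: "w \<in> V"
    unfolding w_def using V v
    by (intro tensor_sub_lift_in[where X = V and Y = UNIV and \<beta> = "\<lambda>x h. \<psi> h *\<^sub>C x"] clinear_intros \<psi>)
      (auto simp: right_comodule_def complex_vector.subspace_scale)
  have tri: "ctrilinear (\<lambda>y k l. \<phi> y *\<^sub>C \<psi> l *\<^sub>C k)" "ctrilinear (\<lambda>y k l. \<phi> y *\<^sub>C \<psi> k *\<^sub>C l)"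
    by (intro ctrilinearI clinear_intros \<phi> \<psi>)+
  have "tensor_lift (\<lambda>a b. \<psi> b *\<^sub>C a) (\<Delta> ?c)
      = tensor_lift (\<lambda>x h. tensor_lift (\<lambda>a b. \<phi> x *\<^sub>C \<psi> b *\<^sub>C a) (\<Delta> h)) (\<delta> v)"
    by (simp add: tensor_lift_clinear[OF lin(1)] clinear_scaleC[OF lin(1)] tensor_lift_fun_scaleC
        del: complex_vector.scale_scale)
  also have "\<dots> = tensor_lift (\<lambda>x h. tensor_lift (\<lambda>y k. \<phi> y *\<^sub>C \<psi> h *\<^sub>C k) (\<delta> x)) (\<delta> v)"
    by (rule coassoc_lift_general[OF tri(1) coassoc, symmetric])
  also have "\<dots> = tensor_lift (\<lambda>y k. \<phi> y *\<^sub>C k) (\<delta> w)"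
  proof -
    have "clinear (\<lambda>x. tensor_lift (\<lambda>y k. \<phi> y *\<^sub>C k) (\<delta> x))"
      by (intro clinear_intros \<phi> \<delta>)
    from tensor_lift_clinear[OF this, of "\<lambda>x h. \<psi> h *\<^sub>C x" "\<delta> v"] clinear_scaleC[OF this]
    show ?thesis
      by (simp add: w_def tensor_lift_fun_scaleC[symmetric] scaleC_scaleC mult.commute)
  qed
  finally show "tensor_lift (\<lambda>a b. \<psi> b *\<^sub>C a) (\<Delta> ?c) \<in> cspan ?G"
    using \<phi> w by (auto intro: complex_vector.span_base)
  have "tensor_lift (\<lambda>a b. \<psi> a *\<^sub>C b) (\<Delta> ?c)
      = tensor_lift (\<lambda>x h. tensor_lift (\<lambda>a b. \<phi> x *\<^sub>C \<psi> a *\<^sub>C b) (\<Delta> h)) (\<delta> v)"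
    by (simp add: tensor_lift_clinear[OF lin(2)] clinear_scaleC[OF lin(2)] tensor_lift_fun_scaleC
        del: complex_vector.scale_scale)
  also have "\<dots> = tensor_lift (\<lambda>x h. tensor_lift (\<lambda>y k. \<phi> y *\<^sub>C \<psi> k *\<^sub>C h) (\<delta> x)) (\<delta> v)"
    by (rule coassoc_lift_general[OF tri(2) coassoc, symmetric])
  also have "\<dots> = tensor_lift (\<lambda>x h. tensor_lift (\<lambda>y k. \<phi> y * \<psi> k) (\<delta> x) *\<^sub>C h) (\<delta> v)"
    by (simp add: scaleC_scaleC tensor_lift_hom[of "\<lambda>z. z *\<^sub>C _"] scaleC_add_left)
  finally show "tensor_lift (\<lambda>a b. \<psi> a *\<^sub>C b) (\<Delta> ?c) \<in> cspan ?G"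
    using v
    by (auto intro!: complex_vector.span_base clinear_intros \<phi> \<psi> \<delta>
        exI[of _ "\<lambda>x. tensor_lift (\<lambda>y k. \<phi> y * \<psi> k) (\<delta> x)"] exI[of _ v])
qed

lemma subcoalgebra_cspan_UN:
  assumes "\<And>l. l \<in> K \<Longrightarrow> subcoalgebra \<Delta> (C l)"
  shows "subcoalgebra \<Delta> (cspan (\<Union>l\<in>K. C l))"
proof (rule subcoalgebra_cspanI, safe)
  fix d l and \<psi> :: "'h \<Rightarrow> complex" assume *: "l \<in> K" "d \<in> C l" "clinear \<psi>"
  show "tensor_lift (\<lambda>a b. \<psi> b *\<^sub>C a) (\<Delta> d) \<in> cspan (\<Union>l\<in>K. C l)"
    by (rule complex_vector.span_base, rule UN_I[OF *(1)], rule subcoalgebra_left[OF assms[OF *(1)] *(2,3)])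
  show "tensor_lift (\<lambda>a b. \<psi> a *\<^sub>C b) (\<Delta> d) \<in> cspan (\<Union>l\<in>K. C l)"
    by (rule complex_vector.span_base, rule UN_I[OF *(1)], rule subcoalgebra_right[OF assms[OF *(1)] *(2,3)])
qed

text \<open>Any nonzero \<open>d\<close> lies in the finite-dimensional right coideal of all \<open>d\<^sub>1 \<phi>(d\<^sub>2)\<close>; a nonzero
  subcoideal of minimal dimension is simple.\<close>

lemma simple_coideal_exists:
  assumes D: "subcoalgebra \<Delta> D" "D \<noteq> {0}"
  shows "\<exists>W\<subseteq>D. simple_comodule \<Delta> \<epsilon> W \<Delta>"
proof -
  obtain d where d: "d \<in> D" "d \<noteq> 0"
    using D complex_vector.subspace_0 unfolding subcoalgebra_def by blast
  define G where "G = {tensor_lift (\<lambda>a b. \<phi> b *\<^sub>C a) (\<Delta> d) | \<phi>. clinear \<phi>}"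
  \<comment> \<open>The finitely many first legs of one representative of \<Delta> d; their number
    bounds the dimension of every subspace of \<open>cspan G\<close>.\<close>
  define F where "F = fst ` set (rep_tensor (\<Delta> d))"
  have GF: "cspan G \<subseteq> cspan F"
  proof (intro complex_vector.span_minimal subsetI)
    fix x assume "x \<in> G"
    then show "x \<in> cspan F"
      unfolding G_def tensor_lift_def F_def
      by (auto intro!: csubspace_sum_list[OF complex_vector.subspace_span]
          complex_vector.span_scale[OF complex_vector.span_base] image_eqI[of _ fst "(_, _)"])
  qed simp
  have GD: "cspan G \<subseteq> D"
    by (intro complex_vector.span_minimal)
      (use D d in \<open>auto simp: G_def subcoalgebra_def[of _ D] intro: subcoalgebra_left\<close>)
  have dG: "d \<in> cspan G"
    using counit_right[of d] clinear_counit unfolding G_def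
    by (intro complex_vector.span_base) (auto intro!: exI[of _ \<epsilon>])
  have subG: "subcomodule \<Delta> (cspan G)"
    unfolding subcomodule_def
  proof (intro conjI ballI in_tensor_sub_UNIV_I)
    fix x \<psi> assume x: "x \<in> cspan G" and \<psi>: "clinear (\<psi> :: 'h \<Rightarrow> complex)"
    have lin: "clinear (\<lambda>d. tensor_lift (\<lambda>a b. \<psi> b *\<^sub>C a) (\<Delta> d))"
      by (intro clinear_intros clinear_comult \<psi>)
    from lin _ _ x show "tensor_lift (\<lambda>a b. \<psi> b *\<^sub>C a) (\<Delta> x) \<in> cspan G"
    proof (rule cspan_clinear_image)
      fix y assume "y \<in> G"
      then obtain \<phi> :: "'h \<Rightarrow> complex" where \<phi>: "clinear \<phi>" and y: "y = tensor_lift (\<lambda>a b. \<phi> b *\<^sub>C a) (\<Delta> d)"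
        by (auto simp: G_def)
      have tri: "ctrilinear (\<lambda>a b c. \<phi> c *\<^sub>C \<psi> b *\<^sub>C a)" by (intro ctrilinearI clinear_intros \<phi> \<psi>)
      have "tensor_lift (\<lambda>a b. \<psi> b *\<^sub>C a) (\<Delta> y)
          = tensor_lift (\<lambda>x h. tensor_lift (\<lambda>a b. \<phi> h *\<^sub>C \<psi> b *\<^sub>C a) (\<Delta> x)) (\<Delta> d)"
        by (simp add: y tensor_lift_clinear[OF lin] clinear_scaleC[OF lin] tensor_lift_fun_scaleC
        del: complex_vector.scale_scale)
      also have "\<dots> = tensor_lift (\<lambda>x h. tensor_lift (\<lambda>b c. \<phi> c * \<psi> b) (\<Delta> h) *\<^sub>C x) (\<Delta> d)"
        using coassoc_lift[OF tri, of d]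
        by (simp add: scaleC_scaleC tensor_lift_hom[of "\<lambda>z. z *\<^sub>C _"] scaleC_add_left)
      finally show "tensor_lift (\<lambda>a b. \<psi> b *\<^sub>C a) (\<Delta> y) \<in> cspan G"
        unfolding G_def
        by (auto intro!: complex_vector.span_base clinear_intros clinear_comult \<phi> \<psi>
            exI[of _ "\<lambda>h. tensor_lift (\<lambda>b c. \<phi> c * \<psi> b) (\<Delta> h)"])
    qed simp
  qed simp_all
  define P where "P = (\<lambda>n. \<exists>B. complex_vector.independent B \<and> finite B \<and> card B = n
    \<and> cspan B \<subseteq> cspan G \<and> cspan B \<noteq> {0} \<and> subcomodule \<Delta> (cspan B))"
  have basis: "\<exists>B. complex_vector.independent B \<and> finite B \<and> cspan B = W"
    if "csubspace W" "W \<subseteq> cspan G" for W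
  proof -
    obtain B where B: "B \<subseteq> W" "complex_vector.independent B" "W \<subseteq> cspan B"
      using complex_vector.maximal_independent_subset[of W] by metis
    then have "cspan B = W" using that(1) complex_vector.span_minimal by blast
    moreover have "finite B"
      using complex_vector.independent_span_bound[of F B] B that GF by (auto simp: F_def)
    ultimately show ?thesis using B by blast
  qed
  have "\<exists>n. P n"
    using basis[of "cspan G"] subG dG d(2) unfolding P_def by fastforce
  then have "P (LEAST n. P n)" by (rule LeastI_ex)
  then obtain B where B: "complex_vector.independent B" "finite B" "card B = (LEAST n. P n)"
    "cspan B \<subseteq> cspan G" "cspan B \<noteq> {0}" "subcomodule \<Delta> (cspan B)"
    unfolding P_def by blast
  have "W = {0} \<or> W = cspan B" if W: "W \<subseteq> cspan B" "subcomodule \<Delta> W" for W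
  proof (rule ccontr)
    assume *: "\<not> (W = {0} \<or> W = cspan B)"
    have "csubspace W" using W(2) by (simp add: subcomodule_def)
    with basis[of W] W B(4) obtain C where C: "complex_vector.independent C" "finite C" "cspan C = W"
      by blast
    then have "P (card C)" unfolding P_def using * W B(4) by (intro exI[of _ C]) auto
    then have le: "card B \<le> card C" unfolding B(3) by (rule Least_le)
    obtain w where w: "w \<in> cspan B" "w \<notin> W" using * W(1) by blast
    have "complex_vector.independent (insert w C)" using w C by (intro complex_vector.independent_insertI) auto
    moreover have "insert w C \<subseteq> cspan B" using w C W(1) complex_vector.span_superset[of C] by blast
    ultimately have "card (insert w C) \<le> card B"
      using complex_vector.independent_span_bound[OF B(2)] by blast
    moreover have "w \<notin> C" using w C complex_vector.span_superset[of C] by blast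
    ultimately show False using le C(2) by simp
  qed
  moreover have "right_comodule \<Delta> \<epsilon> (cspan B) \<Delta>"
    using B(6) clinear_comult coassoc counit_right by (simp add: right_comodule_def subcomodule_def)
  ultimately have "simple_comodule \<Delta> \<epsilon> (cspan B) \<Delta>"
    using B(5) by (simp add: simple_comodule_def)
  then show ?thesis using B(4) GD by blast
qed

text \<open>Composing with an extension of the inverse of \<open>f : W \<cong> V\<close>, the counit becomes a coefficient
  functional on \<open>V\<close>.\<close>

lemma comodule_iso_subset_coefficients:
  fixes W V :: "'h set"
  assumes W: "right_comodule \<Delta> \<epsilon> W \<Delta>" and iso: "comodule_iso W \<Delta> V \<delta>"
  shows "W \<subseteq> coefficient_coalgebra V \<delta>"
proof
  fix w assume w: "w \<in> W"
  obtain f where f: "clinear f" "bij_betw f W V" "\<And>v. v \<in> W \<Longrightarrow> \<delta> (f v) = tensor_map f id (\<Delta> v)"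
    using iso by (auto simp: comodule_iso_def)
  have WW: "cspan W = W" using W by (simp only: right_comodule_def complex_vector.span_eq_iff)
  then obtain g where g: "clinear g" "\<And>x. x \<in> W \<Longrightarrow> g (f x) = x"
    using complex_vector_pair.linear_inj_on_left_inverse[OF f(1), of W] f(2)
    unfolding WW by (auto simp: bij_betw_def)
  define \<phi> where "\<phi> = (\<lambda>x. \<epsilon> (g x))"
  have \<phi>: "clinear \<phi>" unfolding \<phi>_def by (rule clinear_compose[OF clinear_counit g(1)])
  have b: "cbilinear (\<lambda>x h :: 'h. \<phi> x *\<^sub>C h)" "cbilinear (\<lambda>x h. \<phi> (f x) *\<^sub>C h)" "cbilinear (\<lambda>x h. \<epsilon> x *\<^sub>C h)"
    by (intro clinear_intros \<phi> clinear_compose[OF \<phi>] f(1) clinear_counit)+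
  have "tensor_lift (\<lambda>x h. \<phi> x *\<^sub>C h) (\<delta> (f w)) = tensor_lift (\<lambda>x h. \<phi> (f x) *\<^sub>C h) (\<Delta> w)"
    using w by (simp add: f(3) tensor_lift_tensor_map b)
  also have "\<dots> = tensor_lift (\<lambda>x h. \<epsilon> x *\<^sub>C h) (\<Delta> w)"
    by (rule tensor_sub_lift_cong[where X = W and Y = UNIV])
      (use w W b g in \<open>auto simp: right_comodule_def \<phi>_def\<close>)
  also have "\<dots> = w" by (rule counit_left)
  finally show "w \<in> coefficient_coalgebra V \<delta>"
    unfolding coefficient_coalgebra_def using \<phi> f(2) w
    by (intro complex_vector.span_base) (auto simp: bij_betw_def intro!: exI[of _ \<phi>] exI[of _ "f w"])
qed

end

section \<open>Simple subcoalgebras and the filtration by coefficient sums\<close>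

context bialgebra
begin

context
  fixes \<Lambda> :: "'i set" and V :: "'i \<Rightarrow> 'h set" and \<delta> o'
  assumes classes: "simple_comodule_classes \<Delta> \<epsilon> \<Lambda> V \<delta> o'"
begin

lemma subcoalgebra_coefficients: "l \<in> \<Lambda> \<Longrightarrow> subcoalgebra \<Delta> (coefficient_coalgebra (V l) (\<delta> l))"
  using classes by (intro subcoalgebra_coefficient_coalgebra)
    (auto simp: simple_comodule_classes_def simple_comodule_def)

lemma subcoalgebra_coefficient_sum: "K \<subseteq> \<Lambda> \<Longrightarrow> subcoalgebra \<Delta> (coefficient_sum V \<delta> K)"
  unfolding coefficient_sum_def
  by (rule subcoalgebra_cspan_UN, rule subcoalgebra_coefficients) (rule subsetD)

lemma coefficient_coalgebra_subset: "l \<in> K \<Longrightarrow> coefficient_coalgebra (V l) (\<delta> l) \<subseteq> coefficient_sum V \<delta> K"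
  unfolding coefficient_sum_def by (rule subset_trans[OF _ complex_vector.span_superset]) (rule UN_upper)

lemma coefficient_sum_mono: "K \<subseteq> L \<Longrightarrow> coefficient_sum V \<delta> K \<subseteq> coefficient_sum V \<delta> L"
  unfolding coefficient_sum_def by (rule complex_vector.span_mono) (rule UN_mono, auto)

text \<open>D contains a simple right coideal, and this sits inside the coefficient coalgebra of the
  representative of its class. D thus meets that subcoalgebra nontrivially, and simplicity of D
  forces inclusion.\<close>

lemma simple_subcoalgebra_subset_coefficients:
  assumes D: "simple_subcoalgebra \<Delta> D"
  shows "\<exists>l\<in>\<Lambda>. D \<subseteq> coefficient_coalgebra (V l) (\<delta> l)"
proof -
  obtain W where W: "W \<subseteq> D" "simple_comodule \<Delta> \<epsilon> W \<Delta>"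
    using simple_coideal_exists[of D] D by (auto simp: simple_subcoalgebra_def)
  obtain l where l: "l \<in> \<Lambda>" "comodule_iso W \<Delta> (V l) (\<delta> l)"
  proof -
    have "\<forall>(W :: 'h set) \<delta>'. simple_comodule \<Delta> \<epsilon> W \<delta>' \<longrightarrow> (\<exists>l\<in>\<Lambda>. comodule_iso W \<delta>' (V l) (\<delta> l))"
      using classes unfolding simple_comodule_classes_def by (elim conjE) assumption
    from this[rule_format, OF W(2)] show thesis by (elim bexE) (rule that)
  qed
  have "W \<subseteq> coefficient_coalgebra (V l) (\<delta> l)"
    using comodule_iso_subset_coefficients[OF _ l(2)] W(2) by (simp add: simple_comodule_def)
  moreover obtain w where "w \<in> W" "w \<noteq> 0"
  proof -
    have "0 \<in> W" "W \<noteq> {0}"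
      using W(2) by (auto simp: simple_comodule_def right_comodule_def intro: complex_vector.subspace_0)
    then show thesis using that by auto
  qed
  ultimately have "D \<inter> coefficient_coalgebra (V l) (\<delta> l) \<noteq> {0}"
    using W(1) by blast
  then show ?thesis
    using simple_subcoalgebra_Int[OF D subcoalgebra_coefficients[OF l(1)]] l(1) by auto
qed

text \<open>The coefficient of the trivial comodule for a functional with value 1 at the generator.
  This will force the counit to be 1 on each e_K.\<close>

lemma one_in_coefficient_sum:
  assumes "o' \<in> K"
  shows "1 \<in> coefficient_sum V \<delta> K"
proof -
  obtain v where v: "v \<noteq> 0" "V o' = cspan {v}" "\<delta> o' v = v \<otimes> 1"
    using classes by (auto simp: simple_comodule_classes_def trivial_comodule_def)
  then obtain \<psi> :: "'h \<Rightarrow> complex" where \<psi>: "clinear \<psi>" "\<psi> v \<noteq> 0"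
    using clinear_functional_separates by blast
  define \<phi> where "\<phi> = (\<lambda>x. inverse (\<psi> v) * \<psi> x)"
  have \<phi>: "clinear \<phi>" unfolding \<phi>_def by (intro clinear_intros \<psi>)
  have "cbilinear (\<lambda>x h :: 'h. \<phi> x *\<^sub>C h)" by (intro clinear_intros \<phi>)
  then have "tensor_lift (\<lambda>x h. \<phi> x *\<^sub>C h) (\<delta> o' v) = 1"
    using \<psi>(2) by (simp add: v(3) tensor_lift_tens_cbilinear \<phi>_def scaleC_one)
  then have "1 \<in> coefficient_coalgebra (V o') (\<delta> o')"
    unfolding coefficient_coalgebra_def using \<phi> v(2)
    by (intro complex_vector.span_base) (auto intro!: complex_vector.span_base exI[of _ \<phi>] exI[of _ v])
  then show ?thesis using coefficient_coalgebra_subset[OF assms] by blast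
qed

text \<open>The subspaces H_K are directed under unions of index sets, so the union of all of them
  is a subspace. It contains every simple subcoalgebra, and these span H.\<close>

lemma in_coefficient_sum:
  assumes "cosemisimple \<Delta>"
  shows "\<exists>K\<in>C\<^sub>0 \<Lambda> o'. h \<in> coefficient_sum V \<delta> K"
proof -
  let ?X = "{h. \<exists>K\<in>C\<^sub>0 \<Lambda> o'. h \<in> coefficient_sum V \<delta> K}"
  have o': "o' \<in> \<Lambda>" using classes by (simp add: simple_comodule_classes_def)
  have sub: "csubspace (coefficient_sum V \<delta> K)" for K by (simp add: coefficient_sum_def)
  have "csubspace ?X"
    unfolding complex_vector.subspace_def
  proof safe
    show "\<exists>K\<in>C\<^sub>0 \<Lambda> o'. 0 \<in> coefficient_sum V \<delta> K"
      using o' by (intro bexI[of _ "{o'}"]) (simp_all add: C\<^sub>0_def complex_vector.subspace_0 sub)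
  next
    fix x y K L assume *: "K \<in> C\<^sub>0 \<Lambda> o'" "L \<in> C\<^sub>0 \<Lambda> o'" "x \<in> coefficient_sum V \<delta> K" "y \<in> coefficient_sum V \<delta> L"
    then have "x \<in> coefficient_sum V \<delta> (K \<union> L)" "y \<in> coefficient_sum V \<delta> (K \<union> L)"
      using coefficient_sum_mono[of K "K \<union> L"] coefficient_sum_mono[of L "K \<union> L"] by auto
    then show "\<exists>K\<in>C\<^sub>0 \<Lambda> o'. x + y \<in> coefficient_sum V \<delta> K"
      using * by (intro bexI[of _ "K \<union> L"]) (auto simp: C\<^sub>0_def intro: complex_vector.subspace_add[OF sub])
  next
    fix c x K assume "K \<in> C\<^sub>0 \<Lambda> o'" "x \<in> coefficient_sum V \<delta> K"
    then show "\<exists>K\<in>C\<^sub>0 \<Lambda> o'. c *\<^sub>C x \<in> coefficient_sum V \<delta> K"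
      using complex_vector.subspace_scale[OF sub] by blast
  qed
  moreover have "\<Union>{D. simple_subcoalgebra \<Delta> D} \<subseteq> ?X"
  proof safe
    fix x D assume "x \<in> D" "simple_subcoalgebra \<Delta> D"
    then obtain l where "l \<in> \<Lambda>" "x \<in> coefficient_coalgebra (V l) (\<delta> l)"
      using simple_subcoalgebra_subset_coefficients by blast
    then show "\<exists>K\<in>C\<^sub>0 \<Lambda> o'. x \<in> coefficient_sum V \<delta> K"
      using o' coefficient_coalgebra_subset[of l "{o', l}"] by (intro bexI[of _ "{o', l}"]) (auto simp: C\<^sub>0_def)
  qed
  ultimately have "cspan (\<Union>{D. simple_subcoalgebra \<Delta> D}) \<subseteq> ?X"
    using complex_vector.span_minimal by blast
  then show ?thesis using assms by (auto simp: cosemisimple_def)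
qed

end

end

section \<open>The Hilbert space completion\<close>

lemma cinner_add_right: "cinner x (y + z) = cinner x y + cinner x (z :: 'a::complex_hilbert_space)"
  by (metis cinner_commute cinner_add_left complex_cnj_add)

lemma cinner_scaleC_right: "cinner x (c *\<^sub>C y) = cnj c * cinner x (y :: 'a::complex_hilbert_space)"
  by (metis cinner_commute cinner_scaleC_left complex_cnj_mult)

lemma clinear_cinner_left: "clinear (\<lambda>x :: 'a::complex_hilbert_space. cinner x y)"
  by (simp add: clinear_iff cinner_add_left cinner_scaleC_left scaleC_complex_def)

lemma cinner_zero_left: "cinner 0 (y :: 'a::complex_hilbert_space) = 0"
  by (rule clinear_0[OF clinear_cinner_left])

lemma cinner_diff_left: "cinner (x - y) (z :: 'a::complex_hilbert_space) = cinner x z - cinner y z"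
  by (rule clinear_diff[OF clinear_cinner_left])

lemma cinner_sum_left: "cinner (sum f A) (z :: 'a::complex_hilbert_space) = (\<Sum>a\<in>A. cinner (f a) z)"
  by (rule clinear_sum[OF clinear_cinner_left])

lemma cinner_sum_right: "cinner z (sum f A) = (\<Sum>a\<in>A. cinner z (f a :: 'a::complex_hilbert_space))"
  by (subst cinner_commute) (simp add: cinner_sum_left cinner_commute[symmetric])

lemma cinner_eq_0_iff: "cinner x x = 0 \<longleftrightarrow> (x :: 'a::complex_hilbert_space) = 0"
  by (simp add: cinner_norm)

lemma norm_scaleC: "norm (c *\<^sub>C x) = cmod c * norm (x :: 'a::complex_hilbert_space)"
proof -
  have "complex_of_real ((norm (c *\<^sub>C x))\<^sup>2) = c * cnj c * complex_of_real ((norm x)\<^sup>2)"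
    by (simp only: cinner_norm[symmetric] cinner_scaleC_left cinner_scaleC_right ac_simps)
  also have "\<dots> = complex_of_real ((cmod c * norm x)\<^sup>2)"
    by (simp add: complex_norm_square[symmetric] power_mult_distrib)
  finally have "(norm (c *\<^sub>C x))\<^sup>2 = (cmod c * norm x)\<^sup>2"
    unfolding of_real_eq_iff .
  then show ?thesis by simp
qed

lemma cinner_bound: "cmod (cinner x y) \<le> norm x * norm (y :: 'a::complex_hilbert_space)"
proof (cases "y = 0")
  case True
  then show ?thesis by (simp add: cinner_commute[of x 0] cinner_zero_left)
next
  case False
  \<comment> \<open>The coefficient of the orthogonal projection of x onto y; Pythagoras for x = z +
    c y then gives Cauchy-Schwarz.\<close>
  define c where "c = cinner x y / complex_of_real ((norm y)\<^sup>2)"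
  define z where "z = x - c *\<^sub>C y"
  have zy: "cinner z y = 0"
    using False by (simp add: z_def cinner_diff_left cinner_scaleC_left c_def cinner_norm)
  have x: "x = z + c *\<^sub>C y" by (simp add: z_def)
  have yz: "cinner y z = 0" using zy cinner_commute[of y z] by simp
  have "cinner x x = cinner z z + c * cnj c * cinner y y"
    by (simp add: x cinner_add_left cinner_add_right cinner_scaleC_left cinner_scaleC_right zy yz)
  also have "\<dots> = complex_of_real ((norm z)\<^sup>2 + (cmod c * norm y)\<^sup>2)"
    by (simp add: cinner_norm complex_norm_square[symmetric] power_mult_distrib)
  finally have "(norm x)\<^sup>2 = (norm z)\<^sup>2 + (cmod c * norm y)\<^sup>2"
    unfolding cinner_norm of_real_eq_iff .
  then have "(cmod c * norm y)\<^sup>2 \<le> (norm x)\<^sup>2" by simp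
  then have "cmod c * norm y \<le> norm x" by (rule power2_le_imp_le) simp
  moreover have "cmod c = cmod (cinner x y) / (norm y)\<^sup>2" by (simp add: c_def norm_divide norm_power)
  ultimately show ?thesis
    using False by (simp add: power2_eq_square field_simps)
qed

lemma bounded_bilinear_cinner:
  "bounded_bilinear (cinner :: 'a::complex_hilbert_space \<Rightarrow> 'a \<Rightarrow> complex)"
proof
  show "\<exists>K. \<forall>x y :: 'a. norm (cinner x y) \<le> norm x * norm y * K"
    by (rule exI[of _ 1]) (simp add: cinner_bound)
qed (simp_all add: cinner_add_left cinner_add_right scaleR_scaleC cinner_scaleC_left
    cinner_scaleC_right scaleR_conv_of_real)

lemma cinner_eqI:
  fixes x y :: "'a::complex_hilbert_space"
  assumes "closure (cspan S) = UNIV" "\<And>s. s \<in> S \<Longrightarrow> cinner x s = cinner y s"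
  shows "x = y"
proof -
  have 1: "cinner s (x - y) = 0" if "s \<in> S" for s
    using assms(2)[OF that] by (subst cinner_commute) (simp add: cinner_diff_left)
  have "cspan S \<subseteq> {s. cinner s (x - y) \<in> {0}}"
    using 1 by (intro complex_vector.span_minimal csubspace_vimage clinear_cinner_left) auto
  then have "closure (cspan S) \<subseteq> {s. cinner s (x - y) = 0}"
    by (intro closure_minimal closed_Collect_eq
        bounded_bilinear.continuous_on[OF bounded_bilinear_cinner]) (auto intro: continuous_intros)
  then have "cinner (x - y) (x - y) = 0" using assms(1) by blast
  then show ?thesis by (simp add: cinner_eq_0_iff)
qed

lemma dense_eqI:
  fixes f g :: "'a::topological_space \<Rightarrow> 'b::t2_space"
  assumes "closure (range \<iota>) = UNIV" "continuous_on UNIV f" "continuous_on UNIV g"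
    and "\<And>h. f (\<iota> h) = g (\<iota> h)"
  shows "f x = g x"
proof -
  have "closure (range \<iota>) \<subseteq> {x. f x = g x}"
    by (rule closure_minimal) (use assms in \<open>auto intro: closed_Collect_eq\<close>)
  then show ?thesis using assms(1) by blast
qed

lemma hilbert_completion_hermitian:
  "hilbert_completion ip \<iota> \<Longrightarrow> ip a b = cnj (ip b a)"
  by (metis hilbert_completion_def cinner_commute)

lemma hilbert_completion_definite:
  assumes "hilbert_completion ip \<iota>" "ip a a = 0"
  shows "a = 0"
proof -
  have "\<iota> a = 0" using assms by (metis hilbert_completion_def cinner_eq_0_iff)
  moreover have "\<iota> 0 = 0" using assms(1) by (intro clinear_0) (simp add: hilbert_completion_def)
  ultimately show ?thesis using assms(1) by (metis hilbert_completion_def injD)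
qed

section \<open>Algebra, approximate unit and counit on the completion\<close>

locale convolution_completion = compact_hopf_integral \<Delta> \<epsilon> S star I
  for \<Delta> :: "'h::complex_algebra_1 \<Rightarrow> ('h, 'h) tensor" and \<epsilon> :: "'h \<Rightarrow> complex" and S :: "'h \<Rightarrow> 'h"
    and star :: "'h \<Rightarrow> 'h" and I :: "'h \<Rightarrow> complex" +
  fixes \<iota> :: "'h \<Rightarrow> 'l::complex_hilbert_space" and m :: "'l \<Rightarrow> 'l \<Rightarrow> 'l"
  assumes completion: "hilbert_completion (\<lambda>a b. I (a * star b)) \<iota>"
    and conv_ext: "convolution_extension (convolution \<Delta> S I) \<iota> m"
begin

lemma cinner_\<iota>: "cinner (\<iota> a) (\<iota> b) = I (a * star b)"
  and clinear_\<iota>: "clinear \<iota>"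
  and inj_\<iota>: "inj \<iota>"
  and dense_\<iota>: "closure (range \<iota>) = UNIV"
  using completion by (simp_all add: hilbert_completion_def)

lemma m_\<iota>: "m (\<iota> g) (\<iota> f) = \<iota> (conv g f)"
  and cbilinear_m: "cbilinear m"
  and bounded_bilinear_m: "bounded_bilinear m"
  using conv_ext by (simp_all add: convolution_extension_def bounded_cbilinear_def)

lemmas continuous_on_m = bounded_bilinear.continuous_on[OF bounded_bilinear_m]

lemma m_scaleC: "m (c *\<^sub>C x) y = c *\<^sub>C m x y" "m x (c *\<^sub>C y) = c *\<^sub>C m x y"
  using cbilinear_m by (simp_all add: cbilinear_def clinear_iff)

lemmas continuous_m_intros = continuous_on_m continuous_on_id continuous_on_const

lemma m_assoc: "m (m a b) c = m a (m b c)"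
proof -
  have 1: "m (m (\<iota> a) (\<iota> b)) c = m (\<iota> a) (m (\<iota> b) c)" for a b
    by (rule dense_eqI[OF dense_\<iota>, where x = c])
      (intro continuous_m_intros | simp add: m_\<iota> convolution_assoc)+
  have 2: "m (m (\<iota> a) b) c = m (\<iota> a) (m b c)" for a
    by (rule dense_eqI[OF dense_\<iota>, where x = b]) (intro continuous_m_intros | simp add: 1)+
  show ?thesis
    by (rule dense_eqI[OF dense_\<iota>, where x = a]) (intro continuous_m_intros | simp add: 2)+
qed

lemma topological_algebra_m: "topological_algebra m"
  using bounded_bilinear_m cbilinear_m by (simp add: topological_algebra_def bounded_cbilinear_def m_assoc)

lemma m_unit_central:
  assumes "subcoalgebra \<Delta> A" "convolution_unit conv A e"
  shows "m x (\<iota> e) = m (\<iota> e) x"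
  by (rule dense_eqI[OF dense_\<iota>, where x = x])
    (intro continuous_m_intros | simp add: m_\<iota> unit_central[OF assms])+

text \<open>For y = e * f the projection property gives <y,y> = <f,y>, so Cauchy-Schwarz bounds the
  norm of y by that of f. The inequality is a closed condition and spreads from H to its
  completion.\<close>

lemma norm_m_unit:
  assumes "subcoalgebra \<Delta> A" "convolution_unit conv A e"
  shows "norm (m (\<iota> e) x) \<le> norm x"
proof -
  have le: "norm (\<iota> (conv e f)) \<le> norm (\<iota> f)" for f
  proof -
    let ?y = "\<iota> (conv e f)"
    have "cinner ?y ?y = cinner (\<iota> f) ?y"
      by (simp add: cinner_\<iota> inner_unit_conv[OF assms] unit_conv_in[OF assms])
    then have "cmod (cinner ?y ?y) \<le> norm (\<iota> f) * norm ?y" by (simp add: cinner_bound)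
    then have "norm ?y * norm ?y \<le> norm (\<iota> f) * norm ?y"
      by (simp add: cinner_norm norm_of_real norm_power power2_eq_square norm_mult)
    then show ?thesis by (cases "?y = 0") (auto simp: mult_le_cancel_right)
  qed
  have "closed {x. norm (m (\<iota> e) x) \<le> norm x}"
    by (intro closed_Collect_le continuous_intros continuous_on_m)
  then have "closure (range \<iota>) \<subseteq> {x. norm (m (\<iota> e) x) \<le> norm x}"
    by (intro closure_minimal) (auto simp: m_\<iota> le)
  then show ?thesis using dense_\<iota> by blast
qed

context
  fixes \<Lambda> :: "'i set" and V :: "'i \<Rightarrow> 'h set" and \<delta> o' and e :: "'i set \<Rightarrow> 'h"
  assumes classes: "simple_comodule_classes \<Delta> \<epsilon> \<Lambda> V \<delta> o'"
    and units: "\<And>K. K \<in> C\<^sub>0 \<Lambda> o' \<Longrightarrow> convolution_unit conv (coefficient_sum V \<delta> K) (e K)"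
begin

lemma subcoalgebra_C\<^sub>0: "K \<in> C\<^sub>0 \<Lambda> o' \<Longrightarrow> subcoalgebra \<Delta> (coefficient_sum V \<delta> K)"
  by (rule subcoalgebra_coefficient_sum[OF classes]) (simp add: C\<^sub>0_def)

lemma m_e_central: "K \<in> C\<^sub>0 \<Lambda> o' \<Longrightarrow> m x (\<iota> (e K)) = m (\<iota> (e K)) x"
  by (rule m_unit_central[OF subcoalgebra_C\<^sub>0 units])

lemma directed_C\<^sub>0: "directed (C\<^sub>0 \<Lambda> o')"
  unfolding directed_def
proof (intro conjI ballI)
  have "o' \<in> \<Lambda>" using classes by (simp add: simple_comodule_classes_def)
  then have "{o'} \<in> C\<^sub>0 \<Lambda> o'" by (simp add: C\<^sub>0_def)
  then show "C\<^sub>0 \<Lambda> o' \<noteq> {}" by blast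
next
  fix K L assume "K \<in> C\<^sub>0 \<Lambda> o'" "L \<in> C\<^sub>0 \<Lambda> o'"
  then have "K \<union> L \<in> C\<^sub>0 \<Lambda> o'" by (simp add: C\<^sub>0_def)
  then show "\<exists>M\<in>C\<^sub>0 \<Lambda> o'. K \<le> M \<and> L \<le> M" by (intro bexI[of _ "K \<union> L"]) auto
qed

lemma net_converges_unit: "net_converges (C\<^sub>0 \<Lambda> o') (\<lambda>K. m (\<iota> (e K)) a) a"
  unfolding net_converges_def
proof (intro allI impI, elim conjE)
  fix U assume "open U" "a \<in> U"
  then obtain r where r: "r > 0" "ball a r \<subseteq> U" using open_contains_ball by blast
  have "a \<in> closure (range \<iota>)" by (simp add: dense_\<iota>)
  \<comment> \<open>Since e_L fixes h, the error at a equals the error at a - h, which is at most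
    twice the norm of a - h; hence r / 2.\<close>
  then obtain h where h: "dist (\<iota> h) a < r / 2"
    using r(1) unfolding closure_approachable by (metis half_gt_zero rangeE)
  obtain K where K: "K \<in> C\<^sub>0 \<Lambda> o'" "h \<in> coefficient_sum V \<delta> K"
    using in_coefficient_sum[OF classes cosemisimple] by blast
  have "m (\<iota> (e L)) a \<in> U" if L: "L \<in> C\<^sub>0 \<Lambda> o'" "K \<le> L" for L
  proof -
    have "h \<in> coefficient_sum V \<delta> L" using K coefficient_sum_mono[OF classes L(2)] by blast
    then have "m (\<iota> (e L)) (\<iota> h) = \<iota> h"
      using units[OF L(1)] by (simp add: m_\<iota> convolution_unit_def)
    then have "m (\<iota> (e L)) a - a = m (\<iota> (e L)) (a - \<iota> h) - (a - \<iota> h)"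
      by (simp add: bounded_bilinear.diff_right[OF bounded_bilinear_m])
    then have "norm (m (\<iota> (e L)) a - a) \<le> norm (m (\<iota> (e L)) (a - \<iota> h)) + norm (a - \<iota> h)"
      by (simp only: norm_triangle_ineq4)
    also have "\<dots> \<le> norm (a - \<iota> h) + norm (a - \<iota> h)"
      using norm_m_unit[OF subcoalgebra_C\<^sub>0[OF L(1)] units[OF L(1)]] by simp
    also have "\<dots> < r" using h by (simp add: dist_norm norm_minus_commute)
    finally show ?thesis using r(2) by (auto simp: dist_norm norm_minus_commute)
  qed
  then show "\<exists>i\<in>C\<^sub>0 \<Lambda> o'. \<forall>j\<in>C\<^sub>0 \<Lambda> o'. i \<le> j \<longrightarrow> m (\<iota> (e j)) a \<in> U" using K(1) by blast
qed

lemma algebra_with_approximate_unit_m: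
  "algebra_with_approximate_unit m (C\<^sub>0 \<Lambda> o') (\<lambda>K. \<iota> (e K))"
proof -
  have "net_converges (C\<^sub>0 \<Lambda> o') (\<lambda>K. m a (\<iota> (e K))) a" for a
    using net_converges_unit[of a] unfolding net_converges_def by (simp add: m_e_central cong: ball_cong)
  moreover have "m (\<iota> (e K)) (\<iota> (e K)) = \<iota> (e K)" if "K \<in> C\<^sub>0 \<Lambda> o'" for K
    using units[OF that] by (simp add: m_\<iota> convolution_unit_def)
  ultimately show ?thesis
    by (simp add: algebra_with_approximate_unit_def approximate_unit_def topological_algebra_m
        directed_C\<^sub>0 net_converges_unit)
qed

lemma counit_homomorphism_integral:
  assumes "integral_extension I \<iota> \<epsilon>\<^sub>L"
  shows "counit_homomorphism m (C\<^sub>0 \<Lambda> o') (\<lambda>K. \<iota> (e K)) \<epsilon>\<^sub>L"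
proof -
  have b: "bounded_clinear \<epsilon>\<^sub>L" and ext: "\<epsilon>\<^sub>L (\<iota> f) = I f" for f
    using assms by (simp_all add: integral_extension_def)
  have cont: "continuous_on X (\<lambda>x. \<epsilon>\<^sub>L (g x))" if "continuous_on X g" for X and g :: "'l \<Rightarrow> 'l"
    using b that by (auto simp: bounded_clinear_def intro: bounded_linear.continuous_on)
  have 1: "\<epsilon>\<^sub>L (m (\<iota> a) b) = \<epsilon>\<^sub>L (\<iota> a) * \<epsilon>\<^sub>L b" for a b
    by (rule dense_eqI[OF dense_\<iota>, where x = b])
      (intro cont continuous_m_intros continuous_on_mult | simp add: m_\<iota> ext I_convolution)+
  have mult: "\<epsilon>\<^sub>L (m a b) = \<epsilon>\<^sub>L a * \<epsilon>\<^sub>L b" for a b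
    by (rule dense_eqI[OF dense_\<iota>, where x = a])
      (intro cont continuous_m_intros continuous_on_mult | simp add: 1)+
  have "I (e K) = 1" if K: "K \<in> C\<^sub>0 \<Lambda> o'" for K
  proof -
    have "1 \<in> coefficient_sum V \<delta> K"
      by (rule one_in_coefficient_sum[OF classes]) (use K in \<open>simp add: C\<^sub>0_def\<close>)
    \<comment> \<open>Multiplicativity of the integral turns this identity into I(e_K) I(1) =
      I(1).\<close>
    then have "conv (e K) 1 = 1" using units[OF K] by (simp add: convolution_unit_def)
    then show ?thesis using I_convolution[of "e K" 1] by (simp add: integral_one)
  qed
  then show ?thesis by (simp add: counit_homomorphism_def b mult ext)
qed

end

end

section \<open>The dual coproduct\<close>

lemma cbilinear_left: "cbilinear \<beta> \<Longrightarrow> clinear g \<Longrightarrow> clinear (\<lambda>x. \<beta> (g x) b)"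
  unfolding cbilinear_def by (rule clinear_compose[of "\<lambda>a. \<beta> a b"]) auto

lemma cbilinear_right: "cbilinear \<beta> \<Longrightarrow> clinear g \<Longrightarrow> clinear (\<lambda>x. \<beta> a (g x))"
  unfolding cbilinear_def by (rule clinear_compose[of "\<beta> a"]) auto

lemma clinear_sum_fun: "(\<And>a. clinear (f a)) \<Longrightarrow> clinear (\<lambda>x. \<Sum>a\<in>A. f a x)"
  by (simp add: clinear_iff sum.distrib complex_vector.scale_sum_right)

lemma tensor_lift_times:
  fixes \<beta> :: "'a::complex_vector \<Rightarrow> 'b::complex_vector \<Rightarrow> complex"
  shows "tensor_lift \<beta> s * tensor_lift \<gamma> t = tensor_lift (\<lambda>a b. tensor_lift (\<lambda>c d. \<beta> a b * \<gamma> c d) t) s"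
proof -
  have "tensor_lift \<beta> s * tensor_lift \<gamma> t = tensor_lift (\<lambda>a b. \<beta> a b * tensor_lift \<gamma> t) s"
    by (rule tensor_lift_hom[of "\<lambda>z. z * tensor_lift \<gamma> t"]) (rule distrib_right)
  moreover have "\<beta> a b * tensor_lift \<gamma> t = tensor_lift (\<lambda>c d. \<beta> a b * \<gamma> c d) t" for a b
    by (rule tensor_lift_hom[of "\<lambda>z. \<beta> a b * z"]) (rule distrib_left)
  ultimately show ?thesis by simp
qed

section \<open>Finite Parseval frames\<close>

text \<open>Finite dimension in the form in which it is used: the expansion formula of an
  orthonormal basis. It passes to the Hilbert tensor product with index set
  \<open>B \<times> B\<close>, and it bounds linear and bilinear maps explicitly.\<close>

definition parseval_frame :: "('b \<Rightarrow> 'a::complex_hilbert_space) \<Rightarrow> 'b set \<Rightarrow> bool"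
  where "parseval_frame u B \<longleftrightarrow> finite B \<and> (\<forall>x. x = (\<Sum>b\<in>B. cinner x (u b) *\<^sub>C u b))"

lemma parseval_frame_clinear:
  assumes "parseval_frame u B" "clinear f"
  shows "f x = (\<Sum>b\<in>B. cinner x (u b) *\<^sub>C f (u b))"
proof -
  have "f x = f (\<Sum>b\<in>B. cinner x (u b) *\<^sub>C u b)"
    by (rule arg_cong[where f = f]) (use assms(1) in \<open>simp add: parseval_frame_def\<close>)
  then show ?thesis by (simp add: clinear_sum[OF assms(2)] clinear_scaleC[OF assms(2)])
qed

lemma parseval_frame_cbilinear:
  assumes "parseval_frame u B" "cbilinear \<beta>"
  shows "\<beta> x y = (\<Sum>b\<in>B. \<Sum>c\<in>B. (cinner x (u b) * cinner y (u c)) *\<^sub>C \<beta> (u b) (u c))"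
proof -
  have "\<beta> x y = (\<Sum>b\<in>B. cinner x (u b) *\<^sub>C \<beta> (u b) y)"
    using assms by (intro parseval_frame_clinear[where f = "\<lambda>x. \<beta> x y"]) (simp_all add: cbilinear_def)
  also have "\<dots> = (\<Sum>b\<in>B. cinner x (u b) *\<^sub>C (\<Sum>c\<in>B. cinner y (u c) *\<^sub>C \<beta> (u b) (u c)))"
    using assms by (intro sum.cong refl arg_cong[where f = "scaleC _"] parseval_frame_clinear)
      (simp_all add: cbilinear_def)
  finally show ?thesis by (simp add: complex_vector.scale_sum_right)
qed

lemma parseval_frame_bounded_clinear:
  fixes f :: "'a::complex_hilbert_space \<Rightarrow> 'c::complex_hilbert_space" and u :: "'b \<Rightarrow> 'a"
  assumes u: "parseval_frame u B" and f: "clinear f"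
  shows "bounded_clinear f"
  unfolding bounded_clinear_def
proof
  show "bounded_linear f"
  proof (rule bounded_linear_intro)
    fix x
    have "norm (f x) \<le> (\<Sum>b\<in>B. norm (cinner x (u b) *\<^sub>C f (u b)))"
      by (subst parseval_frame_clinear[OF u f]) (rule norm_sum)
    also have "\<dots> \<le> (\<Sum>b\<in>B. norm x * norm (u b) * norm (f (u b)))"
      by (intro sum_mono) (simp add: norm_scaleC mult_right_mono cinner_bound)
    finally show "norm (f x) \<le> norm x * (\<Sum>b\<in>B. norm (u b) * norm (f (u b)))"
      by (simp add: sum_distrib_left mult.assoc)
  qed (simp_all add: clinear_add[OF f] clinear_scaleC[OF f] scaleR_scaleC)
qed (rule f)

lemma parseval_frame_bounded_cbilinear:
  fixes \<beta> :: "'a::complex_hilbert_space \<Rightarrow> 'a \<Rightarrow> 'c::complex_hilbert_space" and u :: "'b \<Rightarrow> 'a"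
  assumes u: "parseval_frame u B" and \<beta>: "cbilinear \<beta>"
  shows "bounded_cbilinear \<beta>"
  unfolding bounded_cbilinear_def
proof
  show "bounded_bilinear \<beta>"
  proof
    have "norm (\<beta> x y) \<le> norm x * norm y * (\<Sum>b\<in>B. \<Sum>c\<in>B. norm (u b) * norm (u c) * norm (\<beta> (u b) (u c)))" for x y
    proof -
      have "norm (\<beta> x y) \<le> (\<Sum>b\<in>B. \<Sum>c\<in>B. norm ((cinner x (u b) * cinner y (u c)) *\<^sub>C \<beta> (u b) (u c)))"
        by (subst parseval_frame_cbilinear[OF u \<beta>]) (intro order_trans[OF norm_sum] sum_mono norm_sum)
      also have "\<dots> \<le> (\<Sum>b\<in>B. \<Sum>c\<in>B. (norm x * norm (u b)) * (norm y * norm (u c)) * norm (\<beta> (u b) (u c)))"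
        by (intro sum_mono) (simp add: norm_scaleC norm_mult mult_right_mono mult_mono cinner_bound)
      finally show ?thesis by (simp add: sum_distrib_left ac_simps)
    qed
    then show "\<exists>K. \<forall>x y. norm (\<beta> x y) \<le> norm x * norm y * K" by blast
  qed (use \<beta> in \<open>simp_all add: cbilinear_def clinear_iff scaleR_scaleC\<close>)
qed (rule \<beta>)

lemma hilbert_tensor_productD:
  assumes "hilbert_tensor_product ht"
  shows "cbilinear ht" "cinner (ht a b) (ht c d) = cinner a c * cinner b d"
    "closure (cspan {ht a b | a b. True}) = UNIV"
  using assms by (auto simp: hilbert_tensor_product_def)

text \<open>Both sides have the same scalar product with each \<open>ht a c\<close>, once
  \<open>ht a c\<close> is itself expanded through the frame of the factors. Simple tensors span a
  dense subspace, so this determines t.\<close>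

lemma parseval_frame_tensor:
  fixes ht :: "'a::complex_hilbert_space \<Rightarrow> 'a \<Rightarrow> 't::complex_hilbert_space" and u :: "'b \<Rightarrow> 'a"
  assumes u: "parseval_frame u B" and ht: "hilbert_tensor_product ht"
  shows "parseval_frame (\<lambda>(b, c). ht (u b) (u c)) (B \<times> B)"
  unfolding parseval_frame_def
proof (intro conjI allI)
  note ht = hilbert_tensor_productD[OF ht]
  show "finite (B \<times> B)" using u by (simp add: parseval_frame_def)
  fix t
  have *: "cinner t (ht a c) = cinner (\<Sum>(b, c)\<in>B \<times> B. cinner t (ht (u b) (u c)) *\<^sub>C ht (u b) (u c)) (ht a c)" for a c
  proof -
    have "cinner t (ht a c)
        = cinner t (\<Sum>b\<in>B. \<Sum>d\<in>B. (cinner a (u b) * cinner c (u d)) *\<^sub>C ht (u b) (u d))"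
      by (simp only: parseval_frame_cbilinear[OF u ht(1), of a c])
    also have "\<dots> = (\<Sum>b\<in>B. \<Sum>d\<in>B. cnj (cinner a (u b)) * cnj (cinner c (u d)) * cinner t (ht (u b) (u d)))"
      by (simp add: cinner_sum_right cinner_scaleC_right)
    also have "\<dots> = (\<Sum>b\<in>B. \<Sum>d\<in>B. cinner t (ht (u b) (u d)) * cinner (ht (u b) (u d)) (ht a c))"
    proof (intro sum.cong HOL.refl)
      fix b d
      show "cnj (cinner a (u b)) * cnj (cinner c (u d)) * cinner t (ht (u b) (u d))
          = cinner t (ht (u b) (u d)) * cinner (ht (u b) (u d)) (ht a c)"
        unfolding ht(2) cinner_commute[of "u b" a] cinner_commute[of "u d" c] by simp
    qed
    finally show ?thesis
      by (simp add: cinner_sum_left cinner_scaleC_left sum.cartesian_product case_prod_unfold)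
  qed
  show "t = (\<Sum>p\<in>B \<times> B. cinner t (case p of (b, c) \<Rightarrow> ht (u b) (u c)) *\<^sub>C (case p of (b, c) \<Rightarrow> ht (u b) (u c)))"
  proof (rule cinner_eqI[OF ht(3)], safe)
    show "cinner t (ht a c) = cinner (\<Sum>p\<in>B \<times> B. cinner t (case p of (b, c) \<Rightarrow> ht (u b) (u c))
        *\<^sub>C (case p of (b, c) \<Rightarrow> ht (u b) (u c))) (ht a c)" for a c
      unfolding case_prod_unfold by (rule *[unfolded case_prod_unfold])
  qed
qed

text \<open>The frame of the tensor product consists of simple tensors, so a linear map is
  determined by its values on them.\<close>

lemma parseval_frame_tensor_eqI:
  fixes ht :: "'a::complex_hilbert_space \<Rightarrow> 'a \<Rightarrow> 't::complex_hilbert_space" and u :: "'b \<Rightarrow> 'a"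
  assumes u: "parseval_frame u B" and ht: "hilbert_tensor_product ht"
    and "clinear F" "clinear G" "\<And>a b. F (ht a b) = G (ht a b)"
  shows "F t = G t"
  using parseval_frame_clinear[OF parseval_frame_tensor[OF u ht], of F t]
    parseval_frame_clinear[OF parseval_frame_tensor[OF u ht], of G t] assms(3-)
  by (simp add: case_prod_unfold)

text \<open>The frame coefficients define the extension. For infinite-dimensional factors a bounded
  bilinear map may have no bounded extension to the Hilbert tensor product, so the frame has to be
  found first.\<close>

lemma hilbert_extension_exists:
  fixes ht :: "'a::complex_hilbert_space \<Rightarrow> 'a \<Rightarrow> 't::complex_hilbert_space"
    and \<beta> :: "'a \<Rightarrow> 'a \<Rightarrow> 'c::complex_hilbert_space" and u :: "'b \<Rightarrow> 'a"
  assumes u: "parseval_frame u B" and ht: "hilbert_tensor_product ht" and \<beta>: "cbilinear \<beta>"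
  shows "\<exists>F. hilbert_extension ht \<beta> F"
proof
  let ?F = "\<lambda>t. \<Sum>b\<in>B. \<Sum>c\<in>B. cinner t (ht (u b) (u c)) *\<^sub>C \<beta> (u b) (u c)"
  have "clinear ?F"
    by (intro clinear_sum_fun clinear_scaleC_left clinear_cinner_left)
  moreover have "?F (ht a c) = \<beta> a c" for a c
    by (simp add: parseval_frame_cbilinear[OF u \<beta>, of a c] hilbert_tensor_productD(2)[OF ht])
  ultimately show "hilbert_extension ht \<beta> ?F"
    using parseval_frame_bounded_clinear[OF parseval_frame_tensor[OF u ht]]
    by (simp add: hilbert_extension_def)
qed

lemma hilbert_extensionD:
  "hilbert_extension ht \<beta> F \<Longrightarrow> clinear F" "hilbert_extension ht \<beta> F \<Longrightarrow> F (ht a b) = \<beta> a b"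
  by (simp_all add: hilbert_extension_def bounded_clinear_def)

section \<open>A bounded dual coproduct and finite dimensionality\<close>

locale convolution_comult_completion = convolution_completion \<Delta> \<epsilon> S star I \<iota> m
  for \<Delta> :: "'h::complex_algebra_1 \<Rightarrow> ('h, 'h) tensor" and \<epsilon> :: "'h \<Rightarrow> complex" and S :: "'h \<Rightarrow> 'h"
    and star :: "'h \<Rightarrow> 'h" and I :: "'h \<Rightarrow> complex"
    and \<iota> :: "'h \<Rightarrow> 'l::complex_hilbert_space" and m :: "'l \<Rightarrow> 'l \<Rightarrow> 'l" +
  fixes ht :: "'l \<Rightarrow> 'l \<Rightarrow> 't::complex_hilbert_space" and D :: "'l \<Rightarrow> 't"
  assumes ht: "hilbert_tensor_product ht"
    and comult: "convolution_comult I star \<iota> ht D"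
begin

lemmas cbilinear_ht = hilbert_tensor_productD(1)[OF ht]
lemmas cinner_ht = hilbert_tensor_productD(2)[OF ht]

lemma bounded_clinear_D: "bounded_clinear D" and clinear_D: "clinear D"
  using comult by (simp_all add: convolution_comult_def bounded_clinear_def)

lemma cinner_D: "cinner (D (\<iota> h)) (ht (\<iota> g) (\<iota> f)) = I (h * star g * star f)"
  using comult unfolding convolution_comult_def by (metis star_star)

definition orthonormal :: "'h set \<Rightarrow> bool"
  where "orthonormal B \<longleftrightarrow> (\<forall>a\<in>B. \<forall>b\<in>B. I (a * star b) = (if a = b then 1 else 0))"

text \<open>Pair \<open>D 1\<close> with \<open>t = \<Sum> b \<otimes> b\<^sup>*\<close> and \<open>s = \<Sum> b\<^sup>* \<otimes> b\<close>, which have the same norm: the first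
  pairing is \<open>\<parallel>t\<parallel>\<^sup>2\<close>, so \<open>\<parallel>t\<parallel> \<le> \<parallel>D 1\<parallel>\<close>, and the second is \<open>card B\<close>.\<close>

lemma orthonormal_card_le:
  assumes "finite B" "orthonormal B"
  shows "real (card B) \<le> (norm (D (\<iota> 1)))\<^sup>2"
proof -
  define C where "C = norm (D (\<iota> 1))"
  define t where "t = (\<Sum>b\<in>B. ht (\<iota> b) (\<iota> (star b)))"
  define s where "s = (\<Sum>b\<in>B. ht (\<iota> (star b)) (\<iota> b))"
  define q where "q = (\<Sum>b\<in>B. I (star b * b))"
  have on: "I (a * star b) = (if a = b then 1 else 0)" if "a \<in> B" "b \<in> B" for a b
    using assms(2) that by (simp add: orthonormal_def)
  have "cinner t t = (\<Sum>a\<in>B. \<Sum>b\<in>B. I (a * star b) * I (star a * b))"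
    by (simp add: t_def cinner_sum_left cinner_sum_right cinner_ht cinner_\<iota> star_star)
      (rule sum.swap)
  also have "\<dots> = (\<Sum>a\<in>B. \<Sum>b\<in>B. if a = b then I (star a * b) else 0)"
    by (intro sum.cong) (auto simp: on)
  also have "\<dots> = q" using assms(1) by (simp add: q_def)
  finally have tt: "complex_of_real ((norm t)\<^sup>2) = q" by (simp only: cinner_norm)
  have "cinner s s = (\<Sum>a\<in>B. \<Sum>b\<in>B. I (star a * b) * I (a * star b))"
    by (simp add: s_def cinner_sum_left cinner_sum_right cinner_ht cinner_\<iota> star_star)
      (rule sum.swap)
  also have "\<dots> = (\<Sum>a\<in>B. \<Sum>b\<in>B. if a = b then I (star a * b) else 0)"
    by (intro sum.cong) (auto simp: on)
  also have "\<dots> = q" using assms(1) by (simp add: q_def)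
  finally have "complex_of_real ((norm s)\<^sup>2) = complex_of_real ((norm t)\<^sup>2)" by (simp only: cinner_norm tt)
  then have st: "norm s = norm t" unfolding of_real_eq_iff by simp
  have "cinner (D (\<iota> 1)) t = complex_of_real ((norm t)\<^sup>2)"
    unfolding tt by (simp add: t_def q_def cinner_sum_right cinner_D star_star)
  then have "(norm t)\<^sup>2 \<le> C * norm t"
    using cinner_bound[of "D (\<iota> 1)" t] by (simp add: C_def norm_power)
  then have t: "norm t \<le> C"
    by (cases "t = 0") (simp_all add: C_def power2_eq_square)
  have "cinner (D (\<iota> 1)) s = of_nat (card B)"
    by (simp add: s_def cinner_sum_right cinner_D star_star on)
  then have "real (card B) \<le> C * norm s"
    using cinner_bound[of "D (\<iota> 1)" s] by (simp add: C_def)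
  also have "\<dots> \<le> C * C" using t by (simp add: st C_def mult_left_mono)
  finally show ?thesis by (simp add: C_def power2_eq_square)
qed

text \<open>Sizes of orthonormal sets are bounded, so one of maximal size exists. Every element of H
  equals its expansion in it, and continuity of both sides carries the formula to the
  completion.\<close>

lemma parseval_frame_exists: "\<exists>B. parseval_frame \<iota> B"
proof -
  let ?P = "\<lambda>B. finite B \<and> orthonormal B"
  have "\<exists>B. ?P B \<and> (\<forall>B'. ?P B' \<longrightarrow> card B' \<le> card B)"
  \<comment> \<open>The maximum principle asks for a strict bound by a natural number, hence the
    ceiling and the \<open>Suc\<close>.\<close>
  proof (rule ex_has_greatest_nat[where b = "Suc (nat \<lceil>(norm (D (\<iota> 1)))\<^sup>2\<rceil>)"])
    show "?P {}" by (simp add: orthonormal_def)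
    show "\<forall>B'. ?P B' \<longrightarrow> card B' < Suc (nat \<lceil>(norm (D (\<iota> 1)))\<^sup>2\<rceil>)"
      unfolding less_Suc_eq_le
      by (auto intro!: of_nat_le_iff[where 'a = real, THEN iffD1]
          order_trans[OF orthonormal_card_le real_nat_ceiling_ge])
  qed
  then obtain B where B: "finite B" "orthonormal B"
    and max: "\<And>B'. finite B' \<Longrightarrow> orthonormal B' \<Longrightarrow> card B' \<le> card B" by blast
  have on: "I (a * star b) = (if a = b then 1 else 0)" if "a \<in> B" "b \<in> B" for a b
    using B(2) that by (simp add: orthonormal_def)
  have exp: "x = (\<Sum>b\<in>B. I (x * star b) *\<^sub>C b)" for x
  proof (rule ccontr)
    define r where "r = x - (\<Sum>b\<in>B. I (x * star b) *\<^sub>C b)"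
    assume "x \<noteq> (\<Sum>b\<in>B. I (x * star b) *\<^sub>C b)"
    then have "r \<noteq> 0" by (simp add: r_def)
    then have r: "\<iota> r \<noteq> 0" using injD[OF inj_\<iota>, of r 0] by (auto simp: clinear_0[OF clinear_\<iota>])
    have "I (r * star b) = 0" if b: "b \<in> B" for b
    proof -
      have "I (r * star b) = I (x * star b) - (\<Sum>a\<in>B. I (x * star a) * I (a * star b))"
        by (simp add: r_def left_diff_distrib I_diff sum_distrib_right clinear_sum[OF clinear_integral]
            mult_scaleC_left I_scaleC)
      also have "(\<Sum>a\<in>B. I (x * star a) * I (a * star b)) = (\<Sum>a\<in>B. if a = b then I (x * star a) else 0)"
        by (intro sum.cong) (auto simp: on b)
      finally show ?thesis using b B(1) by simp
    qed
    \<comment> \<open>The residual r is nonzero and orthogonal to B; scaled to norm 1 it would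
      enlarge B, against maximality.\<close>
    define b0 where "b0 = complex_of_real (inverse (norm (\<iota> r))) *\<^sub>C r"
    have orth: "I (b0 * star b) = 0" if "b \<in> B" for b
      using \<open>\<And>b. b \<in> B \<Longrightarrow> I (r * star b) = 0\<close>[OF that] by (simp add: b0_def mult_scaleC_left I_scaleC)
    have orth': "I (b * star b0) = 0" if "b \<in> B" for b
      using orth[OF that] hermitian[of b b0] by simp
    have one: "I (b0 * star b0) = 1"
      using r by (simp add: b0_def star_scaleC mult_scaleC_left mult_scaleC_right I_scaleC
          cinner_\<iota>[symmetric] cinner_norm power2_eq_square field_simps)
    have "b0 \<notin> B" using orth one by auto
    moreover have "orthonormal (insert b0 B)"
      unfolding orthonormal_def using one orth orth' on \<open>b0 \<notin> B\<close> by auto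
    ultimately show False using max[of "insert b0 B"] B(1) by simp
  qed
  have "x = (\<Sum>b\<in>B. cinner x (\<iota> b) *\<^sub>C \<iota> b)" for x
  proof (rule dense_eqI[OF dense_\<iota>, where f = "\<lambda>x. x" and x = x])
    have cont: "continuous_on UNIV (\<lambda>x. c x *\<^sub>C \<iota> b)" if "continuous_on UNIV c" for c :: "'l \<Rightarrow> complex" and b
    proof -
      have "bounded_linear (\<lambda>z. z *\<^sub>C \<iota> b)"
        by (rule bounded_linear_intro[where K = "norm (\<iota> b)"])
          (simp_all add: scaleC_add_left scaleR_scaleC scaleC_scaleC norm_scaleC scaleR_conv_of_real)
      then show ?thesis using that by (rule bounded_linear.continuous_on)
    qed
    show "continuous_on UNIV (\<lambda>x. \<Sum>b\<in>B. cinner x (\<iota> b) *\<^sub>C \<iota> b)"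
      by (intro continuous_on_sum cont bounded_bilinear.continuous_on[OF bounded_bilinear_cinner]
          continuous_on_id continuous_on_const)
    show "\<iota> h = (\<Sum>b\<in>B. cinner (\<iota> h) (\<iota> b) *\<^sub>C \<iota> b)" for h
      by (rule HOL.trans[OF arg_cong[OF exp[of h], of \<iota>]])
        (simp add: clinear_sum[OF clinear_\<iota>] clinear_scaleC[OF clinear_\<iota>] cinner_\<iota>)
  qed (rule continuous_on_id)
  then show ?thesis using B(1) unfolding parseval_frame_def by blast
qed

definition B :: "'h set" where "B = (SOME B. parseval_frame \<iota> B)"

lemma frame: "parseval_frame \<iota> B"
  unfolding B_def by (rule someI_ex) (rule parseval_frame_exists)

lemma finite_B: "finite B" and frame_expansion: "x = (\<Sum>b\<in>B. cinner x (\<iota> b) *\<^sub>C \<iota> b)"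
  using frame by (simp_all add: parseval_frame_def)

text \<open>A frame with vectors in the image of \<iota> makes \<iota> surjective: the completion
  adds nothing, and all remaining identities may be checked on elements of H.\<close>

lemma \<iota>_cases: obtains h where "x = \<iota> h"
proof
  show "x = \<iota> (\<Sum>b\<in>B. cinner x (\<iota> b) *\<^sub>C b)"
    by (simp add: clinear_sum[OF clinear_\<iota>] clinear_scaleC[OF clinear_\<iota>] frame_expansion[symmetric])
qed

lemma expansion: "h = (\<Sum>b\<in>B. I (h * star b) *\<^sub>C b)"
proof (rule injD[OF inj_\<iota>])
  show "\<iota> h = \<iota> (\<Sum>b\<in>B. I (h * star b) *\<^sub>C b)"
    using frame_expansion[of "\<iota> h"]
    by (simp add: clinear_sum[OF clinear_\<iota>] clinear_scaleC[OF clinear_\<iota>] cinner_\<iota>)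
qed

lemma eqI_\<iota>: "(\<And>g. cinner x (\<iota> g) = cinner y (\<iota> g)) \<Longrightarrow> x = y"
  by (rule HOL.trans[OF frame_expansion[of x] HOL.trans[OF _ frame_expansion[of y, symmetric]]]) simp

lemma eqI_ht: "(\<And>g f. cinner x (ht (\<iota> g) (\<iota> f)) = cinner y (ht (\<iota> g) (\<iota> f))) \<Longrightarrow> x = y"
  by (rule cinner_eqI[OF hilbert_tensor_productD(3)[OF ht]]) (auto, metis \<iota>_cases)

lemmas tensor_eqI = parseval_frame_tensor_eqI[OF frame ht]
lemmas extension_exists = hilbert_extension_exists[OF frame ht]
lemmas clin_L = clinear_intros cbilinear_left[OF cbilinear_ht] cbilinear_right[OF cbilinear_ht]
  cbilinear_left[OF cbilinear_m] cbilinear_right[OF cbilinear_m] clinear_compose[OF clinear_D]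
  clinear_compose[OF clinear_cinner_left]

section \<open>Bialgebra axioms for the dual coproduct, by adjoints\<close>

lemma cinner_m:
  "cinner (m x y) (\<iota> g) = tensor_lift (\<lambda>a b. cinner y (\<iota> a) * cinner x (\<iota> b)) (\<Delta> g)"
  by (cases x rule: \<iota>_cases, cases y rule: \<iota>_cases) (simp add: m_\<iota> cinner_\<iota> integral_convolution_star)

text \<open>Tested against g \<otimes> f, the element D(h * k) gives the integral of (h * k) star(g)
  star(f), which duality splits along \<Delta>(star g) \<Delta>(star f). The factorwise product of D
  h and D k splits in the same way, its adjoint being \<Delta> \<otimes> \<Delta> with legs
  regrouped.\<close>

lemma comult_homomorphism_D: "comult_homomorphism ht m D"
proof -
  \<comment> \<open>The factorwise product is extended from simple tensors by frame expansion, in s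
    and then in t.\<close>
  define P where "P = (\<lambda>s t. \<Sum>p\<in>B \<times> B. cinner s (ht (\<iota> (fst p)) (\<iota> (snd p))) *\<^sub>C
    (\<Sum>q\<in>B \<times> B. cinner t (ht (\<iota> (fst q)) (\<iota> (snd q))) *\<^sub>C
      ht (m (\<iota> (fst p)) (\<iota> (fst q))) (m (\<iota> (snd p)) (\<iota> (snd q)))))"
  have P: "cbilinear P"
    unfolding P_def by (intro clinear_intros clinear_sum_fun clinear_cinner_left)
  have ex: "(\<Sum>p\<in>B \<times> B. cinner (ht a c) (ht (\<iota> (fst p)) (\<iota> (snd p))) *\<^sub>C \<beta> (\<iota> (fst p)) (\<iota> (snd p)))
      = \<beta> a c" if "cbilinear \<beta>" for \<beta> :: "'l \<Rightarrow> 'l \<Rightarrow> 't" and a c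
    by (simp add: parseval_frame_cbilinear[OF frame that, of a c] cinner_ht sum.cartesian_product case_prod_unfold)
  have P_ht: "P (ht a b) (ht c d) = ht (m a c) (m b d)" for a b c d
  proof -
    have "cbilinear (\<lambda>x y. ht (m p x) (m q y))" for p q by (intro clin_L)
    note 1 = ex[OF this]
    have "cbilinear (\<lambda>x y. ht (m x c) (m y d))" by (intro clin_L)
    note 2 = ex[OF this]
    show ?thesis unfolding P_def by (simp add: 1 2)
  qed
  have pair: "cinner (P s t) (ht (\<iota> g) (\<iota> f)) = tensor_lift (\<lambda>p q. tensor_lift (\<lambda>u v.
      cinner s (ht (\<iota> q) (\<iota> v)) * cinner t (ht (\<iota> p) (\<iota> u))) (\<Delta> f)) (\<Delta> g)" for s t g f
  proof (rule tensor_eqI[where t = s])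
    show "clinear (\<lambda>s. cinner (P s t) (ht (\<iota> g) (\<iota> f)))"
      by (intro clin_L cbilinear_left[OF P])
    fix a b
    show "cinner (P (ht a b) t) (ht (\<iota> g) (\<iota> f)) = tensor_lift (\<lambda>p q. tensor_lift (\<lambda>u v.
      cinner (ht a b) (ht (\<iota> q) (\<iota> v)) * cinner t (ht (\<iota> p) (\<iota> u))) (\<Delta> f)) (\<Delta> g)"
    proof (rule tensor_eqI[where t = t])
      fix c d
      show "cinner (P (ht a b) (ht c d)) (ht (\<iota> g) (\<iota> f)) = tensor_lift (\<lambda>p q. tensor_lift (\<lambda>u v.
        cinner (ht a b) (ht (\<iota> q) (\<iota> v)) * cinner (ht c d) (ht (\<iota> p) (\<iota> u))) (\<Delta> f)) (\<Delta> g)"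
        by (simp add: P_ht cinner_ht cinner_m tensor_lift_times ac_simps)
    qed (intro clin_L cbilinear_right[OF P])+
  qed (intro clin_L)
  have "D (m (\<iota> h) (\<iota> k)) = P (D (\<iota> h)) (D (\<iota> k))" for h k
  proof (rule eqI_ht)
    fix g f
    have b: "cbilinear (\<lambda>a b. I (k * a) * I (h * b))" by (intro clin)
    have b1: "cbilinear (\<lambda>a b. tensor_lift (\<lambda>c d. I (k * (a * star c)) * I (h * (b * star d))) (\<Delta> f))"
      by (intro clin)
    have b2: "cbilinear (\<lambda>c d. I (k * (a * c)) * I (h * (b * d)))" for a b by (intro clin)
    have "cinner (D (m (\<iota> h) (\<iota> k))) (ht (\<iota> g) (\<iota> f)) = I (conv h k * (star g * star f))"
      by (simp add: m_\<iota> cinner_D mult.assoc)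
    also have "\<dots> = tensor_lift (\<lambda>p q. tensor_lift (\<lambda>u v.
        I (k * (star p * star u)) * I (h * (star q * star v))) (\<Delta> f)) (\<Delta> g)"
      by (simp add: integral_convolution comult_mult_lift[OF b] comult_star_lift[OF b1] comult_star_lift[OF b2])
    also have "\<dots> = cinner (P (D (\<iota> h)) (D (\<iota> k))) (ht (\<iota> g) (\<iota> f))"
      by (simp add: pair cinner_D mult.assoc mult.commute)
    finally show "cinner (D (m (\<iota> h) (\<iota> k))) (ht (\<iota> g) (\<iota> f)) = cinner (P (D (\<iota> h)) (D (\<iota> k))) (ht (\<iota> g) (\<iota> f))" .
  qed
  then have "D (m a b) = P (D a) (D b)" for a b
    by (cases a rule: \<iota>_cases, cases b rule: \<iota>_cases) simp
  moreover have "bounded_cbilinear P"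
    by (rule parseval_frame_bounded_cbilinear[OF parseval_frame_tensor[OF frame ht] P])
  ultimately show ?thesis
    unfolding comult_homomorphism_def using bounded_clinear_D P_ht by blast
qed

text \<open>The adjoints of F and G send g \<otimes> f \<otimes> k to fg \<otimes> k and to g
  \<otimes> kf; the order is reversed because \<open>star\<close> reverses products. Pairing with D
  h then gives the integral of h star(kfg) in both cases, by associativity of H.\<close>

lemma coassociative_D:
  fixes htl :: "'t \<Rightarrow> 'l \<Rightarrow> 'u::complex_hilbert_space"
  assumes "hilbert_tensor_powers ht htl htr"
  shows "coassociative ht htl htr D"
proof -
  have htl: "hilbert_tensor_product htl" and htr: "hilbert_tensor_product htr"
    and lr: "htl (ht a b) c = htr a (ht b c)" for a b c
    using assms by (auto simp: hilbert_tensor_powers_def)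
  note htl = hilbert_tensor_productD[OF htl] and htr = hilbert_tensor_productD[OF htr]
  have "cbilinear (\<lambda>a b. htl (D a) b)" "cbilinear (\<lambda>a b. htr a (D b))"
    by (intro cbilinearI cbilinear_left[OF htl(1)] cbilinear_right[OF htl(1)] cbilinear_left[OF htr(1)]
        cbilinear_right[OF htr(1)] clinear_D clinear_id)+
  then obtain F G where F: "hilbert_extension ht (\<lambda>a b. htl (D a) b) F"
    and G: "hilbert_extension ht (\<lambda>a b. htr a (D b)) G"
    using extension_exists by blast
  have eqI: "x = y" if eq: "\<And>g f k. cinner x (htl (ht (\<iota> g) (\<iota> f)) (\<iota> k)) = cinner y (htl (ht (\<iota> g) (\<iota> f)) (\<iota> k))" for x y
  proof (rule cinner_eqI[OF htl(3)], safe)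
    fix t z
    obtain k where z: "z = \<iota> k" by (rule \<iota>_cases)
    have "cinner (htl t z) x = cinner (htl t z) y"
    proof (rule tensor_eqI)
      fix a b
      show "cinner (htl (ht a b) z) x = cinner (htl (ht a b) z) y"
        using eq by (cases a rule: \<iota>_cases, cases b rule: \<iota>_cases)
          (simp add: z cinner_commute[of "htl _ _"])
    qed (intro clinear_compose[OF clinear_cinner_left] cbilinear_left[OF htl(1)] clinear_id)+
    then show "cinner x (htl t z) = cinner y (htl t z)"
      by (simp add: cinner_commute[of _ "htl _ _"])
  qed
  have cF: "cinner (F t) (htl (ht (\<iota> g) (\<iota> f)) (\<iota> k)) = cinner t (ht (\<iota> (f * g)) (\<iota> k))" for t g f k
  proof (rule tensor_eqI[where t = t])
    fix a b
    show "cinner (F (ht a b)) (htl (ht (\<iota> g) (\<iota> f)) (\<iota> k)) = cinner (ht a b) (ht (\<iota> (f * g)) (\<iota> k))"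
      by (cases a rule: \<iota>_cases)
        (simp add: hilbert_extensionD(2)[OF F] htl(2) cinner_ht cinner_D cinner_\<iota> star_mult mult.assoc)
  qed (intro clinear_compose[OF clinear_cinner_left] hilbert_extensionD(1)[OF F] clinear_id)+
  have cG: "cinner (G t) (htl (ht (\<iota> g) (\<iota> f)) (\<iota> k)) = cinner t (ht (\<iota> g) (\<iota> (k * f)))" for t g f k
  proof (rule tensor_eqI[where t = t])
    fix a b
    show "cinner (G (ht a b)) (htl (ht (\<iota> g) (\<iota> f)) (\<iota> k)) = cinner (ht a b) (ht (\<iota> g) (\<iota> (k * f)))"
      by (cases b rule: \<iota>_cases)
        (simp add: hilbert_extensionD(2)[OF G] lr htr(2) cinner_ht cinner_D cinner_\<iota> star_mult mult.assoc)
  qed (intro clinear_compose[OF clinear_cinner_left] hilbert_extensionD(1)[OF G] clinear_id)+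
  have "F (D a) = G (D a)" for a
    by (rule eqI, cases a rule: \<iota>_cases) (simp add: cF cG cinner_D star_mult mult.assoc)
  then show ?thesis unfolding coassociative_def using F G by blast
qed

context
  fixes \<epsilon>\<^sub>L :: "'l \<Rightarrow> complex"
  assumes \<epsilon>\<^sub>L: "integral_extension I \<iota> \<epsilon>\<^sub>L"
begin

lemma clinear_\<epsilon>\<^sub>L: "clinear \<epsilon>\<^sub>L" and \<epsilon>\<^sub>L_\<iota>: "\<epsilon>\<^sub>L (\<iota> f) = I f"
  using \<epsilon>\<^sub>L by (simp_all add: integral_extension_def bounded_clinear_def)

lemma \<epsilon>\<^sub>L_cinner: "\<epsilon>\<^sub>L x = cinner x (\<iota> 1)"
  by (cases x rule: \<iota>_cases) (simp add: \<epsilon>\<^sub>L_\<iota> cinner_\<iota> star_one)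

text \<open>The counit is pairing with 1, so the adjoints of F and G insert a factor 1 into the
  product that D dualizes.\<close>

lemma counital_D: "counital ht D \<epsilon>\<^sub>L"
proof -
  have "cbilinear (\<lambda>a b :: 'l. \<epsilon>\<^sub>L a *\<^sub>C b)" "cbilinear (\<lambda>a b :: 'l. \<epsilon>\<^sub>L b *\<^sub>C a)"
    by (intro clinear_intros clinear_\<epsilon>\<^sub>L)+
  then obtain F G where F: "hilbert_extension ht (\<lambda>a b. \<epsilon>\<^sub>L a *\<^sub>C b) F"
    and G: "hilbert_extension ht (\<lambda>a b. \<epsilon>\<^sub>L b *\<^sub>C a) G"
    using extension_exists by blast
  have cF: "cinner (F t) (\<iota> f) = cinner t (ht (\<iota> 1) (\<iota> f))" for t f
    by (rule tensor_eqI[where t = t])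
      (intro clinear_compose[OF clinear_cinner_left] hilbert_extensionD(1)[OF F] clinear_id
        | simp add: hilbert_extensionD(2)[OF F] cinner_ht \<epsilon>\<^sub>L_cinner cinner_scaleC_left)+
  have cG: "cinner (G t) (\<iota> f) = cinner t (ht (\<iota> f) (\<iota> 1))" for t f
    by (rule tensor_eqI[where t = t])
      (intro clinear_compose[OF clinear_cinner_left] hilbert_extensionD(1)[OF G] clinear_id
        | simp add: hilbert_extensionD(2)[OF G] cinner_ht \<epsilon>\<^sub>L_cinner cinner_scaleC_left)+
  have "F (D a) = a" "G (D a) = a" for a
    by (rule eqI_\<iota>, cases a rule: \<iota>_cases, simp add: cF cG cinner_D cinner_\<iota> star_one)+
  then show ?thesis unfolding counital_def using F G by blast
qed

text \<open>A left unit represents the counit of H. From I(x y) = I((e * x) y) = I(x y_1) I(e y_2)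
  for all x, nondegeneracy gives y = y_1 I(e y_2); apply \<epsilon>.\<close>

lemma integral_unit:
  assumes "\<And>x. conv e x = x"
  shows "I (e * y) = \<epsilon> y"
proof -
  define z where "z = tensor_lift (\<lambda>a b. I (e * b) *\<^sub>C a) (\<Delta> y)"
  have "I (x * y) = I (x * z)" for x
    using integral_convolution[of e x y]
    by (simp add: assms z_def mult_tensor_lift_right mult_scaleC_right I_tensor_lift I_scaleC mult.commute)
  then have "star y = star z"
    by (intro integral_star_eqI) (simp add: star_star)
  then have "y = z" by (metis star_star)
  then have "\<epsilon> y = \<epsilon> z" by simp
  also have "\<dots> = tensor_lift (\<lambda>a b. I (e * b) * \<epsilon> a) (\<Delta> y)"
    by (simp add: z_def tensor_lift_clinear[OF clinear_counit] clinear_scaleC[OF clinear_counit]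
        scaleC_complex_def)
  also have "\<dots> = I (e * tensor_lift (\<lambda>a b. \<epsilon> a *\<^sub>C b) (\<Delta> y))"
    by (simp add: mult_tensor_lift_right mult_scaleC_right I_tensor_lift I_scaleC mult.commute)
  finally show ?thesis by (simp add: counit_left)
qed

text \<open>The Hilbert space adjoint of \<open>S\<close>.\<close>

definition T :: "'l \<Rightarrow> 'l"
  where "T x = (\<Sum>b\<in>B. cinner x (\<iota> (S b)) *\<^sub>C \<iota> b)"

lemma clinear_T: "clinear T"
  unfolding T_def[abs_def] by (intro clinear_sum_fun clinear_scaleC_left clinear_cinner_left)

lemma cinner_T: "cinner (T x) (\<iota> g) = cinner x (\<iota> (S g))"
proof -
  have "S g = (\<Sum>b\<in>B. I (g * star b) *\<^sub>C S b)"
    using arg_cong[OF expansion[of g], of S]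
    by (simp add: clinear_sum[OF clinear_antipode] clinear_scaleC[OF clinear_antipode])
  then have "cinner x (\<iota> (S g)) = cinner x (\<iota> (\<Sum>b\<in>B. I (g * star b) *\<^sub>C S b))" by simp
  also have "\<dots> = (\<Sum>b\<in>B. cnj (I (g * star b)) * cinner x (\<iota> (S b)))"
    by (simp add: clinear_sum[OF clinear_\<iota>] clinear_scaleC[OF clinear_\<iota>] cinner_sum_right cinner_scaleC_right)
  also have "\<dots> = cinner (T x) (\<iota> g)"
    by (simp add: T_def cinner_sum_left cinner_scaleC_left cinner_\<iota> hermitian[of _ g] mult.commute)
  finally show ?thesis by simp
qed

text \<open>The adjoint of Q sends g to S(g_2) \<otimes> g_1. Pairing with D h gives the integral of
  h star(g_1 S(g_2)), which is I(h) times the conjugate of \<epsilon>(g); by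
  \<open>integral_unit\<close> that conjugate is <e, g>. For R the other antipode identity
  appears.\<close>

lemma antipode_T:
  assumes e: "\<And>x. conv e x = x"
  shows "\<exists>Q. hilbert_extension ht (\<lambda>a b. m (T a) b) Q \<and> (\<forall>a. Q (D a) = \<epsilon>\<^sub>L a *\<^sub>C \<iota> e)"
    and "\<exists>Q. hilbert_extension ht (\<lambda>a b. m a (T b)) Q \<and> (\<forall>a. Q (D a) = \<epsilon>\<^sub>L a *\<^sub>C \<iota> e)"
proof -
  have star_sum: "tensor_lift (\<lambda>p q. I (h * star (\<gamma> p q))) t = I (h * star (tensor_lift \<gamma> t))" for h \<gamma> t
    by (simp add: star_tensor_lift mult_tensor_lift_right I_tensor_lift)
  have unit: "I (h * star (\<epsilon> g *\<^sub>C 1)) = cinner (\<epsilon>\<^sub>L (\<iota> h) *\<^sub>C \<iota> e) (\<iota> g)" for h g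
    by (simp add: cinner_scaleC_left cinner_\<iota> \<epsilon>\<^sub>L_\<iota> integral_unit[OF e] counit_star star_scaleC star_one
        mult_scaleC_right I_scaleC mult.commute)
  have "cbilinear (\<lambda>a b. m (T a) b)" "cbilinear (\<lambda>a b. m a (T b))"
    by (intro clin_L clinear_T)+
  then obtain Q R where Q: "hilbert_extension ht (\<lambda>a b. m (T a) b) Q"
    and R: "hilbert_extension ht (\<lambda>a b. m a (T b)) R"
    using extension_exists by blast
  have "cinner (Q t) (\<iota> g) = tensor_lift (\<lambda>p q. cinner t (ht (\<iota> (S q)) (\<iota> p))) (\<Delta> g)" for t g
    by (rule tensor_eqI[where t = t])
      (intro clin_L hilbert_extensionD(1)[OF Q]
        | simp add: hilbert_extensionD(2)[OF Q] cinner_m cinner_T cinner_ht mult.commute)+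
  then have "cinner (Q (D (\<iota> h))) (\<iota> g) = cinner (\<epsilon>\<^sub>L (\<iota> h) *\<^sub>C \<iota> e) (\<iota> g)" for h g
    by (simp add: cinner_D mult.assoc star_mult[symmetric] star_sum antipode_right unit)
  then have "Q (D a) = \<epsilon>\<^sub>L a *\<^sub>C \<iota> e" for a
    by (cases a rule: \<iota>_cases) (auto intro: eqI_\<iota>)
  with Q show "\<exists>Q. hilbert_extension ht (\<lambda>a b. m (T a) b) Q \<and> (\<forall>a. Q (D a) = \<epsilon>\<^sub>L a *\<^sub>C \<iota> e)" by blast
  have "cinner (R t) (\<iota> g) = tensor_lift (\<lambda>p q. cinner t (ht (\<iota> q) (\<iota> (S p)))) (\<Delta> g)" for t g
    by (rule tensor_eqI[where t = t])
      (intro clin_L hilbert_extensionD(1)[OF R]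
        | simp add: hilbert_extensionD(2)[OF R] cinner_m cinner_T cinner_ht mult.commute)+
  then have "cinner (R (D (\<iota> h))) (\<iota> g) = cinner (\<epsilon>\<^sub>L (\<iota> h) *\<^sub>C \<iota> e) (\<iota> g)" for h g
    by (simp add: cinner_D mult.assoc star_mult[symmetric] star_sum antipode_left unit)
  then have "R (D a) = \<epsilon>\<^sub>L a *\<^sub>C \<iota> e" for a
    by (cases a rule: \<iota>_cases) (auto intro: eqI_\<iota>)
  with R show "\<exists>Q. hilbert_extension ht (\<lambda>a b. m a (T b)) Q \<and> (\<forall>a. Q (D a) = \<epsilon>\<^sub>L a *\<^sub>C \<iota> e)" by blast
qed

section \<open>A genuine unit and the approximate antipode\<close>

context
  fixes \<Lambda> :: "'i set" and V :: "'i \<Rightarrow> 'h set" and \<delta> o' and e :: "'i set \<Rightarrow> 'h"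
  assumes classes: "simple_comodule_classes \<Delta> \<epsilon> \<Lambda> V \<delta> o'"
    and units: "\<And>K. K \<in> C\<^sub>0 \<Lambda> o' \<Longrightarrow> convolution_unit conv (coefficient_sum V \<delta> K) (e K)"
begin

text \<open>The finite frame B lies in one H_K and spans H. The corresponding e_K is therefore a
  true unit for convolution.\<close>

lemma coefficient_sum_eq_UNIV: "\<exists>K\<in>C\<^sub>0 \<Lambda> o'. coefficient_sum V \<delta> K = UNIV"
proof -
  have "\<exists>K\<in>C\<^sub>0 \<Lambda> o'. X \<subseteq> coefficient_sum V \<delta> K" if "finite X" for X
    using that
  proof induction
    case empty
    then show ?case using in_coefficient_sum[OF classes cosemisimple] by blast
  next
    case (insert x X)
    then obtain K where K: "K \<in> C\<^sub>0 \<Lambda> o'" "X \<subseteq> coefficient_sum V \<delta> K" by blast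
    obtain L where L: "L \<in> C\<^sub>0 \<Lambda> o'" "x \<in> coefficient_sum V \<delta> L"
      using in_coefficient_sum[OF classes cosemisimple] by blast
    have "insert x X \<subseteq> coefficient_sum V \<delta> (K \<union> L)"
      using K L coefficient_sum_mono[OF classes, of K "K \<union> L"]
        coefficient_sum_mono[OF classes, of L "K \<union> L"] by auto
    then show ?case using K L by (intro bexI[of _ "K \<union> L"]) (auto simp: C\<^sub>0_def)
  qed
  from this[OF finite_B] obtain K where K: "K \<in> C\<^sub>0 \<Lambda> o'" "B \<subseteq> coefficient_sum V \<delta> K" by blast
  have "h \<in> coefficient_sum V \<delta> K" for h
    by (subst expansion, unfold coefficient_sum_def)
      (intro complex_vector.span_sum complex_vector.span_scale,
        use K(2) in \<open>auto simp: coefficient_sum_def\<close>)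
  then show ?thesis using K(1) by blast
qed

text \<open>With the true unit e_L, the map T satisfies the ordinary antipode identities with value
  e_L. Multiplying them by e_K replaces e_L by e_K * e_L = e_K.\<close>

lemma approximate_antipode_T:
  "approximate_antipode ht m (C\<^sub>0 \<Lambda> o') (\<lambda>K. \<iota> (e K)) D \<epsilon>\<^sub>L (\<lambda>K x. m (\<iota> (e K)) (T x))"
proof -
  obtain L where L: "L \<in> C\<^sub>0 \<Lambda> o'" "coefficient_sum V \<delta> L = UNIV"
    using coefficient_sum_eq_UNIV by blast
  have unit: "conv (e L) x = x" "conv x (e L) = x" for x
    using units[OF L(1)] L(2) by (simp_all add: convolution_unit_def)
  obtain M where M: "hilbert_extension ht m M"
    using extension_exists[OF cbilinear_m] by blast
  obtain Q where Q: "hilbert_extension ht (\<lambda>a b. m (T a) b) Q" "\<And>a. Q (D a) = \<epsilon>\<^sub>L a *\<^sub>C \<iota> (e L)"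
    using antipode_T(1)[OF unit(1)] by blast
  obtain R where R: "hilbert_extension ht (\<lambda>a b. m a (T b)) R" "\<And>a. R (D a) = \<epsilon>\<^sub>L a *\<^sub>C \<iota> (e L)"
    using antipode_T(2)[OF unit(1)] by blast
  have "bounded_clinear (\<lambda>x. m (\<iota> (e K)) (T x))
      \<and> (\<exists>F G. hilbert_extension ht (\<lambda>a b. ht (m (\<iota> (e K)) (T a)) b) F
             \<and> hilbert_extension ht (\<lambda>a b. ht a (m (\<iota> (e K)) (T b))) G
             \<and> (\<forall>a. M (F (D a)) = \<epsilon>\<^sub>L a *\<^sub>C \<iota> (e K) \<and> M (G (D a)) = \<epsilon>\<^sub>L a *\<^sub>C \<iota> (e K)))"
    if K: "K \<in> C\<^sub>0 \<Lambda> o'" for K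
  proof
    let ?e = "\<iota> (e K)"
    have S: "clinear (\<lambda>x. m ?e (T x))" by (intro clin_L clinear_T)
    then show "bounded_clinear (\<lambda>x. m ?e (T x))" by (rule parseval_frame_bounded_clinear[OF frame])
    have "cbilinear (\<lambda>a b. ht (m ?e (T a)) b)" "cbilinear (\<lambda>a b. ht a (m ?e (T b)))"
      by (intro clin_L clinear_T)+
    then obtain F G where F: "hilbert_extension ht (\<lambda>a b. ht (m ?e (T a)) b) F"
      and G: "hilbert_extension ht (\<lambda>a b. ht a (m ?e (T b))) G"
      using extension_exists by blast
    have e: "m ?e (\<iota> (e L)) = ?e" by (simp add: m_\<iota> unit)
    have central: "m x ?e = m ?e x" for x by (rule m_e_central[OF classes units K])
    have MF: "M (F t) = m ?e (Q t)" for t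
      by (rule tensor_eqI[where t = t])
        (intro clinear_compose[OF hilbert_extensionD(1)[OF M]] hilbert_extensionD(1)[OF F]
            cbilinear_right[OF cbilinear_m] hilbert_extensionD(1)[OF Q(1)]
          | simp add: hilbert_extensionD(2)[OF M] hilbert_extensionD(2)[OF F] hilbert_extensionD(2)[OF Q(1)] m_assoc)+
    \<comment> \<open>Here e_K stands between a and T b; centrality moves it to the front.\<close>
    have MG: "M (G t) = m ?e (R t)" for t
      by (rule tensor_eqI[where t = t])
        (intro clinear_compose[OF hilbert_extensionD(1)[OF M]] hilbert_extensionD(1)[OF G]
            cbilinear_right[OF cbilinear_m] hilbert_extensionD(1)[OF R(1)]
          | simp add: hilbert_extensionD(2)[OF M] hilbert_extensionD(2)[OF G] hilbert_extensionD(2)[OF R(1)]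
              m_assoc[symmetric] central)+
    show "\<exists>F G. hilbert_extension ht (\<lambda>a b. ht (m ?e (T a)) b) F
             \<and> hilbert_extension ht (\<lambda>a b. ht a (m ?e (T b))) G
             \<and> (\<forall>a. M (F (D a)) = \<epsilon>\<^sub>L a *\<^sub>C ?e \<and> M (G (D a)) = \<epsilon>\<^sub>L a *\<^sub>C ?e)"
      using F G by (intro exI[of _ F] exI[of _ G]) (simp add: MF MG Q(2) R(2) m_scaleC e)
  qed
  then show ?thesis unfolding approximate_antipode_def using M by blast
qed

lemma hopf_algebra_with_approximate_unit_D:
  fixes htl :: "'t \<Rightarrow> 'l \<Rightarrow> 'u::complex_hilbert_space"
  assumes "hilbert_tensor_powers ht htl htr"
  shows "hopf_algebra_with_approximate_unit ht htl htr m (C\<^sub>0 \<Lambda> o') (\<lambda>K. \<iota> (e K)) D \<epsilon>\<^sub>L"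
  unfolding hopf_algebra_with_approximate_unit_def bialgebra_with_approximate_unit_def
  using algebra_with_approximate_unit_m[OF classes units] counit_homomorphism_integral[OF classes units \<epsilon>\<^sub>L]
    comult_homomorphism_D coassociative_D[OF assms] counital_D approximate_antipode_T by blast

end

end

end

theorem theorem3p4:
  fixes \<Delta> :: "'h::complex_algebra_1 \<Rightarrow> ('h, 'h) tensor"
    and \<epsilon> :: "'h \<Rightarrow> complex" and S star :: "'h \<Rightarrow> 'h" and I :: "'h \<Rightarrow> complex"
    and \<Lambda> :: "'i set" and V :: "'i \<Rightarrow> 'h set" and \<delta> :: "'i \<Rightarrow> 'h \<Rightarrow> ('h, 'h) tensor" and o' :: 'i
    and \<iota> :: "'h \<Rightarrow> 'l::complex_hilbert_space"
    and ht :: "'l \<Rightarrow> 'l \<Rightarrow> 't::complex_hilbert_space"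
    and htl :: "'t \<Rightarrow> 'l \<Rightarrow> 'u::complex_hilbert_space" and htr :: "'l \<Rightarrow> 't \<Rightarrow> 'u"
    and m :: "'l \<Rightarrow> 'l \<Rightarrow> 'l" and e :: "'i set \<Rightarrow> 'h" and \<epsilon>\<^sub>L :: "'l \<Rightarrow> complex"
  assumes "compact_hopf_star_algebra \<Delta> \<epsilon> S star"
    and "normalized_integral \<Delta> I"
    and "simple_comodule_classes \<Delta> \<epsilon> \<Lambda> V \<delta> o'"
    and "hilbert_completion (\<lambda>a b. I (a * star b)) \<iota>"
    and "hilbert_tensor_powers ht htl htr"
    and "convolution_extension (convolution \<Delta> S I) \<iota> m"
    and "\<And>K. K \<in> C\<^sub>0 \<Lambda> o' \<Longrightarrow> convolution_unit (convolution \<Delta> S I) (coefficient_sum V \<delta> K) (e K)"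
    and "integral_extension I \<iota> \<epsilon>\<^sub>L"
  shows "algebra_with_approximate_unit m (C\<^sub>0 \<Lambda> o') (\<lambda>K. \<iota> (e K))
    \<and> counit_homomorphism m (C\<^sub>0 \<Lambda> o') (\<lambda>K. \<iota> (e K)) \<epsilon>\<^sub>L
    \<and> (\<forall>\<Delta>\<^sub>L. convolution_comult I star \<iota> ht \<Delta>\<^sub>L \<longrightarrow>
          hopf_algebra_with_approximate_unit ht htl htr m (C\<^sub>0 \<Lambda> o') (\<lambda>K. \<iota> (e K)) \<Delta>\<^sub>L \<epsilon>\<^sub>L)"
proof -
  interpret compact_hopf_star_algebra \<Delta> \<epsilon> S star by (rule assms(1))
  interpret convolution_completion \<Delta> \<epsilon> S star I \<iota> m
  proof unfold_locales
    show "I (a * star b) = cnj (I (b * star a))" for a b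
      by (rule hilbert_completion_hermitian[OF assms(4)])
    show "a = 0" if "I (a * star a) = 0" for a
      by (rule hilbert_completion_definite[OF assms(4) that])
  qed (fact assms)+
  \<comment> \<open>The coproduct is fixed only from here on, so the finite dimension that it forces
    stays confined to this claim.\<close>
  have "hopf_algebra_with_approximate_unit ht htl htr m (C\<^sub>0 \<Lambda> o') (\<lambda>K. \<iota> (e K)) \<Delta>\<^sub>L \<epsilon>\<^sub>L"
    if "convolution_comult I star \<iota> ht \<Delta>\<^sub>L" for \<Delta>\<^sub>L
  proof -
    interpret convolution_comult_completion \<Delta> \<epsilon> S star I \<iota> m ht \<Delta>\<^sub>L
      by unfold_locales (use assms(5) that in \<open>auto simp: hilbert_tensor_powers_def\<close>)
    show ?thesis
      by (rule hopf_algebra_with_approximate_unit_D[OF assms(8,3,7,5)])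
  qed
  then show ?thesis
    using algebra_with_approximate_unit_m[OF assms(3,7)] counit_homomorphism_integral[OF assms(3,7,8)]
    by blast
qed

end
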